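(* For every $k\ge1$, the open Toda lattice $V_{2k-1}$ of dimension $2k-1$ is a bihamiltonian structure which is generically Kronecker of type $(2k-1)$; that is, on an open dense subset of $V_{2k-1}$ it is a Kronecker bihamiltonian structure of type $(2k-1)$.
   Context: A bihamiltonian structure is a manifold with two Poisson brackets $\{,\}_1,\{,\}_2$ such that $\lambda_1\{,\}_1+\lambda_2\{,\}_2$ is Poisson for all $\lambda_1,\lambda_2$. The open Toda lattice $V_{2k-1}$ is the vector space over $\mathbb C$ with coordinates $v_0,\dots,v_{2k-2}$ and the following two compatible Poisson brackets. The bracket $\{,\}_1$ is given by $\{v_i,v_j\}_1=0$ for $|i-j|>1$ and $\{v_{2l},v_{2l\pm1}\}_1=\mp v_{2l\pm1}$. The bracket $\{,\}_2$ is given by $\{v_i,v_j\}_2=0$ for $|i-j|>2$ and $$\{v_{2l},v_{2l\pm1}\}_2=\mp v_{2l}v_{2l\pm1},\quad \{v_{2l},v_{2l+2}\}_2=-2v_{2l+1}^2,\quad \{v_{2l-1},v_{2l+1}\}_2=-\tfrac12 v_{2l-1}v_{2l+1},$$ for all $l$ for which the left-hand sides make sense. A bihamiltonian structure on a vector space is translation-invariant if both brackets are invariant under parallel translations. It is decomposable if it is isomorphic to a direct product of two bihamiltonian structures of positive dimension. A bihamiltonian structure is Kronecker of type $(d_1,\dots,d_s)$ if near each point it is isomorphic to an open subset of a direct product of translation-invariant indecomposable structures of odd dimensions $d_1,\dots,d_s$. The unique (up to isomorphism) translation-invariant indecomposable structure of dimension $2k-1$ has coordinates $x_0,\dots,x_{2k-2}$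 with $\{x_{2l},x_{2l+1}\}_1=1$, $\{x_{2l+1},x_{2l+2}\}_2=1$, $0\le l\le k-2$, all other brackets of coordinates being zero. Isomorphisms here are local biholomorphisms preserving both brackets. *)

theory Defs
  imports "HOL-Analysis.Analysis"
begin

text \<open>
  All structures live on open subsets of coordinate spaces over \<open>\<complex>\<close>. To be able to quantify over
  dimensions, a coordinate space of dimension \<open>d\<close> is represented as the subspace of
  \<^typ>\<open>complex^'n\<close> spanned by the coordinates in a set \<open>I\<close> with \<open>d\<close> elements. Domains are
  relatively open in such a subspace; the full space is the case \<open>I = UNIV\<close>.
\<close>

definition cspace :: "'n set \<Rightarrow> (complex^'n::finite) set" where
  "cspace I = {x. \<forall>i. i \<notin> I \<longrightarrow> x $ i = 0}"

definition cproj :: "'n set \<Rightarrow> complex^'n::finite \<Rightarrow> complex^'n" where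
  "cproj I x = (\<chi> i. if i \<in> I then x $ i else 0)"

abbreviation open_dom :: "'n set \<Rightarrow> (complex^'n::finite) set \<Rightarrow> bool" where
  "open_dom I U \<equiv> openin (top_of_set (cspace I)) U"

text \<open>Holomorphic functions of several variables: everywhere complex differentiable.\<close>

definition holo :: "(complex^'n::finite) set \<Rightarrow> (complex^'n \<Rightarrow> complex) \<Rightarrow> bool" where
  "holo U f \<longleftrightarrow>
     (\<forall>x\<in>U. \<exists>D. (f has_derivative D) (at x within U) \<and> (\<forall>c h. D (c *s h) = c * D h))"

definition pd :: "'n \<Rightarrow> (complex^'n::finite \<Rightarrow> complex) \<Rightarrow> complex^'n \<Rightarrow> complex" where
  "pd i f x = deriv (\<lambda>t. f (x + axis i t)) 0"

text \<open>
  A skew biderivation of holomorphic functions is determined by its values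
  \<open>P x i j = {x\<^sub>i, x\<^sub>j}(x)\<close> on coordinates. So a bracket is given by \<open>P\<close>, and the Leibniz rule is
  built in; skew-symmetry and the Jacobi identity are imposed on all local holomorphic functions.
  Only the values \<open>P x i j\<close> with \<open>i, j \<in> I\<close> matter.
\<close>

type_synonym 'n tensor = "complex^'n \<Rightarrow> 'n \<Rightarrow> 'n \<Rightarrow> complex"

definition bracket ::
  "'n::finite set \<Rightarrow> 'n tensor \<Rightarrow> (complex^'n \<Rightarrow> complex) \<Rightarrow> (complex^'n \<Rightarrow> complex) \<Rightarrow>
     complex^'n \<Rightarrow> complex" where
  "bracket I P f g x = (\<Sum>i\<in>I. \<Sum>j\<in>I. P x i j * pd i f x * pd j g x)"

definition poisson_on :: "'n::finite set \<Rightarrow> (complex^'n) set \<Rightarrow> 'n tensor \<Rightarrow> bool" where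
  "poisson_on I U P \<longleftrightarrow>
     (\<forall>i\<in>I. \<forall>j\<in>I. holo U (\<lambda>x. P x i j)) \<and>
     (\<forall>W f g. open_dom I W \<and> W \<subseteq> U \<and> holo W f \<and> holo W g \<longrightarrow>
        (\<forall>x\<in>W. bracket I P f g x = - bracket I P g f x)) \<and>
     (\<forall>W f g h. open_dom I W \<and> W \<subseteq> U \<and> holo W f \<and> holo W g \<and> holo W h \<longrightarrow>
        (\<forall>x\<in>W. bracket I P (bracket I P f g) h x
              + bracket I P (bracket I P g h) f x
              + bracket I P (bracket I P h f) g x = 0))"

definition bihamiltonian ::
  "'n::finite set \<Rightarrow> (complex^'n) set \<Rightarrow> 'n tensor \<Rightarrow> 'n tensor \<Rightarrow> bool" where
  "bihamiltonian I U P Q \<longleftrightarrow>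
     open_dom I U \<and> poisson_on I U P \<and> poisson_on I U Q \<and>
     (\<forall>a b. poisson_on I U (\<lambda>x i j. a * P x i j + b * Q x i j))"

definition preserves_bracket ::
  "'n::finite set \<Rightarrow> (complex^'n \<Rightarrow> complex^'n) \<Rightarrow>
     (complex^'n) set \<Rightarrow> 'n tensor \<Rightarrow> (complex^'n) set \<Rightarrow> 'n tensor \<Rightarrow> bool" where
  "preserves_bracket I \<phi> U P V P' \<longleftrightarrow>
     (\<forall>W f g. open_dom I W \<and> W \<subseteq> V \<and> holo W f \<and> holo W g \<longrightarrow>
        (\<forall>x\<in>U. \<phi> x \<in> W \<longrightarrow> bracket I P (f \<circ> \<phi>) (g \<circ> \<phi>) x = bracket I P' f g (\<phi> x)))"

definition biham_iso ::
  "'n::finite set \<Rightarrow> (complex^'n \<Rightarrow> complex^'n) \<Rightarrow>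
     (complex^'n) set \<Rightarrow> 'n tensor \<Rightarrow> 'n tensor \<Rightarrow>
     (complex^'n) set \<Rightarrow> 'n tensor \<Rightarrow> 'n tensor \<Rightarrow> bool" where
  "biham_iso I \<phi> U P Q V P' Q' \<longleftrightarrow>
     open_dom I U \<and> open_dom I V \<and> bij_betw \<phi> U V \<and>
     (\<forall>i\<in>I. holo U (\<lambda>x. \<phi> x $ i)) \<and> (\<forall>i\<in>I. holo V (\<lambda>y. inv_into U \<phi> y $ i)) \<and>
     preserves_bracket I \<phi> U P V P' \<and> preserves_bracket I \<phi> U Q V Q'"

text \<open>Near \<open>x\<close>, the structure on \<open>U\<close> is isomorphic to an open subset of the one on \<open>V\<close>.\<close>

definition locally_isomorphic_at ::
  "'n::finite set \<Rightarrow> complex^'n \<Rightarrow>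
     (complex^'n) set \<Rightarrow> 'n tensor \<Rightarrow> 'n tensor \<Rightarrow>
     (complex^'n) set \<Rightarrow> 'n tensor \<Rightarrow> 'n tensor \<Rightarrow> bool" where
  "locally_isomorphic_at I x U P Q V P' Q' \<longleftrightarrow>
     (\<exists>\<phi> U' V'. x \<in> U' \<and> U' \<subseteq> U \<and> V' \<subseteq> V \<and> biham_iso I \<phi> U' P Q V' P' Q')"

text \<open>
  Direct products: the product of coordinate spaces with disjoint index sets \<open>Is ! m\<close> is the
  coordinate space of the union of the index sets.
\<close>

definition index_partition :: "'n set \<Rightarrow> 'n set list \<Rightarrow> bool" where
  "index_partition I Is \<longleftrightarrow>
     \<Union> (set Is) = I \<and> {} \<notin> set Is \<and>
     (\<forall>m<length Is. \<forall>l<length Is. m \<noteq> l \<longrightarrow> Is ! m \<inter> Is ! l = {})"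

definition prod_dom ::
  "'n::finite set list \<Rightarrow> (nat \<Rightarrow> (complex^'n) set) \<Rightarrow> (complex^'n) set" where
  "prod_dom Is Us =
     {x \<in> cspace (\<Union> (set Is)). \<forall>m<length Is. cproj (Is ! m) x \<in> Us m}"

definition prod_tensor :: "'n::finite set list \<Rightarrow> (nat \<Rightarrow> 'n tensor) \<Rightarrow> 'n tensor" where
  "prod_tensor Is Ps x i j =
     (\<Sum>m<length Is. if i \<in> Is ! m \<and> j \<in> Is ! m then Ps m (cproj (Is ! m) x) i j else 0)"

text \<open>
  Isomorphisms are local, so decomposability is understood near each point. The factors may then
  be taken to be open subsets of coordinate spaces, and, since the dimensions of the factors add
  up to the number of elements of \<open>I\<close>, their index sets may be taken to be the two parts of a
  partition of \<open>I\<close>. Nonempty parts give factors of positive dimension. For translation-invariant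
  structures on a vector space this is equivalent to global decomposability: the derivative of a
  local isomorphism at a point is a linear isomorphism onto a product of translation-invariant
  structures.
\<close>

definition decomposable ::
  "'n::finite set \<Rightarrow> (complex^'n) set \<Rightarrow> 'n tensor \<Rightarrow> 'n tensor \<Rightarrow> bool" where
  "decomposable I U P Q \<longleftrightarrow>
     (\<forall>x\<in>U. \<exists>Is Us Ps Qs. length Is = 2 \<and> index_partition I Is \<and>
        (\<forall>m<2. bihamiltonian (Is ! m) (Us m) (Ps m) (Qs m)) \<and>
        locally_isomorphic_at I x U P Q
          (prod_dom Is Us) (prod_tensor Is Ps) (prod_tensor Is Qs))"

definition translation_invariant :: "'n::finite set \<Rightarrow> 'n tensor \<Rightarrow> 'n tensor \<Rightarrow> bool" where
  "translation_invariant I P Q \<longleftrightarrow>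
     (\<forall>a\<in>cspace I. biham_iso I (\<lambda>x. x + a) (cspace I) P Q (cspace I) P Q)"

definition kronecker_of_type ::
  "nat list \<Rightarrow> 'n::finite set \<Rightarrow> (complex^'n) set \<Rightarrow> 'n tensor \<Rightarrow> 'n tensor \<Rightarrow> bool" where
  "kronecker_of_type ds I U P Q \<longleftrightarrow>
     bihamiltonian I U P Q \<and>
     (\<forall>x\<in>U. \<exists>Is As Bs. length Is = length ds \<and> index_partition I Is \<and>
        (\<forall>m<length ds.
           card (Is ! m) = ds ! m \<and> odd (ds ! m) \<and>
           bihamiltonian (Is ! m) (cspace (Is ! m)) (As m) (Bs m) \<and>
           translation_invariant (Is ! m) (As m) (Bs m) \<and>
           \<not> decomposable (Is ! m) (cspace (Is ! m)) (As m) (Bs m)) \<and>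
        locally_isomorphic_at I x U P Q
          (prod_dom Is (\<lambda>m. cspace (Is ! m))) (prod_tensor Is As) (prod_tensor Is Bs))"

text \<open>
  The Toda brackets of the coordinates \<open>v 0, v 1, \<dots>\<close>. The tables list the nonzero brackets in one
  of the two orders of the arguments only; the other order is given by skew-symmetry.
\<close>

definition toda_table1 :: "(nat \<Rightarrow> complex) \<Rightarrow> nat \<Rightarrow> nat \<Rightarrow> complex" where
  "toda_table1 v i j =
     (if even i \<and> j = i + 1 then - v j
      else if even i \<and> i = j + 1 then v j
      else 0)"

definition toda_table2 :: "(nat \<Rightarrow> complex) \<Rightarrow> nat \<Rightarrow> nat \<Rightarrow> complex" where
  "toda_table2 v i j =
     (if even i \<and> j = i + 1 then - (v i * v j)
      else if even i \<and> i = j + 1 then v i * v j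
      else if even i \<and> j = i + 2 then - 2 * (v (i + 1))^2
      else if odd i \<and> j = i + 2 then - (1/2) * v i * v j
      else 0)"

text \<open>
  The function \<open>c\<close> numbers the coordinates of \<^typ>\<open>complex^'n\<close>: it is meant to be a bijection
  onto \<open>{..<2 * k - 1}\<close>, and \<open>v\<^sub>m\<close> is the coordinate with number \<open>m\<close>.
\<close>

definition toda1 :: "('n::finite \<Rightarrow> nat) \<Rightarrow> 'n tensor" where
  "toda1 c x i j =
     (let v = (\<lambda>m. x $ inv c m)
      in toda_table1 v (c i) (c j) - toda_table1 v (c j) (c i))"

definition toda2 :: "('n::finite \<Rightarrow> nat) \<Rightarrow> 'n tensor" where
  "toda2 c x i j =
     (let v = (\<lambda>m. x $ inv c m)
      in toda_table2 v (c i) (c j) - toda_table2 v (c j) (c i))"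

end

theory Submission
  imports Defs "HOL-Complex_Analysis.Cauchy_Integral_Formula"
    "HOL-Computational_Algebra.Fundamental_Theorem_Algebra"
begin

text \<open>
  Let \<open>q\<close> be the characteristic polynomial of the Jacobi matrix with diagonal \<open>v\<^sub>0, v\<^sub>2, \<dots>\<close> and off-diagonal
  \<open>v\<^sub>1, v\<^sub>3, \<dots>\<close>, and let \<open>p\<close> be that of the matrix without its last row and column. By induction along the
  three-term recursion, for the bracket \<open>{,} = \<alpha> {,}\<^sub>1 + \<beta> {,}\<^sub>2\<close>,
  \<open>{q(x), q(y)} = {p(x), p(y)} = 0\<close> and
  \<open>{q(x), p(y)} = 2 (\<alpha> + \<beta> x) ((q(x) p(y) - q(y) p(x)) / (x - y) - p(x) p(y))\<close>.
  Near a point where the roots \<open>l\<^sub>j\<close> of \<open>q\<close> are distinct and the \<open>v\<^bsub>2m+1\<^esub>\<close> do not vanish, let \<open>a\<^sub>i\<close> be the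
  coefficients of \<open>q\<close> and put \<open>y\<^sub>m = 1/2 \<Sum>\<^sub>j l\<^sub>j\<^sup>m ln p(l\<^sub>j) / q'(l\<^sub>j)\<close> for \<open>m \<le> k - 2\<close>. Lagrange
  interpolation gives \<open>{q(x), y\<^sub>m} = (\<alpha> + \<beta> x) x\<^sup>m\<close> and \<open>{y\<^sub>m, y\<^sub>n} = 0\<close>, so \<open>(a, y)\<close> are coordinates in which
  both brackets are constant and form a Kronecker block. The Jacobi identities then hold on a dense set,
  hence everywhere.
\<close>

section \<open>Gradients and bilinear forms\<close>

text \<open>The factor \<open>\<alpha> + \<beta> * x\<close> in the mixed bracket makes
  q(-\<alpha>/\<beta>) a Casimir function of the bracket with these parameters, so the coefficients
  of q are natural flat coordinates, and conjugates to them are needed. At a root one gets {q(x), ln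
  p(l_j)} = 2 (\<alpha> + \<beta> x) (q(x)/(x - l_j) - p(x)). Weights g_j with sum zero remove p(x),
  and the Lagrange weights l_j^m / q'(l_j) also turn the first term into x^m. Both hold exactly for
  m <= k - 2, the factor 1/2 cancels the 2, and k + (k - 1) coordinates result. The weights vary
  with the point; the cross terms this creates in {y_m, y_n} cancel by a second interpolation.
  Holomorphy is only pointwise complex differentiability, while the Jacobi identity ranges over all
  local holomorphic functions. Continuity of first derivatives and symmetry of second ones therefore
  come from Cauchy estimates. Indecomposability must exclude every local product; linearizing at one
  point reduces it to the kernels of a pencil of skew forms.\<close>

definition has_grad :: "(complex^'n::finite \<Rightarrow> complex) \<Rightarrow> complex^'n \<Rightarrow> complex^'n \<Rightarrow> bool" where
  "has_grad f G x \<longleftrightarrow> (f has_derivative (\<lambda>h. \<Sum>i\<in>UNIV. G $ i * h $ i)) (at x)"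

definition grad :: "(complex^'n::finite \<Rightarrow> complex) \<Rightarrow> complex^'n \<Rightarrow> complex^'n" where
  "grad f x = (\<chi> i. pd i f x)"

lemma grad_nth [simp]: "grad f x $ i = pd i f x"
  by (simp add: grad_def)

lemma has_derivative_axis_line: "((\<lambda>t::complex. (x::complex^'n::finite) + axis i t) has_derivative (\<lambda>t. axis i t)) (at t)"
proof -
  have "bounded_linear (\<lambda>t::complex. axis i t :: complex^'n)"
    by (rule linear_conv_bounded_linear[THEN iffD1], rule linearI) (auto simp: axis_def vec_eq_iff)
  then have "((\<lambda>t::complex. axis i t :: complex^'n) has_derivative (\<lambda>t. axis i t)) (at t)"
    by (rule bounded_linear_imp_has_derivative)
  then show ?thesis
    by (rule has_derivative_add_const[where c = x, unfolded add.commute[of _ x]])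
qed

lemma sum_mult_axis [simp]: "(\<Sum>j\<in>UNIV. (G::complex^'n::finite) $ j * (axis i t) $ j) = G $ i * t"
  by (simp add: axis_def if_distrib cong: if_cong)

lemma sum_axis_mult [simp]: "(\<Sum>j\<in>UNIV. axis i t $ j * h j) = t * h (i::'n::finite)" for t :: complex
proof -
  have "(\<Sum>j\<in>UNIV. axis i t $ j * h j) = (\<Sum>j\<in>UNIV. if j = i then t * h j else 0)"
    by (rule sum.cong) (auto simp: axis_def)
  then show ?thesis by simp
qed

lemma axis_zero [simp]: "axis i 0 = 0"
  by (simp add: vec_eq_iff axis_def)

lemma has_grad_imp_line:
  assumes "has_grad f G (x + axis i s)"
  shows "((\<lambda>t. f (x + axis i t)) has_field_derivative G $ i) (at s)"
proof -
  have "((\<lambda>t. f (x + axis i t)) has_derivative (\<lambda>t. \<Sum>j\<in>UNIV. G $ j * (axis i t) $ j)) (at s)"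
    using has_derivative_compose[OF has_derivative_axis_line assms[unfolded has_grad_def]] .
  then show ?thesis
    by (simp add: has_field_derivative_def)
qed

lemma has_grad_pd: "has_grad f G x \<Longrightarrow> pd i f x = G $ i"
  unfolding pd_def by (rule DERIV_imp_deriv, rule has_grad_imp_line) simp

lemma has_grad_grad: "has_grad f G x \<Longrightarrow> grad f x = G"
  by (simp add: vec_eq_iff has_grad_pd)

lemma has_grad_unique: "has_grad f G x \<Longrightarrow> has_grad f H x \<Longrightarrow> G = H"
  using has_grad_grad by metis

text \<open>Openness turns the derivative within \<open>U\<close> into a full one. Real linearity
  together with complex homogeneity then determines it by its values on the axis vectors.\<close>

lemma holo_has_grad:
  assumes "open U" "holo U f" "x \<in> U"
  shows "has_grad f (grad f x) x"
proof -
  obtain D where D: "(f has_derivative D) (at x within U)" "\<And>c h. D (c *s h) = c * D h"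
    using assms(2,3) by (auto simp: holo_def)
  have D': "(f has_derivative D) (at x)"
    using D(1) at_within_open[OF assms(3,1)] by simp
  have lin: "linear D"
    using D(1) has_derivative_linear by blast
  have "D = (\<lambda>h. \<Sum>i\<in>UNIV. D (axis i 1) * h $ i)"
  proof
    fix h
    have "D h = D (\<Sum>i\<in>UNIV. h $ i *s axis i 1)"
      by (simp only: basis_expansion)
    also have "\<dots> = (\<Sum>i\<in>UNIV. h $ i * D (axis i 1))"
      using lin D(2) by (simp add: linear_sum)
    finally show "D h = (\<Sum>i\<in>UNIV. D (axis i 1) * h $ i)" by (simp add: mult.commute)
  qed
  from has_derivative_eq_rhs[OF D' this] have "has_grad f (\<chi> i. D (axis i 1)) x"
    unfolding has_grad_def by simp
  then show ?thesis using has_grad_grad by metis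
qed

lemma holoI:
  assumes "\<And>x. x \<in> U \<Longrightarrow> \<exists>G. has_grad f G x"
  shows "holo U f"
  unfolding holo_def
proof
  fix x assume "x \<in> U"
  then obtain G where "has_grad f G x" using assms by blast
  then have "(f has_derivative (\<lambda>h. \<Sum>i\<in>UNIV. G $ i * h $ i)) (at x within U)"
    unfolding has_grad_def by (rule has_derivative_at_withinI)
  moreover have "(\<Sum>i\<in>UNIV. G $ i * (c *s h) $ i) = c * (\<Sum>i\<in>UNIV. G $ i * h $ i)" for c h
    by (simp add: sum_distrib_left algebra_simps)
  ultimately show "\<exists>D. (f has_derivative D) (at x within U) \<and> (\<forall>c h. D (c *s h) = c * D h)"
    by blast
qed

lemma has_grad_continuous: "has_grad f G x \<Longrightarrow> isCont f x"
  unfolding has_grad_def by (rule has_derivative_continuous)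

lemma holo_continuous_on: "open U \<Longrightarrow> holo U f \<Longrightarrow> continuous_on U f"
  by (meson continuous_at_imp_continuous_on has_grad_continuous holo_has_grad)

lemma has_grad_const [simp]: "has_grad (\<lambda>x. c) 0 x"
  unfolding has_grad_def by simp

lemma has_grad_nth: "has_grad (\<lambda>x. x $ i) (axis i 1) (x :: complex^'n::finite)"
  unfolding has_grad_def
  by (simp add: bounded_linear_vec_nth bounded_linear_imp_has_derivative)

lemma has_grad_add:
  "has_grad f F x \<Longrightarrow> has_grad g G x \<Longrightarrow> has_grad (\<lambda>x. f x + g x) (F + G) x"
  unfolding has_grad_def
  by (drule (1) has_derivative_add) (simp add: algebra_simps sum.distrib)

lemma has_grad_diff:
  "has_grad f F x \<Longrightarrow> has_grad g G x \<Longrightarrow> has_grad (\<lambda>x. f x - g x) (F - G) x"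
  unfolding has_grad_def
  by (drule (1) has_derivative_diff) (simp add: algebra_simps sum_subtractf)

lemma has_grad_mult:
  assumes "has_grad f F x" "has_grad g G x"
  shows "has_grad (\<lambda>x. f x * g x) (f x *s G + g x *s F) x"
proof -
  have *: "((\<lambda>x. f x * g x) has_derivative (\<lambda>h. f x * (\<Sum>i\<in>UNIV. G $ i * h $ i) + (\<Sum>i\<in>UNIV. F $ i * h $ i) * g x)) (at x)"
    using assms unfolding has_grad_def by (rule has_derivative_mult)
  have "(\<lambda>h. f x * (\<Sum>i\<in>UNIV. G $ i * h $ i) + (\<Sum>i\<in>UNIV. F $ i * h $ i) * g x)
     = (\<lambda>h. \<Sum>i\<in>UNIV. (f x *s G + g x *s F) $ i * h $ i)"
    by (simp add: fun_eq_iff algebra_simps sum.distrib sum_distrib_left)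
  then show ?thesis using * unfolding has_grad_def by simp
qed

lemma has_grad_cmult: "has_grad f F x \<Longrightarrow> has_grad (\<lambda>x. c * f x) (c *s F) x"
  using has_grad_mult[OF has_grad_const[of c]] by (fastforce simp: vec_eq_iff)

lemma has_grad_uminus: "has_grad f F x \<Longrightarrow> has_grad (\<lambda>x. - f x) (- F) x"
  using has_grad_diff[OF has_grad_const[of 0]] by fastforce

lemma has_grad_sum:
  assumes "\<And>i. i \<in> A \<Longrightarrow> has_grad (f i) (F i) x"
  shows "has_grad (\<lambda>x. \<Sum>i\<in>A. f i x) (\<Sum>i\<in>A. F i) x"
  using assms by (induction A rule: infinite_finite_induct) (auto intro: has_grad_add)

lemma has_grad_compose_field:
  assumes "has_grad f F x" "(g has_field_derivative d) (at (f x))"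
  shows "has_grad (\<lambda>x. g (f x)) (d *s F) x"
proof -
  have "((\<lambda>x. g (f x)) has_derivative (\<lambda>h. d * (\<Sum>i\<in>UNIV. F $ i * h $ i))) (at x)"
    using has_derivative_compose[OF assms(1)[unfolded has_grad_def] assms(2)[unfolded has_field_derivative_def]]
    by simp
  then show ?thesis unfolding has_grad_def by (simp add: sum_distrib_left algebra_simps)
qed

lemma has_grad_power: "has_grad f F x \<Longrightarrow> has_grad (\<lambda>x. f x ^ n) ((of_nat n * f x ^ (n - 1)) *s F) x"
  by (erule has_grad_compose_field) (auto intro!: derivative_eq_intros)

lemma has_grad_transform:
  assumes "has_grad f F x" "open W" "x \<in> W" "\<And>y. y \<in> W \<Longrightarrow> f y = g y"
  shows "has_grad g F x"
  using assms unfolding has_grad_def by (rule has_derivative_transform_within_open)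

lemma has_derivative_vec_has_grad:
  assumes "\<And>i. has_grad (\<lambda>y. \<phi> y $ i) (A $ i) x"
  shows "(\<phi> has_derivative (\<lambda>h. A *v h)) (at x)"
proof -
  have "((\<lambda>y. \<phi> y $ i) has_derivative (\<lambda>h. (A *v h) $ i)) (at x)" for i
    using assms[of i] unfolding has_grad_def matrix_vector_mult_def by simp
  then show ?thesis
    by (subst has_derivative_componentwise_within)
       (auto simp: Basis_vec_def inner_axis intro!: has_derivative_inner_left)
qed

lemma has_grad_chain:
  assumes "\<And>i. has_grad (\<lambda>y. \<phi> y $ i) (A $ i) x" "has_grad f F (\<phi> x)"
  shows "has_grad (f \<circ> \<phi>) (\<Sum>i\<in>UNIV. F $ i *s A $ i) x"
proof -
  have "((\<lambda>y. f (\<phi> y)) has_derivative (\<lambda>h. \<Sum>i\<in>UNIV. F $ i * (A *v h) $ i)) (at x)"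
    using has_derivative_compose[OF has_derivative_vec_has_grad[of \<phi>, OF assms(1)] assms(2)[unfolded has_grad_def]] .
  moreover have "(\<Sum>i\<in>UNIV. F $ i * (A *v h) $ i) = (\<Sum>j\<in>UNIV. (\<Sum>i\<in>UNIV. F $ i *s A $ i) $ j * h $ j)" for h
  proof -
    have "(\<Sum>i\<in>UNIV. F $ i * (A *v h) $ i) = (\<Sum>i\<in>UNIV. \<Sum>j\<in>UNIV. F $ i * (A $ i $ j * h $ j))"
      by (simp add: matrix_vector_mult_def sum_distrib_left)
    also have "\<dots> = (\<Sum>j\<in>UNIV. \<Sum>i\<in>UNIV. F $ i * (A $ i $ j * h $ j))"
      by (rule sum.swap)
    also have "\<dots> = (\<Sum>j\<in>UNIV. (\<Sum>i\<in>UNIV. F $ i *s A $ i) $ j * h $ j)"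
      by (simp add: sum_distrib_right mult.assoc)
    finally show ?thesis .
  qed
  ultimately show ?thesis
    unfolding has_grad_def o_def by simp
qed

section \<open>Bilinear forms on covectors\<close>

text \<open>The value of a biderivation at one point, applied to differentials. It lets brackets be
  computed by linear algebra on gradients.\<close>

definition om :: "('n::finite \<Rightarrow> 'n \<Rightarrow> complex) \<Rightarrow> complex^'n \<Rightarrow> complex^'n \<Rightarrow> complex" where
  "om M u w = (\<Sum>i\<in>UNIV. \<Sum>j\<in>UNIV. M i j * u $ i * w $ j)"

lemma bracket_om: "bracket UNIV P f g x = om (P x) (grad f x) (grad g x)"
  by (simp add: bracket_def om_def)

lemma om_add_left [simp]: "om M (u + u') w = om M u w + om M u' w"
  and om_add_right [simp]: "om M u (w + w') = om M u w + om M u w'"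
  and om_diff_left [simp]: "om M (u - u') w = om M u w - om M u' w"
  and om_diff_right [simp]: "om M u (w - w') = om M u w - om M u w'"
  and om_zero_left [simp]: "om M 0 w = 0"
  and om_zero_right [simp]: "om M u 0 = 0"
  and om_scale_left [simp]: "om M (a *s u) w = a * om M u w"
  and om_scale_right [simp]: "om M u (a *s w) = a * om M u w"
  by (simp_all add: om_def algebra_simps sum.distrib sum_subtractf sum_distrib_left)

lemma om_minus_left [simp]: "om M (- u) w = - om M u w"
  and om_minus_right [simp]: "om M u (- w) = - om M u w"
  by (simp_all add: om_def sum_negf)

lemma om_sum_left: "om M (\<Sum>i\<in>A. u i) w = (\<Sum>i\<in>A. om M (u i) w)"
  by (induction A rule: infinite_finite_induct) auto

lemma om_sum_right: "om M u (\<Sum>i\<in>A. w i) = (\<Sum>i\<in>A. om M u (w i))"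
  by (induction A rule: infinite_finite_induct) auto

lemma om_axis: "om M (axis i 1) (axis j 1) = M i j"
proof -
  have "om M (axis i 1) (axis j 1) = (\<Sum>a\<in>UNIV. if a = i then M i j else 0)"
    unfolding om_def by (rule sum.cong) (auto simp: axis_def if_distrib cong: if_cong)
  then show ?thesis by simp
qed

lemma om_skew:
  assumes "\<And>i j. M i j = - M j i"
  shows "om M u w = - om M w u"
proof -
  have "om M u w = (\<Sum>j\<in>UNIV. \<Sum>i\<in>UNIV. M i j * u $ i * w $ j)"
    unfolding om_def by (rule sum.swap)
  also have "\<dots> = (\<Sum>j\<in>UNIV. \<Sum>i\<in>UNIV. - (M j i * w $ j * u $ i))"
    by (intro sum.cong refl) (subst assms, simp)
  also have "\<dots> = - om M w u" by (simp add: om_def sum_negf)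
  finally show ?thesis .
qed

lemma om_lincomb: "om (\<lambda>i j. a * M i j + b * N i j) u w = a * om M u w + b * om N u w"
  by (simp add: om_def algebra_simps sum.distrib sum_distrib_left)

section \<open>Second derivatives of holomorphic functions\<close>

lemma norm_vector_scalar_mult: "norm (t *s a) = cmod t * norm a" for a :: "complex^'n::finite"
  by (simp add: norm_vec_def norm_mult L2_set_right_distrib)

lemma norm_axis_cplx [simp]: "norm (axis i (t::complex) :: complex^'n::finite) = cmod t"
proof -
  have "axis i t = t *s (axis i 1 :: complex^'n)"
    by (simp add: vec_eq_iff axis_def)
  then show ?thesis by (simp add: norm_vector_scalar_mult)
qed

lemma holo_line:
  assumes "open U" "holo U f" "y + axis i s \<in> U"
  shows "((\<lambda>t. f (y + axis i t)) has_field_derivative pd i f (y + axis i s)) (at s)"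
  using has_grad_imp_line[OF holo_has_grad[OF assms]] by simp

text \<open>Taylor's formula along a coordinate line, with Cauchy's estimate for the second
  derivative. The point is that \<open>C\<close> and \<open>r\<close> do not depend on the base
  point \<open>y\<close>.\<close>

lemma holo_second_order_bound:
  assumes U: "open U" "holo U f" "x \<in> U"
  obtains r C where "0 < r" "ball x r \<subseteq> U"
    "\<And>y s. y \<in> ball x r \<Longrightarrow> cmod s < r \<Longrightarrow> y + axis i s \<in> U"
    "\<And>y s. y \<in> ball x r \<Longrightarrow> cmod s < r \<Longrightarrow>
       cmod (f (y + axis i s) - f y - pd i f y * s) \<le> C * (cmod s)\<^sup>2"
proof -
  obtain R where R: "R > 0" "cball x R \<subseteq> U"
    using U open_contains_cball by blast
  have "compact (f ` cball x R)"
    by (intro compact_continuous_image continuous_on_subset[OF holo_continuous_on[OF U(1,2)] R(2)] compact_cball)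
  then have "\<exists>M. \<forall>y\<in>cball x R. cmod (f y) < M"
    by (metis bounded_pos_less compact_imp_bounded imageI)
  then obtain M where M: "\<And>y. y \<in> cball x R \<Longrightarrow> cmod (f y) < M"
    by blast
  \<comment> \<open>A base point within \<open>r\<close> of \<open>x\<close> and a shift below
    \<open>3 * r\<close> stay within \<open>R\<close>; Cauchy discs of radius \<open>r\<close> about
    points of \<open>ball 0 r\<close> then fit inside \<open>ball 0 (3 * r)\<close>.\<close>
  define r where "r = R / 4"
  have r: "r > 0" using R by (simp add: r_def)
  have near: "y + axis i s \<in> cball x R" if "y \<in> ball x r" "cmod s < 3 * r" for y s
  proof -
    have "dist x (y + axis i s) \<le> dist x y + cmod s"
      using dist_triangle[of x "y + axis i s" y] by (simp add: dist_norm)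
    then show ?thesis using that by (simp add: r_def)
  qed
  have bound: "cmod (f (y + axis i s) - f y - pd i f y * s) \<le> (2 * M / r^2) * (cmod s)\<^sup>2"
    if y: "y \<in> ball x r" and s: "cmod s < r" for y s
  proof -
    define g where "g t = f (y + axis i t)" for t
    have gd: "(g has_field_derivative pd i f (y + axis i t)) (at t)" if "cmod t < 3 * r" for t
      unfolding g_def using holo_line[OF U(1,2)] near[OF y that] R(2) by blast
    have hol: "g holomorphic_on ball 0 (3 * r)"
      by (rule holomorphic_onI) (metis field_differentiable_at_within field_differentiable_def gd mem_ball_0)
    have hol': "deriv g holomorphic_on ball 0 (3 * r)"
      using hol by (simp add: holomorphic_deriv)
    have B: "cmod (deriv (deriv g) t) \<le> 2 * M / r^2" if "t \<in> ball 0 r" for t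
    proof -
      have sub: "cball t r \<subseteq> ball 0 (3 * r)"
      proof
        fix z assume "z \<in> cball t r"
        then have "cmod z \<le> cmod t + r"
          using norm_triangle_sub[of z t] by (simp add: dist_norm norm_minus_commute)
        then show "z \<in> ball 0 (3 * r)" using that r by simp
      qed
      have "cmod ((deriv ^^ 2) g t) \<le> fact 2 * M / r ^ 2"
      proof (rule Cauchy_higher_deriv_bound)
        show "g holomorphic_on ball t r"
          using hol sub by (meson ball_subset_cball holomorphic_on_subset subset_trans)
        show "continuous_on (cball t r) g"
          using hol sub continuous_on_subset holomorphic_on_imp_continuous_on by blast
        show "g w \<in> ball 0 M" if "w \<in> ball t r" for w
        proof -
          have "cmod w < 3 * r" using that sub by (auto simp: subset_iff)
          then show ?thesis using M[OF near[OF y]] by (simp add: g_def)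
        qed
      qed (use r in auto)
      then show ?thesis by (simp add: numeral_2_eq_2)
    qed
    have der: "((deriv ^^ k) g has_field_derivative (deriv ^^ Suc k) g t) (at t within ball 0 r)"
      if "t \<in> ball 0 r" "k \<le> 1" for k t
    proof -
      have t: "t \<in> ball 0 (3 * r)" using that r by auto
      have "k = 0 \<or> k = 1" using that by auto
      then show ?thesis
        using holomorphic_derivI[OF hol open_ball t] holomorphic_derivI[OF hol' open_ball t]
        by auto
    qed
    have "cmod ((deriv ^^ 0) g s - (\<Sum>k\<le>1. (deriv ^^ k) g 0 * (s - 0) ^ k / fact k))
        \<le> (2 * M / r^2) * cmod (s - 0) ^ Suc 1 / fact 1"
      by (rule complex_Taylor[where S = "ball 0 r"]) (use r s der B in auto)
    moreover have "deriv g 0 = pd i f y"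
      unfolding g_def pd_def by simp
    ultimately show ?thesis
      by (simp add: g_def numeral_2_eq_2 algebra_simps)
  qed
  show ?thesis
  proof
    show "0 < r" by fact
    show "ball x r \<subseteq> U" using R r by (auto simp: r_def subset_iff)
    show "y + axis i s \<in> U" if "y \<in> ball x r" "cmod s < r" for y s
      using near[OF that(1), of s] that(2) r R(2) by (simp add: subset_iff)
  qed (use bound in blast)
qed

lemma diff_quotient_uniform_limit:
  assumes U: "open U" "holo U f" "x \<in> U"
  obtains r h where "0 < r" "ball x r \<subseteq> U" "h \<longlonglongrightarrow> 0" "\<And>n. h n \<noteq> (0::complex)"
    "\<And>y n. y \<in> ball x r \<Longrightarrow> y + axis i (h n) \<in> U"
    "uniform_limit (ball x r) (\<lambda>n y. (f (y + axis i (h n)) - f y) / h n) (pd i f) sequentially"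
proof -
  obtain r C where r: "0 < r" "ball x r \<subseteq> U"
    "\<And>y s. y \<in> ball x r \<Longrightarrow> cmod s < r \<Longrightarrow> y + axis i s \<in> U"
    and C: "\<And>y s. y \<in> ball x r \<Longrightarrow> cmod s < r \<Longrightarrow>
       cmod (f (y + axis i s) - f y - pd i f y * s) \<le> C * (cmod s)\<^sup>2"
    using holo_second_order_bound[OF U] by blast
  \<comment> \<open>The offset 2 makes already the first step strictly smaller than
    \<open>r\<close>.\<close>
  define h :: "nat \<Rightarrow> complex" where "h n = of_real (r / real (n + 2))" for n
  have h0: "h n \<noteq> 0" and hr: "cmod (h n) < r" for n
    using r(1) by (simp_all add: h_def norm_divide field_simps add_pos_nonneg del: of_real_divide of_real_add)
  have "(\<lambda>n. r / real (n + 2)) \<longlonglongrightarrow> 0"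
    using LIMSEQ_ignore_initial_segment[OF lim_const_over_n[of r], of 2] by simp
  then have hlim: "h \<longlonglongrightarrow> 0"
    unfolding h_def by (metis of_real_0 tendsto_of_real)
  have "uniform_limit (ball x r) (\<lambda>n y. (f (y + axis i (h n)) - f y) / h n) (pd i f) sequentially"
  proof (rule uniform_limitI)
    fix e :: real assume "e > 0"
    have "(\<lambda>n. C * cmod (h n)) \<longlonglongrightarrow> 0"
      using tendsto_mult_right_zero[OF tendsto_norm_zero[OF hlim]] by blast
    then have "\<forall>\<^sub>F n in sequentially. C * cmod (h n) < e"
      using \<open>e > 0\<close> by (rule order_tendstoD)
    then show "\<forall>\<^sub>F n in sequentially. \<forall>y\<in>ball x r. dist ((f (y + axis i (h n)) - f y) / h n) (pd i f y) < e"
    proof (rule eventually_mono, intro ballI)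
      fix n y assume n: "C * cmod (h n) < e" and y: "y \<in> ball x r"
      have "(f (y + axis i (h n)) - f y) / h n - pd i f y
          = (f (y + axis i (h n)) - f y - pd i f y * h n) / h n"
        using h0[of n] by (simp add: field_simps)
      then have "dist ((f (y + axis i (h n)) - f y) / h n) (pd i f y)
          = cmod (f (y + axis i (h n)) - f y - pd i f y * h n) / cmod (h n)"
        by (simp add: dist_norm norm_divide)
      also have "\<dots> \<le> C * (cmod (h n))\<^sup>2 / cmod (h n)"
        by (intro divide_right_mono C y hr) auto
      also have "\<dots> = C * cmod (h n)" using h0[of n] by (simp add: power2_eq_square)
      finally show "dist ((f (y + axis i (h n)) - f y) / h n) (pd i f y) < e" using n by simp
    qed
  qed
  with r hlim h0 hr show ?thesis by (intro that[of r h]) auto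
qed

text \<open>Partial derivatives are locally uniform limits of continuous difference quotients. This
  supplies the continuous differentiability required by the inverse function theorem.\<close>

lemma continuous_on_pd:
  assumes U: "open U" "holo U f"
  shows "continuous_on U (pd i f)"
proof (rule continuous_at_imp_continuous_on, rule ballI)
  fix x assume "x \<in> U"
  obtain r h where r: "0 < r" "ball x r \<subseteq> U" and h: "h \<longlonglongrightarrow> 0" "\<And>n. h n \<noteq> (0::complex)"
    and r': "\<And>y n. y \<in> ball x r \<Longrightarrow> y + axis i (h n) \<in> U"
    "uniform_limit (ball x r) (\<lambda>n y. (f (y + axis i (h n)) - f y) / h n) (pd i f) sequentially"
    by (rule diff_quotient_uniform_limit[OF U \<open>x \<in> U\<close>, where i = i]) (rule that)
  note r = r r' h(2)
  have cf: "continuous_on U f" using U by (rule holo_continuous_on)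
  have "continuous_on (ball x r) (\<lambda>y. (f (y + axis i (h n)) - f y) / h n)" for n
    by (intro continuous_intros continuous_on_compose2[OF cf]) (use r in auto)
  then have "continuous_on (ball x r) (pd i f)"
    by (intro uniform_limit_theorem[OF _ r(4)]) auto
  then show "isCont (pd i f) x"
    using r(1) by (simp add: continuous_on_eq_continuous_at)
qed

text \<open>Weierstrass' theorem on the line in direction \<open>j\<close>: the difference quotients
  in direction \<open>i\<close> converge uniformly, so their limit is differentiable there and its
  derivative is the limit of their derivatives.\<close>

lemma pd_line_limit:
  assumes U: "open U" "holo U f" "x \<in> U"
  shows "\<exists>d h. ((\<lambda>t. pd i f (x + axis j t)) has_field_derivative d) (at 0) \<and>
     h \<longlonglongrightarrow> 0 \<and> (\<forall>n. h n \<noteq> 0) \<and> (\<lambda>n. (pd j f (x + axis i (h n)) - pd j f x) / h n) \<longlonglongrightarrow> d"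
proof -
  obtain r h where r: "0 < r" "ball x r \<subseteq> U" and h: "h \<longlonglongrightarrow> 0" "\<And>n. h n \<noteq> (0::complex)"
    and r': "\<And>y n. y \<in> ball x r \<Longrightarrow> y + axis i (h n) \<in> U"
    "uniform_limit (ball x r) (\<lambda>n y. (f (y + axis i (h n)) - f y) / h n) (pd i f) sequentially"
    by (rule diff_quotient_uniform_limit[OF U, where i = i]) (rule that)
  note r = r r'
  have in_ball: "x + axis j t \<in> ball x r" if "t \<in> ball 0 r" for t
    using that by (simp add: dist_norm)
  have "\<exists>g'. \<forall>t\<in>ball 0 r. ((\<lambda>t. pd i f (x + axis j t)) has_field_derivative g' t) (at t) \<and>
     ((\<lambda>n. (pd j f (x + axis i (h n) + axis j t) - pd j f (x + axis j t)) / h n) \<longlongrightarrow> g' t) sequentially"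
  proof (rule has_complex_derivative_uniform_sequence)
    show "open (ball (0::complex) r)" by simp
  next
    fix n t assume t: "t \<in> ball (0::complex) r"
    have 1: "x + axis j t \<in> U" using in_ball[OF t] r(2) by blast
    have 2: "x + axis i (h n) + axis j t \<in> U"
      using r(3)[OF in_ball[OF t], of n] by (simp add: algebra_simps)
    have "((\<lambda>t. (f (x + axis i (h n) + axis j t) - f (x + axis j t)) / h n) has_field_derivative
         (pd j f (x + axis i (h n) + axis j t) - pd j f (x + axis j t)) / h n) (at t)"
      by (intro DERIV_cdivide DERIV_diff holo_line[OF U(1,2)] 1 2)
    then show "((\<lambda>t. (f (x + axis j t + axis i (h n)) - f (x + axis j t)) / h n) has_field_derivative
         (pd j f (x + axis i (h n) + axis j t) - pd j f (x + axis j t)) / h n) (at t)"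
      by (simp add: algebra_simps)
  next
    fix t assume t: "t \<in> ball (0::complex) r"
    then obtain d where d: "d > 0" "cball t d \<subseteq> ball 0 r"
      using open_contains_cball[of "ball (0::complex) r"] open_ball by blast
    have "uniform_limit (cball t d) (\<lambda>n t. (f (x + axis j t + axis i (h n)) - f (x + axis j t)) / h n)
        (\<lambda>t. pd i f (x + axis j t)) sequentially"
    proof (rule uniform_limitI)
      fix e :: real assume "e > 0"
      from uniform_limitD[OF r(4) this]
      show "\<forall>\<^sub>F n in sequentially. \<forall>t\<in>cball t d.
          dist ((f (x + axis j t + axis i (h n)) - f (x + axis j t)) / h n) (pd i f (x + axis j t)) < e"
        by (rule eventually_mono) (use in_ball d in blast)
    qed
    with d show "\<exists>d>0. cball t d \<subseteq> ball 0 r \<and>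
      uniform_limit (cball t d) (\<lambda>n t. (f (x + axis j t + axis i (h n)) - f (x + axis j t)) / h n)
        (\<lambda>t. pd i f (x + axis j t)) sequentially" by blast
  qed
  then obtain g' where g': "\<And>t. t \<in> ball 0 r \<Longrightarrow> ((\<lambda>t. pd i f (x + axis j t)) has_field_derivative g' t) (at t)"
    "\<And>t. t \<in> ball 0 r \<Longrightarrow> ((\<lambda>n. (pd j f (x + axis i (h n) + axis j t) - pd j f (x + axis j t)) / h n) \<longlongrightarrow> g' t) sequentially"
    by blast
  from g'[of 0] r(1) h show ?thesis by fastforce
qed

lemma pd_line:
  assumes U: "open U" "holo U f" "x \<in> U"
  shows "((\<lambda>t. pd i f (x + axis j t)) has_field_derivative pd j (pd i f) x) (at 0)"
proof -
  obtain d where "((\<lambda>t. pd i f (x + axis j t)) has_field_derivative d) (at 0)"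
    using pd_line_limit[OF U, of i j] by blast
  then show ?thesis
    unfolding pd_def[of j "pd i f"] by (metis DERIV_imp_deriv)
qed

text \<open>The two iterated derivatives are limits of the same difference quotients.\<close>

lemma pd_commute:
  assumes U: "open U" "holo U f" "x \<in> U"
  shows "pd j (pd i f) x = pd i (pd j f) x"
proof -
  obtain d h where d: "((\<lambda>t. pd i f (x + axis j t)) has_field_derivative d) (at 0)"
    and h: "h \<longlonglongrightarrow> 0" "\<And>n. h n \<noteq> 0" and
    lim: "(\<lambda>n. (pd j f (x + axis i (h n)) - pd j f x) / h n) \<longlonglongrightarrow> d"
    using pd_line_limit[OF U, of i j] by blast
  have "((\<lambda>s. (pd j f (x + axis i s) - pd j f x) / s) \<longlongrightarrow> pd i (pd j f) x) (at 0)"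
    using pd_line[OF U, of j i] by (simp add: DERIV_def)
  then have "(\<lambda>n. (pd j f (x + axis i (h n)) - pd j f x) / h n) \<longlonglongrightarrow> pd i (pd j f) x"
    by (rule filterlim_compose) (use h in \<open>auto simp: filterlim_at\<close>)
  with lim have "d = pd i (pd j f) x" by (rule LIMSEQ_unique)
  moreover have "d = pd j (pd i f) x"
    using d pd_line[OF U] DERIV_unique by blast
  ultimately show ?thesis by simp
qed

section \<open>The Jacobi identity and charts\<close>

lemma cspace_UNIV [simp]: "cspace UNIV = UNIV"
  by (simp add: cspace_def)

lemma open_dom_UNIV [simp]: "open_dom UNIV U \<longleftrightarrow> open U"
  by simp

lemma sum_rotate4:
  "(\<Sum>l\<in>A. \<Sum>c\<in>B. \<Sum>a\<in>C. \<Sum>b\<in>D. X l c a b) = (\<Sum>a\<in>C. \<Sum>b\<in>D. \<Sum>c\<in>B. \<Sum>l\<in>A. X l c a b)"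
proof -
  have "(\<Sum>l\<in>A. \<Sum>c\<in>B. \<Sum>a\<in>C. \<Sum>b\<in>D. X l c a b) = (\<Sum>l\<in>A. \<Sum>a\<in>C. \<Sum>c\<in>B. \<Sum>b\<in>D. X l c a b)"
    by (intro sum.cong refl sum.swap)
  also have "\<dots> = (\<Sum>a\<in>C. \<Sum>l\<in>A. \<Sum>c\<in>B. \<Sum>b\<in>D. X l c a b)"
    by (rule sum.swap)
  also have "\<dots> = (\<Sum>a\<in>C. \<Sum>l\<in>A. \<Sum>b\<in>D. \<Sum>c\<in>B. X l c a b)"
    by (intro sum.cong refl sum.swap)
  also have "\<dots> = (\<Sum>a\<in>C. \<Sum>b\<in>D. \<Sum>l\<in>A. \<Sum>c\<in>B. X l c a b)"
    by (intro sum.cong refl sum.swap)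
  also have "\<dots> = (\<Sum>a\<in>C. \<Sum>b\<in>D. \<Sum>c\<in>B. \<Sum>l\<in>A. X l c a b)"
    by (intro sum.cong refl sum.swap)
  finally show ?thesis .
qed

lemma sum_rotate3:
  "(\<Sum>a\<in>A. \<Sum>b\<in>B. \<Sum>c\<in>C. X a b c) = (\<Sum>b\<in>B. \<Sum>c\<in>C. \<Sum>a\<in>A. X a b c)"
proof -
  have "(\<Sum>a\<in>A. \<Sum>b\<in>B. \<Sum>c\<in>C. X a b c) = (\<Sum>b\<in>B. \<Sum>a\<in>A. \<Sum>c\<in>C. X a b c)"
    by (rule sum.swap)
  also have "\<dots> = (\<Sum>b\<in>B. \<Sum>c\<in>C. \<Sum>a\<in>A. X a b c)"
    by (intro sum.cong refl sum.swap)
  finally show ?thesis .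
qed

text \<open>The Jacobiator of three coordinate functions: the cyclic sum of {{x_a, x_b},
  x_c}.\<close>

definition jac :: "'n::finite tensor \<Rightarrow> complex^'n \<Rightarrow> 'n \<Rightarrow> 'n \<Rightarrow> 'n \<Rightarrow> complex" where
  "jac P x a b c = (\<Sum>l\<in>UNIV. pd l (\<lambda>y. P y a b) x * P x l c + pd l (\<lambda>y. P y b c) x * P x l a
     + pd l (\<lambda>y. P y c a) x * P x l b)"

text \<open>Separates the derivatives of the tensor from the second derivatives of the two inner
  functions. Skew-symmetry brings both Hessian terms into the same shape \<open>T\<close>.\<close>

lemma bracket_bracket_expand:
  fixes p :: "'n::finite \<Rightarrow> 'n \<Rightarrow> complex"
  assumes skew: "\<And>a b. p a b = - p b a"
  defines "T \<equiv> \<lambda>F g h. \<Sum>l\<in>UNIV. \<Sum>c\<in>UNIV. \<Sum>a\<in>UNIV. \<Sum>b\<in>UNIV. p l c * p a b * F a l * g b * h c"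
  shows "(\<Sum>l\<in>UNIV. \<Sum>c\<in>UNIV. p l c *
      (\<Sum>a\<in>UNIV. \<Sum>b\<in>UNIV. dp l a b * f a * g b + p a b * F a l * g b + p a b * f a * G b l) * h c)
    = (\<Sum>a\<in>UNIV. \<Sum>b\<in>UNIV. \<Sum>c\<in>UNIV. (\<Sum>l\<in>UNIV. dp l a b * p l c) * f a * g b * h c)
      + T F g h - T G f h"
proof -
  have 1: "(\<Sum>a\<in>UNIV. \<Sum>b\<in>UNIV. \<Sum>c\<in>UNIV. (\<Sum>l\<in>UNIV. dp l a b * p l c) * f a * g b * h c)
     = (\<Sum>l\<in>UNIV. \<Sum>c\<in>UNIV. \<Sum>a\<in>UNIV. \<Sum>b\<in>UNIV. p l c * dp l a b * f a * g b * h c)"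
    unfolding sum_rotate4[of "\<lambda>l c a b. p l c * dp l a b * f a * g b * h c"]
    by (simp add: sum_distrib_left sum_distrib_right algebra_simps)
  have 2: "- T G f h = (\<Sum>l\<in>UNIV. \<Sum>c\<in>UNIV. \<Sum>a\<in>UNIV. \<Sum>b\<in>UNIV. p l c * p a b * f a * G b l * h c)"
  proof -
    have "- T G f h = (\<Sum>l\<in>UNIV. \<Sum>c\<in>UNIV. \<Sum>a\<in>UNIV. \<Sum>b\<in>UNIV. p l c * p b a * G a l * f b * h c)"
      unfolding T_def sum_negf[symmetric]
      by (intro sum.cong refl) (metis (no_types) skew mult_minus_left mult_minus_right)
    also have "\<dots> = (\<Sum>l\<in>UNIV. \<Sum>c\<in>UNIV. \<Sum>b\<in>UNIV. \<Sum>a\<in>UNIV. p l c * p b a * G a l * f b * h c)"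
      by (intro sum.cong refl sum.swap)
    finally show ?thesis by (simp add: algebra_simps)
  qed
  show ?thesis
    unfolding diff_conv_add_uminus 1 2 unfolding T_def
    by (simp add: sum.distrib sum_distrib_left sum_distrib_right algebra_simps)
qed

text \<open>Interchanging the index pairs \<open>(l, c)\<close> and \<open>(a, b)\<close> exchanges
  \<open>g\<close> and \<open>h\<close> and transposes the Hessian. In the cyclic sum the six
  Hessian terms thus cancel in pairs.\<close>

lemma second_order_terms_symmetric:
  fixes p :: "'n::finite \<Rightarrow> 'n \<Rightarrow> complex"
  assumes sym: "\<And>a b. F a b = F b a"
  defines "T \<equiv> \<lambda>F g h. \<Sum>l\<in>UNIV. \<Sum>c\<in>UNIV. \<Sum>a\<in>UNIV. \<Sum>b\<in>UNIV. p l c * p a b * F a l * g b * h c"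
  shows "T F g h = T F h g"
proof -
  have "T F h g = (\<Sum>a\<in>UNIV. \<Sum>b\<in>UNIV. \<Sum>l\<in>UNIV. \<Sum>c\<in>UNIV. p l c * p a b * F a l * h b * g c)"
    unfolding T_def by (subst sum_rotate4) (intro sum.cong refl sum.swap)
  also have "\<dots> = T F g h"
    unfolding T_def by (intro sum.cong refl) (metis (no_types) sym mult.commute mult.assoc)
  finally show ?thesis ..
qed

lemma pd_bracket:
  assumes W: "open W" "x \<in> W" and P: "\<And>i j. holo W (\<lambda>y. P y i j)" and f: "holo W f" and g: "holo W g"
  shows "pd l (bracket UNIV P f g) x = (\<Sum>a\<in>UNIV. \<Sum>b\<in>UNIV. pd l (\<lambda>y. P y a b) x * pd a f x * pd b g x
     + P x a b * pd l (pd a f) x * pd b g x + P x a b * pd a f x * pd l (pd b g) x)"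
proof -
  have P': "((\<lambda>t. P (x + axis l t) a b) has_field_derivative pd l (\<lambda>y. P y a b) x) (at 0)" for a b
    using holo_line[OF W(1) P, of x l 0] W by simp
  show ?thesis
    unfolding pd_def[of l "bracket UNIV P f g"] bracket_def
    by (rule DERIV_imp_deriv)
      (auto intro!: derivative_eq_intros P' pd_line[OF W(1) f W(2)] pd_line[OF W(1) g W(2)] sum.cong
        simp: algebra_simps)
qed

text \<open>With the Hessian terms gone, the Jacobiator is trilinear in the differentials. The
  identity for arbitrary functions therefore reduces to coordinates, in any chart.\<close>

lemma jacobi_formula:
  assumes W: "open W" "x \<in> W" and P: "\<And>i j. holo W (\<lambda>y. P y i j)"
    and skew: "\<And>i j. P x i j = - P x j i" and f: "holo W f" and g: "holo W g" and h: "holo W h"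
  shows "bracket UNIV P (bracket UNIV P f g) h x + bracket UNIV P (bracket UNIV P g h) f x
     + bracket UNIV P (bracket UNIV P h f) g x
     = (\<Sum>a\<in>UNIV. \<Sum>b\<in>UNIV. \<Sum>c\<in>UNIV. jac P x a b c * pd a f x * pd b g x * pd c h x)"
proof -
  define T where "T F g h = (\<Sum>l\<in>UNIV. \<Sum>c\<in>UNIV. \<Sum>a\<in>UNIV. \<Sum>b\<in>UNIV. P x l c * P x a b * F a l * g b * h c)"
    for F :: "'a \<Rightarrow> 'a \<Rightarrow> complex" and g h :: "'a \<Rightarrow> complex"
  define H where "H f = (\<lambda>a l. pd l (pd a f) x)" for f :: "complex^'a \<Rightarrow> complex"
  define E where "E f = (\<lambda>a. pd a f x)" for f :: "complex^'a \<Rightarrow> complex"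
  define J where "J f g h = (\<Sum>a\<in>UNIV. \<Sum>b\<in>UNIV. \<Sum>c\<in>UNIV. (\<Sum>l\<in>UNIV. pd l (\<lambda>y. P y a b) x * P x l c) * E f a * E g b * E h c)"
    for f g h :: "complex^'a \<Rightarrow> complex"
  have br: "bracket UNIV P (bracket UNIV P f g) h x = J f g h + T (H f) (E g) (E h) - T (H g) (E f) (E h)"
    if "holo W f" "holo W g" for f g h
  proof -
    have "bracket UNIV P (bracket UNIV P f g) h x = (\<Sum>l\<in>UNIV. \<Sum>c\<in>UNIV. P x l c *
      (\<Sum>a\<in>UNIV. \<Sum>b\<in>UNIV. pd l (\<lambda>y. P y a b) x * E f a * E g b + P x a b * H f a l * E g b
        + P x a b * E f a * H g b l) * E h c)"
      unfolding bracket_def[of UNIV P "bracket UNIV P f g"] pd_bracket[OF W P that] E_def H_def ..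
    then show ?thesis
      unfolding T_def J_def using bracket_bracket_expand[of "P x", OF skew] by simp
  qed
  have sym: "T (H f) u v = T (H f) v u" if "holo W f" for f u v
    unfolding T_def
    by (rule second_order_terms_symmetric) (simp add: H_def pd_commute[OF W(1) that W(2)])
  have J2: "J g h f = (\<Sum>a\<in>UNIV. \<Sum>b\<in>UNIV. \<Sum>c\<in>UNIV. (\<Sum>l\<in>UNIV. pd l (\<lambda>y. P y b c) x * P x l a) * E f a * E g b * E h c)"
    unfolding J_def by (subst (2) sum_rotate3) (simp add: algebra_simps)
  have J3: "J h f g = (\<Sum>a\<in>UNIV. \<Sum>b\<in>UNIV. \<Sum>c\<in>UNIV. (\<Sum>l\<in>UNIV. pd l (\<lambda>y. P y c a) x * P x l b) * E f a * E g b * E h c)"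
    unfolding J_def by (subst sum_rotate3) (simp add: algebra_simps)
  have "J f g h + J g h f + J h f g
     = (\<Sum>a\<in>UNIV. \<Sum>b\<in>UNIV. \<Sum>c\<in>UNIV. jac P x a b c * E f a * E g b * E h c)"
    unfolding J2 J3 unfolding J_def by (simp add: jac_def sum.distrib algebra_simps)
  then show ?thesis
    using sym[OF f, of "E g" "E h"] sym[OF g, of "E f" "E h"] sym[OF h, of "E f" "E g"]
    by (simp add: br f g h E_def algebra_simps)
qed

lemma holo_subset: "holo U f \<Longrightarrow> W \<subseteq> U \<Longrightarrow> holo W f"
  unfolding holo_def by (meson has_derivative_subset subset_iff)

lemma poisson_onI:
  assumes U: "open U" and P: "\<And>i j. holo U (\<lambda>y. P y i j)"
    and skew: "\<And>x i j. x \<in> U \<Longrightarrow> P x i j = - P x j i"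
    and jac: "\<And>x a b c. x \<in> U \<Longrightarrow> jac P x a b c = 0"
  shows "poisson_on UNIV U P"
proof -
  have "bracket UNIV P f g x = - bracket UNIV P g f x" if "x \<in> U" for f g x
    unfolding bracket_om by (rule om_skew) (rule skew[OF that])
  moreover have "bracket UNIV P (bracket UNIV P f g) h x + bracket UNIV P (bracket UNIV P g h) f x
     + bracket UNIV P (bracket UNIV P h f) g x = 0"
    if "open W" "W \<subseteq> U" "holo W f" "holo W g" "holo W h" "x \<in> W" for W f g h x
    using that jac[of x] by (subst jacobi_formula[of W]) (auto intro: holo_subset P skew)
  ultimately show ?thesis
    unfolding poisson_on_def open_dom_UNIV using P by blast
qed

lemma invertible_mult_zero:
  fixes A :: "'a::field^'n::finite^'n"
  assumes "invertible A" "\<And>i. (\<Sum>j\<in>UNIV. A $ i $ j * X j) = 0"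
  shows "X j = 0"
proof -
  have "A *v (\<chi> j. X j) = 0"
    using assms(2) by (simp add: vec_eq_iff matrix_vector_mult_def)
  then have "(\<chi> j. X j) = 0"
    using assms(1) by (metis invertible_def matrix_vector_mul_assoc matrix_vector_mul_lid matrix_vector_mult_0_right)
  then show ?thesis by (simp add: vec_eq_iff)
qed

text \<open>The Jacobiator is a tensor, so it vanishes as soon as it vanishes on a coordinate system.\<close>

lemma jac_zero_of_chart:
  fixes F :: "'n::finite \<Rightarrow> complex^'n \<Rightarrow> complex"
  assumes W: "open W" "x \<in> W" and P: "\<And>i j. holo W (\<lambda>y. P y i j)"
    and skew: "\<And>i j. P x i j = - P x j i"
    and F: "\<And>i. holo W (F i)" and const: "\<And>i j y. y \<in> W \<Longrightarrow> bracket UNIV P (F i) (F j) y = K i j"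
    and inv: "invertible (\<chi> i. grad (F i) x)"
  shows "jac P x a b c = 0"
proof -
  have "pd l (bracket UNIV P (F i) (F j)) x = 0" for i j l
  proof -
    have "has_grad (bracket UNIV P (F i) (F j)) 0 x"
      by (rule has_grad_transform[OF has_grad_const W]) (simp add: const)
    then show ?thesis using has_grad_pd by fastforce
  qed
  then have "bracket UNIV P (bracket UNIV P (F i) (F j)) g x = 0" for i j g
    by (simp add: bracket_def[of _ _ "bracket UNIV P (F i) (F j)"])
  then have *: "(\<Sum>a\<in>UNIV. \<Sum>b\<in>UNIV. \<Sum>c\<in>UNIV. jac P x a b c * pd a (F i) x * pd b (F j) x * pd c (F k) x) = 0"
    for i j k
    by (subst jacobi_formula[OF W P skew F F F, symmetric]) simp
  \<comment> \<open>The iterated brackets of chart functions vanish because the inner ones are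
    constant. The Jacobian matrix is now stripped off one tensor slot at a time.\<close>
  have 1: "(\<Sum>b\<in>UNIV. \<Sum>c\<in>UNIV. jac P x a b c * pd b (F j) x * pd c (F k) x) = 0" for a j k
    by (rule invertible_mult_zero[OF inv,
          where X = "\<lambda>a. \<Sum>b\<in>UNIV. \<Sum>c\<in>UNIV. jac P x a b c * pd b (F j) x * pd c (F k) x"])
      (use * in \<open>simp add: sum_distrib_left algebra_simps\<close>)
  have 2: "(\<Sum>c\<in>UNIV. jac P x a b c * pd c (F k) x) = 0" for a b k
    by (rule invertible_mult_zero[OF inv, where X = "\<lambda>b. \<Sum>c\<in>UNIV. jac P x a b c * pd c (F k) x"])
      (use 1 in \<open>simp add: sum_distrib_left algebra_simps\<close>)
  show ?thesis
    by (rule invertible_mult_zero[OF inv, where X = "jac P x a b"])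
      (use 2 in \<open>simp add: algebra_simps\<close>)
qed

section \<open>Holomorphic charts and preservation of brackets\<close>

text \<open>The real inverse function theorem provides the inverse; its derivative is complex linear
  because it inverts a complex linear bijection.\<close>

lemma holo_inverse_function:
  fixes \<phi> :: "complex^'n::finite \<Rightarrow> complex^'n"
  assumes U: "open U" "x \<in> U" and \<phi>: "\<And>i. holo U (\<lambda>y. \<phi> y $ i)"
    and inv: "invertible (\<chi> i. grad (\<lambda>y. \<phi> y $ i) x)"
  obtains U' V where "open U'" "x \<in> U'" "U' \<subseteq> U" "open V" "bij_betw \<phi> U' V"
    "\<And>i. holo V (\<lambda>y. inv_into U' \<phi> y $ i)"
proof -
  define A where "A y = (\<chi> i. grad (\<lambda>z. \<phi> z $ i) y)" for y
  define f' where "f' y = Blinfun (\<lambda>h. A y *v h)" for y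
  have bl: "bounded_linear (\<lambda>h. M *v h)" for M :: "complex^'n^'n"
    by (rule linear_conv_bounded_linear[THEN iffD1])
       (auto intro!: linearI simp: vec_eq_iff matrix_vector_mult_def algebra_simps sum.distrib scaleR_sum_right)
  have f'_apply: "blinfun_apply (f' y) h = A y *v h" for y h
    unfolding f'_def by (simp add: bounded_linear_Blinfun_apply bl)
  have der: "(\<phi> has_derivative (\<lambda>h. A y *v h)) (at y)" if "y \<in> U" for y
    by (rule has_derivative_vec_has_grad) (use holo_has_grad[OF U(1) \<phi> that] in \<open>simp add: A_def\<close>)
  have contA: "continuous_on U (\<lambda>y. A y $ i $ j)" for i j
    unfolding A_def using continuous_on_pd[OF U(1) \<phi>] by simp
  have cont: "continuous_on U f'"
  proof (rule continuous_on_blinfun_componentwise)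
    fix b :: "complex^'n"
    have "continuous_on U (\<lambda>y. A y *v b)"
      unfolding matrix_vector_mult_def
      by (intro continuous_on_vec_lambda continuous_intros contA)
    then show "continuous_on U (\<lambda>y. blinfun_apply (f' y) b)"
      by (simp add: f'_apply)
  qed
  obtain B where B: "B ** A x = mat 1"
    using inv unfolding A_def invertible_def by blast
  have "Blinfun (\<lambda>h. B *v h) o\<^sub>L f' x = id_blinfun"
    by (rule blinfun_eqI) (simp add: f'_apply bounded_linear_Blinfun_apply bl matrix_vector_mul_assoc B)
  moreover have "\<And>y. y \<in> U \<Longrightarrow> (\<phi> has_derivative blinfun_apply (f' y)) (at y)"
    using der by (simp add: f'_apply[abs_def])
  ultimately obtain U' V g g' where V: "open U'" "U' \<subseteq> U" "x \<in> U'" "open V" "homeomorphism U' V \<phi> g"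
    "\<And>y. y \<in> V \<Longrightarrow> (g has_derivative (g' y)) (at y)"
    "\<And>y. y \<in> V \<Longrightarrow> g' y = inv (blinfun_apply (f' (g y)))"
    "\<And>y. y \<in> V \<Longrightarrow> bij (blinfun_apply (f' (g y)))"
    using inverse_function_theorem[OF U(1) _ cont U(2)] by metis
  have g: "g y \<in> U'" "\<phi> (g y) = y" if "y \<in> V" for y
    using V(5) that by (auto simp: homeomorphism_def)
  have gf: "g (\<phi> y) = y" "\<phi> y \<in> V" if "y \<in> U'" for y
    using V(5) that by (auto simp: homeomorphism_def)
  have bij: "bij_betw \<phi> U' V"
    by (rule bij_betwI[of _ _ _ g]) (use g gf in auto)
  have inv_g: "inv_into U' \<phi> y = g y" if "y \<in> V" for y
    using bij g that by (metis bij_betw_def inv_into_f_f)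
  have "holo V (\<lambda>y. inv_into U' \<phi> y $ i)" for i
    unfolding holo_def
  proof
    fix y assume y: "y \<in> V"
    have "(g has_derivative g' y) (at y within V)"
      using V(6)[OF y] by (rule has_derivative_at_withinI)
    then have "((\<lambda>y. inv_into U' \<phi> y) has_derivative g' y) (at y within V)"
      by (rule has_derivative_transform[rotated 2]) (use y inv_g in auto)
    then have "((\<lambda>y. inv_into U' \<phi> y $ i) has_derivative (\<lambda>h. g' y h $ i)) (at y within V)"
      by (rule bounded_linear.has_derivative[OF bounded_linear_vec_nth])
    moreover have "g' y (c *s h) = c *s g' y h" for c h
    proof -
      have inj: "inj (blinfun_apply (f' (g y)))" and surj: "surj (blinfun_apply (f' (g y)))"
        using V(8)[OF y] by (auto simp: bij_def)
      have "blinfun_apply (f' (g y)) (c *s g' y h) = c *s blinfun_apply (f' (g y)) (g' y h)"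
        by (simp add: f'_apply vector_scalar_commute)
      also have "\<dots> = c *s h"
        using surj V(7)[OF y] by (simp add: surj_f_inv_f)
      finally show ?thesis
        using inj V(7)[OF y] by (metis inv_f_f)
    qed
    ultimately show "\<exists>D. ((\<lambda>y. inv_into U' \<phi> y $ i) has_derivative D) (at y within V) \<and>
        (\<forall>c h. D (c *s h) = c * D h)"
      by (intro exI[of _ "\<lambda>h. g' y h $ i"]) simp
  qed
  with V bij show ?thesis by (intro that[of U' V]) auto
qed

text \<open>By the chain rule a biderivation of pulled-back functions depends only on the brackets
  of the components of the map.\<close>

lemma preserves_bracketI:
  fixes \<phi> :: "complex^'n::finite \<Rightarrow> complex^'n"
  assumes U: "open U" and \<phi>: "\<And>i. holo U (\<lambda>y. \<phi> y $ i)"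
    and br: "\<And>x i j. x \<in> U \<Longrightarrow> bracket UNIV P (\<lambda>y. \<phi> y $ i) (\<lambda>y. \<phi> y $ j) x = P' (\<phi> x) i j"
  shows "preserves_bracket UNIV \<phi> U P V P'"
  unfolding preserves_bracket_def open_dom_UNIV
proof (intro allI impI ballI)
  fix W f g x
  assume W: "open W \<and> W \<subseteq> V \<and> holo W f \<and> holo W g" and x: "x \<in> U" "\<phi> x \<in> W"
  have g\<phi>: "has_grad (\<lambda>y. \<phi> y $ i) ((\<chi> i. grad (\<lambda>y. \<phi> y $ i) x) $ i) x" for i
    using holo_has_grad[OF U \<phi> x(1)] by simp
  have gr: "grad (f \<circ> \<phi>) x = (\<Sum>i\<in>UNIV. pd i f (\<phi> x) *s grad (\<lambda>y. \<phi> y $ i) x)" if "holo W f" for f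
    using has_grad_grad[OF has_grad_chain[OF g\<phi> holo_has_grad[of W, OF _ that x(2)]]] W by simp
  have "bracket UNIV P (f \<circ> \<phi>) (g \<circ> \<phi>) x
     = (\<Sum>i\<in>UNIV. \<Sum>j\<in>UNIV. pd i f (\<phi> x) * (pd j g (\<phi> x) * om (P x) (grad (\<lambda>y. \<phi> y $ i) x) (grad (\<lambda>y. \<phi> y $ j) x)))"
    unfolding bracket_om gr[OF conjunct1[OF conjunct2[OF conjunct2[OF W]]]]
      gr[OF conjunct2[OF conjunct2[OF conjunct2[OF W]]]] om_sum_left
    by (simp add: om_sum_right sum_distrib_left mult.left_commute)
  also have "\<dots> = bracket UNIV P' f g (\<phi> x)"
    using br[OF x(1)] by (simp add: bracket_om[symmetric] bracket_def[of _ P'] algebra_simps)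
  finally show "bracket UNIV P (f \<circ> \<phi>) (g \<circ> \<phi>) x = bracket UNIV P' f g (\<phi> x)" .
qed

section \<open>The Kronecker block\<close>

lemma pd_const [simp]: "pd l (\<lambda>y. a) x = 0"
  using has_grad_pd[OF has_grad_const] by simp

lemma grad_nth_coord: "grad (\<lambda>y. y $ i) x = axis i 1"
  by (rule has_grad_grad[OF has_grad_nth])

lemma holo_const [simp]: "holo U (\<lambda>y. a)"
  by (rule holoI) (blast intro: has_grad_const)

lemma poisson_on_const:
  assumes "\<And>i j. M i j = - M j i"
  shows "poisson_on UNIV UNIV (\<lambda>x. M)"
  by (rule poisson_onI[OF open_UNIV holo_const assms]) (simp add: jac_def)

lemma bihamiltonian_const:
  assumes M: "\<And>i j. M i j = - M j i" and N: "\<And>i j. N i j = - N j i"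
  shows "bihamiltonian UNIV UNIV (\<lambda>x. M) (\<lambda>x. N)"
proof -
  have "poisson_on UNIV UNIV (\<lambda>x i j. a * M i j + b * N i j)" for a b
  proof (rule poisson_on_const)
    show "a * M i j + b * N i j = - (a * M j i + b * N j i)" for i j
      using M[of i j] N[of i j] by (simp add: algebra_simps)
  qed
  moreover have "poisson_on UNIV UNIV (\<lambda>x. M)" "poisson_on UNIV UNIV (\<lambda>x. N)"
    by (rule poisson_on_const, rule assms)+
  ultimately show ?thesis
    unfolding bihamiltonian_def by simp
qed

lemma translation_invariant_const:
  "translation_invariant UNIV (\<lambda>x. M) (\<lambda>x. N)"
  unfolding translation_invariant_def
proof
  fix a :: "complex^'a"
  have g: "has_grad (\<lambda>y. (y + a) $ i) (axis i 1) x" for a :: "complex^'a" and i x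
    using has_grad_add[OF has_grad_nth has_grad_const] by simp
  have h: "holo UNIV (\<lambda>y. (y + a) $ i)" for a :: "complex^'a" and i
    by (rule holoI) (blast intro: g)
  have inv: "inv (\<lambda>x. x + a) = (\<lambda>x. x + (- a))"
    by (rule inv_equality) auto
  have p: "preserves_bracket UNIV (\<lambda>x. x + a) UNIV (\<lambda>x. L) UNIV (\<lambda>x. L)" for L
    by (rule preserves_bracketI) (simp_all only: h open_UNIV bracket_om has_grad_grad[OF g] om_axis)
  have "bij (\<lambda>x. x + a)"
    by (rule bij_betwI[of _ _ _ "\<lambda>x. x - a"]) auto
  then show "biham_iso UNIV (\<lambda>x. x + a) (cspace UNIV) (\<lambda>x. M) (\<lambda>x. N) (cspace UNIV) (\<lambda>x. M) (\<lambda>x. N)"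
    unfolding biham_iso_def cspace_UNIV inv using p h[of a] h[of "- a"] by simp
qed

section \<open>Kernels of the pencil and indecomposability\<close>

text \<open>A skew matrix of odd size is singular. \<open>N\<close> pads the block on
  \<open>J\<close> by an identity, and \<open>S\<close> negates the rows in \<open>J\<close>, so
  that transposing \<open>N\<close> amounts to multiplying by \<open>S\<close>, whose determinant is
  \<open>(- 1) ^ card J\<close>.\<close>

lemma odd_skew_kernel:
  fixes M :: "'n::finite \<Rightarrow> 'n \<Rightarrow> complex"
  assumes skew: "\<And>i j. M i j = - M j i" and odd: "odd (card J)"
  obtains \<eta> where "\<And>i. i \<notin> J \<Longrightarrow> \<eta> i = 0" "\<exists>i. \<eta> i \<noteq> 0" "\<And>j. j \<in> J \<Longrightarrow> (\<Sum>i\<in>UNIV. \<eta> i * M i j) = 0"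
proof -
  define N :: "complex^'n^'n" where
    "N = (\<chi> i j. if i \<in> J \<and> j \<in> J then M i j else if i = j then 1 else 0)"
  define S :: "complex^'n^'n" where
    "S = (\<chi> i j. if i = j then (if i \<in> J then - 1 else 1) else 0)"
  have "transpose N = S ** N"
  proof -
    have "(S ** N) $ i $ j = N $ j $ i" for i j
    proof -
      have "(S ** N) $ i $ j = (\<Sum>l\<in>UNIV. S $ i $ l * N $ l $ j)"
        by (simp add: matrix_matrix_mult_def)
      also have "\<dots> = (\<Sum>l\<in>UNIV. if l = i then (if i \<in> J then - 1 else 1) * N $ i $ j else 0)"
        by (rule sum.cong) (auto simp: S_def)
      also have "\<dots> = N $ j $ i"
        using skew[of j i] by (auto simp: N_def)
      finally show ?thesis .
    qed
    then show ?thesis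
      by (simp add: vec_eq_iff transpose_def)
  qed
  moreover have "det S = (\<Prod>i\<in>UNIV. if i \<in> J then - 1 else 1)"
    by (subst det_diagonal) (auto simp: S_def)
  moreover have "\<dots> = (- 1) ^ card J"
    by (simp add: prod.If_cases)
  ultimately have "det N = - det N"
    using odd by (metis det_mul det_transpose mult_minus1 power_minus_odd power_one)
  then have "det N = 0" by simp
  then have "\<not> (\<exists>B. B ** N = mat 1)"
    by (metis invertible_det_nz invertible_left_inverse)
  then obtain w where w: "N *v w = 0" "w \<noteq> 0"
    unfolding matrix_left_invertible_ker by blast
  have off: "w $ i = 0" if "i \<notin> J" for i
  proof -
    have "(N *v w) $ i = (\<Sum>j\<in>UNIV. N $ i $ j * w $ j)"
      by (simp add: matrix_vector_mult_def)
    also have "\<dots> = (\<Sum>j\<in>UNIV. if j = i then w $ i else 0)"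
      by (rule sum.cong) (use that in \<open>auto simp: N_def\<close>)
    finally have "(N *v w) $ i = (\<Sum>j\<in>UNIV. if j = i then w $ i else 0)" .
    then show ?thesis using w(1) by simp
  qed
  have "(\<Sum>i\<in>UNIV. w $ i * M i j) = 0" if "j \<in> J" for j
  proof -
    have "(N *v w) $ j = (\<Sum>i\<in>UNIV. N $ j $ i * w $ i)"
      by (simp add: matrix_vector_mult_def)
    also have "\<dots> = (\<Sum>i\<in>UNIV. - (w $ i * M i j))"
    proof (rule sum.cong)
      show "N $ j $ i * w $ i = - (w $ i * M i j)" for i
        using that off[of i] skew[of j i] by (cases "i \<in> J") (auto simp: N_def)
    qed simp
    finally have "(N *v w) $ j = (\<Sum>i\<in>UNIV. - (w $ i * M i j))" .
    then show ?thesis using w(1) by (simp add: sum_negf)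
  qed
  moreover have "\<exists>i. w $ i \<noteq> 0" using w(2) by (simp add: vec_eq_iff)
  ultimately show ?thesis using off by (intro that[of "($) w"]) auto
qed

text \<open>With \<open>a\<^sub>l = x\<^sub>l\<close> for \<open>l < k\<close> and \<open>y\<^sub>m = x\<^bsub>k+m\<^esub>\<close>, the brackets of the Kronecker block are
  \<open>{a\<^sub>l, y\<^sub>m}\<^sub>1 = \<delta>\<^bsub>l,m\<^esub>\<close> and \<open>{a\<^sub>l, y\<^sub>m}\<^sub>2 = \<delta>\<^bsub>l,m+1\<^esub>\<close>.\<close>

definition kron1 :: "nat \<Rightarrow> nat \<Rightarrow> nat \<Rightarrow> complex" where
  "kron1 k i j = (if i < k \<and> j = i + k then 1 else if j < k \<and> i = j + k then - 1 else 0)"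

definition kron2 :: "nat \<Rightarrow> nat \<Rightarrow> nat \<Rightarrow> complex" where
  "kron2 k i j = (if i < k \<and> k \<le> j \<and> j + 1 = i + k then 1
     else if j < k \<and> k \<le> i \<and> i + 1 = j + k then - 1 else 0)"

lemma kron1_skew: "kron1 k i j = - kron1 k j i"
  and kron2_skew: "kron2 k i j = - kron2 k j i"
  by (auto simp: kron1_def kron2_def)

lemma om_axis_left:
  "om M (axis i 1) w = (\<Sum>j\<in>UNIV. M i j * w $ j)"
proof -
  have "om M (axis i 1) w = (\<Sum>a\<in>UNIV. if a = i then (\<Sum>j\<in>UNIV. M i j * w $ j) else 0)"
    unfolding om_def by (rule sum.cong) (auto simp: axis_def)
  then show ?thesis by simp
qed

context
  fixes c :: "'n::finite \<Rightarrow> nat" and k :: nat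
  assumes c: "bij_betw c UNIV {..<2 * k - 1}"
begin

lemma c_inv [simp]: "m < 2 * k - 1 \<Longrightarrow> c (inv c m) = m"
  using c by (simp add: bij_betw_inv_into_right)

lemma inv_c [simp]: "inv c (c i) = i"
  using c by (simp add: bij_betw_inv_into_left)

lemma c_less: "c i < 2 * k - 1"
  using c by (auto simp: bij_betw_def)

lemma om_axis_nat:
  assumes "l < 2 * k - 1"
  shows "om (\<lambda>i j. \<kappa> (c i) (c j)) (axis (inv c l) 1) w = (\<Sum>m<2 * k - 1. \<kappa> l m * w $ inv c m)"
  unfolding om_axis_left using assms
  by (subst sum.reindex_bij_betw[OF c, symmetric]) simp

text \<open>The last coefficient, \<open>l = k - 1\<close>, has no partner in the first bracket; in
  the second bracket it is \<open>l = 0\<close> that has none. These ends of the chain produce the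
  kernels.\<close>

lemma om_kron1_a:
  assumes "l < k"
  shows "om (\<lambda>i j. kron1 k (c i) (c j)) (axis (inv c l) 1) w = (if l + 1 < k then w $ inv c (l + k) else 0)"
proof -
  have lt: "l < 2 * k - 1" using assms by simp
  have "om (\<lambda>i j. kron1 k (c i) (c j)) (axis (inv c l) 1) w
      = (\<Sum>m<2 * k - 1. if m = l + k then w $ inv c m else 0)"
    unfolding om_axis_nat[OF lt] by (rule sum.cong) (use assms in \<open>auto simp: kron1_def\<close>)
  then show ?thesis using assms by (simp, linarith)
qed

lemma om_kron2_a:
  assumes "l < k"
  shows "om (\<lambda>i j. kron2 k (c i) (c j)) (axis (inv c l) 1) w = (if 0 < l then w $ inv c (l + k - 1) else 0)"
proof -
  have lt: "l < 2 * k - 1" using assms by simp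
  have "om (\<lambda>i j. kron2 k (c i) (c j)) (axis (inv c l) 1) w
      = (\<Sum>m<2 * k - 1. if m = l + k - 1 then (if 0 < l then w $ inv c m else 0) else 0)"
    unfolding om_axis_nat[OF lt] by (rule sum.cong) (use assms in \<open>auto simp: kron2_def\<close>)
  then show ?thesis using assms by (simp, linarith)
qed

lemma om_kron_y:
  assumes "l + 1 < k"
  shows "om (\<lambda>i j. kron1 k (c i) (c j)) (axis (inv c (l + k)) 1) w = - w $ inv c l"
    and "om (\<lambda>i j. kron2 k (c i) (c j)) (axis (inv c (l + k)) 1) w = - w $ inv c (l + 1)"
proof -
  have lt: "l + k < 2 * k - 1" using assms by simp
  have "om (\<lambda>i j. kron1 k (c i) (c j)) (axis (inv c (l + k)) 1) w
      = (\<Sum>m<2 * k - 1. if m = l then - w $ inv c m else 0)"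
    unfolding om_axis_nat[OF lt] by (rule sum.cong) (use assms in \<open>auto simp: kron1_def\<close>)
  then show "om (\<lambda>i j. kron1 k (c i) (c j)) (axis (inv c (l + k)) 1) w = - w $ inv c l"
    using assms by simp
  have "om (\<lambda>i j. kron2 k (c i) (c j)) (axis (inv c (l + k)) 1) w
      = (\<Sum>m<2 * k - 1. if m = l + 1 then - w $ inv c m else 0)"
    unfolding om_axis_nat[OF lt] by (rule sum.cong) (use assms in \<open>auto simp: kron2_def\<close>)
  then show "om (\<lambda>i j. kron2 k (c i) (c j)) (axis (inv c (l + k)) 1) w = - w $ inv c (l + 1)"
    using assms by simp
qed

text \<open>Pairing with the y covectors gives the recursion that multiplies by \<open>t\<close>;
  pairing with the a covectors gives a recursion for the y components that terminates at the top of
  the chain. As \<open>t\<close> varies, the kernel line follows the moment curve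
  \<open>(1, t, t^2, ...)\<close>.\<close>

lemma kron_pencil_kernel:
  assumes u: "\<And>j. om (\<lambda>i j. kron2 k (c i) (c j) - t * kron1 k (c i) (c j)) (axis j 1) u = 0"
    and m: "m < 2 * k - 1"
  shows "u $ inv c m = (if m < k then t ^ m * u $ inv c 0 else 0)"
proof -
  have eq: "om (\<lambda>i j. kron2 k (c i) (c j)) (axis j 1) u = t * om (\<lambda>i j. kron1 k (c i) (c j)) (axis j 1) u" for j
    using u[of j] om_lincomb[of 1 "\<lambda>i j. kron2 k (c i) (c j)" "- t" "\<lambda>i j. kron1 k (c i) (c j)"] by simp
  have a: "u $ inv c m = t ^ m * u $ inv c 0" if "m < k" for m
    using that
  proof (induction m)
    case (Suc m)
    then show ?case using eq[of "inv c (m + k)"] by (simp add: om_kron_y)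
  qed simp
  have y: "u $ inv c (l + k) = 0" if "l + 1 < k" for l
    using that
  \<comment> \<open>Downward induction from \<open>l = k - 2\<close>, where the right-hand side has
    no next component.\<close>
  proof (induction "k - l" arbitrary: l rule: less_induct)
    case less
    have "u $ inv c (l + k) = t * (if l + 2 < k then u $ inv c (Suc l + k) else 0)"
      using eq[of "inv c (l + 1)"] less.prems by (simp add: om_kron1_a om_kron2_a)
    also have "\<dots> = 0"
      using less.hyps[of "Suc l"] less.prems by simp
    finally show ?case .
  qed
  show ?thesis
  proof (cases "m < k")
    case True
    then show ?thesis using a[OF True] True by simp
  next
    case False
    then obtain l where l: "m = l + k"
      by (metis le_add_diff_inverse2 not_less)
    then show ?thesis using y[of l] m by simp
  qed
qed

text \<open>In a decomposition, the kernels of all brackets of the pencil lie in the block of odd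
  dimension. They span the covectors \<open>da\<^sub>l\<close>, and those form a maximal isotropic subspace.\<close>

lemma kron_no_blocks:
  fixes A B :: "complex^'n^'n"
  assumes AB: "A ** B = mat 1" and J: "J \<inter> J' = {}" "J \<union> J' = UNIV" "odd (card J)" "j0 \<in> J'"
    and b1: "\<And>i j. i \<in> J \<Longrightarrow> j \<in> J' \<Longrightarrow> om (\<lambda>i j. kron1 k (c i) (c j)) (A $ i) (A $ j) = 0"
    and b2: "\<And>i j. i \<in> J \<Longrightarrow> j \<in> J' \<Longrightarrow> om (\<lambda>i j. kron2 k (c i) (c j)) (A $ i) (A $ j) = 0"
  shows False
proof -
  have BA: "B ** A = mat 1" using AB by (simp add: matrix_left_right_inverse)
  have AB': "(\<Sum>l\<in>UNIV. A $ i $ l * B $ l $ j) = (if i = j then 1 else 0)" for i j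
    using arg_cong[OF AB, of "\<lambda>M. M $ i $ j"] by (simp add: matrix_matrix_mult_def mat_def)
  have ax: "axis l 1 = (\<Sum>i\<in>UNIV. B $ l $ i *s A $ i)" for l
    using arg_cong[OF BA, of "\<lambda>M. M $ l"]
    by (simp add: vec_eq_iff matrix_matrix_mult_def mat_def axis_def)
  have BJ: "B $ inv c m $ j = 0" if m: "m < k" and j: "j \<in> J'" for m j
  proof -
    \<comment> \<open>For every \<open>t\<close> the odd block supplies a kernel vector
      \<open>u\<close> of the pencil, a nonzero multiple of \<open>1, t, ..., t ^ (k - 1)\<close> on
      the a coordinates. Its components along the rows of \<open>A\<close> in \<open>J'\<close>
      vanish; letting \<open>t\<close> vary makes this a polynomial identity.\<close>
    have "(\<Sum>m\<le>k - 1. B $ inv c m $ j * t ^ m) = 0" for t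
    proof -
      define K where "K = (\<lambda>i j. kron2 k (c i) (c j) - t * kron1 k (c i) (c j))"
      have Ksk: "K i j = - K j i" for i j
        unfolding K_def using kron1_skew[of k "c i" "c j"] kron2_skew[of k "c i" "c j"] by simp
      have Komega: "om K u w = om (\<lambda>i j. kron2 k (c i) (c j)) u w - t * om (\<lambda>i j. kron1 k (c i) (c j)) u w" for u w
        unfolding K_def using om_lincomb[of 1 "\<lambda>i j. kron2 k (c i) (c j)" "- t" "\<lambda>i j. kron1 k (c i) (c j)"] by simp
      obtain \<eta> where \<eta>: "\<And>i. i \<notin> J \<Longrightarrow> \<eta> i = 0" "\<exists>i. \<eta> i \<noteq> 0"
        "\<And>j. j \<in> J \<Longrightarrow> (\<Sum>i\<in>UNIV. \<eta> i * om K (A $ i) (A $ j)) = 0"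
        by (rule odd_skew_kernel[of "\<lambda>i j. om K (A $ i) (A $ j)", OF om_skew[OF Ksk] J(3)]) (rule that)
      define u where "u = (\<Sum>i\<in>UNIV. \<eta> i *s A $ i)"
      have "om K u (A $ j) = 0" for j
      proof (cases "j \<in> J")
        case True
        then show ?thesis using \<eta>(3) by (simp add: u_def om_sum_left)
      next
        case False
        then have "j \<in> J'" using J by blast
        then have "\<eta> i * om K (A $ i) (A $ j) = 0" for i
          using \<eta>(1)[of i] by (cases "i \<in> J") (auto simp: Komega b1 b2)
        then show ?thesis by (simp only: u_def om_sum_left om_scale_left sum.neutral_const)
      qed
      then have "om K u (axis l 1) = 0" for l
        by (simp add: ax om_sum_right)
      then have "om K (axis l 1) u = 0" for l
        using om_skew[of K "axis l 1" u, OF Ksk] by simp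
      then have ker: "u $ inv c m = (if m < k then t ^ m * u $ inv c 0 else 0)" if "m < 2 * k - 1" for m
        using kron_pencil_kernel[of t u m] that unfolding K_def by blast
      have uB: "(\<Sum>l\<in>UNIV. u $ l * B $ l $ j) = \<eta> j" for j
      proof -
        have "(\<Sum>l\<in>UNIV. u $ l * B $ l $ j) = (\<Sum>l\<in>UNIV. \<Sum>i\<in>UNIV. \<eta> i * (A $ i $ l * B $ l $ j))"
          by (simp add: u_def sum_distrib_right mult.assoc)
        also have "\<dots> = (\<Sum>i\<in>UNIV. \<Sum>l\<in>UNIV. \<eta> i * (A $ i $ l * B $ l $ j))"
          by (rule sum.swap)
        also have "\<dots> = (\<Sum>i\<in>UNIV. if i = j then \<eta> j else 0)"
          unfolding sum_distrib_left[symmetric] AB' by (rule sum.cong) auto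
        finally show ?thesis by simp
      qed
      have u0: "u $ inv c 0 \<noteq> 0"
      proof
        assume "u $ inv c 0 = 0"
        then have "u $ i = 0" for i
          using ker[of "c i"] c_less[of i] by simp
        then show False using uB \<eta>(2) by simp
      qed
      have "0 = (\<Sum>l\<in>UNIV. u $ l * B $ l $ j)"
        using uB[of j] \<eta>(1)[of j] j J by auto
      also have "\<dots> = (\<Sum>m<2 * k - 1. u $ inv c m * B $ inv c m $ j)"
        by (subst sum.reindex_bij_betw[OF c, symmetric]) simp
      also have "\<dots> = (\<Sum>m<2 * k - 1. if m < k then t ^ m * u $ inv c 0 * B $ inv c m $ j else 0)"
      proof (rule sum.cong)
        fix m assume "m \<in> {..<2 * k - 1}"
        then show "u $ inv c m * B $ inv c m $ j = (if m < k then t ^ m * u $ inv c 0 * B $ inv c m $ j else 0)"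
          using ker[of m] by (cases "m < k") auto
      qed simp
      also have "\<dots> = (\<Sum>m\<in>{..<2 * k - 1} \<inter> {m. m < k}. t ^ m * u $ inv c 0 * B $ inv c m $ j)"
        by (simp add: sum.inter_restrict[symmetric] sum.If_cases)
      also have "{..<2 * k - 1} \<inter> {m. m < k} = {..k - 1}" using m by auto
      also have "(\<Sum>m\<le>k - 1. t ^ m * u $ inv c 0 * B $ inv c m $ j) = u $ inv c 0 * (\<Sum>m\<le>k - 1. B $ inv c m $ j * t ^ m)"
        by (simp add: sum_distrib_left algebra_simps)
      finally show ?thesis using u0 by simp
    qed
    then show ?thesis
      using polyfun_eq_0[of "\<lambda>m. B $ inv c m $ j" "k - 1"] m by auto
  qed
  \<comment> \<open>By \<open>BJ\<close> each axis covector of an a coordinate is a combination of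
    rows of \<open>A\<close> in \<open>J\<close>, so \<open>A $ j0\<close> pairs to zero with it and
    has no y components. Column \<open>j0\<close> of \<open>B\<close> vanishes on the a indices, so
    the diagonal entry of \<open>A ** B\<close> at \<open>j0\<close> becomes zero.\<close>
  have "A $ j0 $ inv c (m + k) = 0" if m: "m + 1 < k" for m
  proof -
    have "A $ j0 $ inv c (m + k) = om (\<lambda>i j. kron1 k (c i) (c j)) (axis (inv c m) 1) (A $ j0)"
      using m by (simp add: om_kron1_a)
    also have "\<dots> = (\<Sum>i\<in>UNIV. B $ inv c m $ i * om (\<lambda>i j. kron1 k (c i) (c j)) (A $ i) (A $ j0))"
      by (simp add: ax om_sum_left)
    also have "\<dots> = 0"
    proof (rule sum.neutral, rule ballI)
      show "B $ inv c m $ i * om (\<lambda>i j. kron1 k (c i) (c j)) (A $ i) (A $ j0) = 0" for i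
        using BJ[of m i] b1[of i j0] J m by (cases "i \<in> J") auto
    qed
    finally show ?thesis .
  qed
  then have "A $ j0 $ l * B $ l $ j0 = 0" for l
    using BJ[of "c l" j0] J(4) c_less[of l] by (cases "c l < k") (auto dest: meta_spec[of _ "c l - k"])
  then have "(\<Sum>l\<in>UNIV. A $ j0 $ l * B $ l $ j0) = 0"
    by (intro sum.neutral ballI)
  then show False
    using AB'[of j0 j0] by simp
qed

end

text \<open>A local isomorphism is linearized at the origin: the differentials of its components
  form an invertible matrix, and the product tensors have no mixed entries. Since the total
  dimension is odd, one of the two factors has odd dimension.\<close>

lemma kron_not_decomposable:
  fixes c :: "'n::finite \<Rightarrow> nat"
  assumes c: "bij_betw c UNIV {..<2 * k - 1}"
  shows "\<not> decomposable UNIV UNIV (\<lambda>x i j. kron1 k (c i) (c j)) (\<lambda>x i j. kron2 k (c i) (c j))"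
proof
  assume "decomposable UNIV UNIV (\<lambda>x i j. kron1 k (c i) (c j)) (\<lambda>x i j. kron2 k (c i) (c j))"
  then obtain Is Us Ps Qs where Is: "length Is = 2" "index_partition UNIV Is"
    and loc: "locally_isomorphic_at UNIV (0 :: complex^'n) UNIV (\<lambda>x i j. kron1 k (c i) (c j)) (\<lambda>x i j. kron2 k (c i) (c j))
      (prod_dom Is Us) (prod_tensor Is Ps) (prod_tensor Is Qs)"
    unfolding decomposable_def by (metis UNIV_I)
  obtain \<phi> :: "complex^'n \<Rightarrow> complex^'n" and U V where UV: "0 \<in> U" and iso: "biham_iso UNIV \<phi> U (\<lambda>x i j. kron1 k (c i) (c j))
      (\<lambda>x i j. kron2 k (c i) (c j)) V (prod_tensor Is Ps) (prod_tensor Is Qs)"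
    using loc unfolding locally_isomorphic_at_def by blast
  define \<psi> where "\<psi> = inv_into U \<phi>"
  have U: "open U" and V: "open V" and bij: "bij_betw \<phi> U V"
    and \<phi>: "\<And>i. holo U (\<lambda>x. \<phi> x $ i)" and \<psi>: "\<And>i. holo V (\<lambda>y. \<psi> y $ i)"
    and p1: "preserves_bracket UNIV \<phi> U (\<lambda>x i j. kron1 k (c i) (c j)) V (prod_tensor Is Ps)"
    and p2: "preserves_bracket UNIV \<phi> U (\<lambda>x i j. kron2 k (c i) (c j)) V (prod_tensor Is Qs)"
    using iso unfolding biham_iso_def \<psi>_def by auto
  have \<phi>0: "\<phi> 0 \<in> V" using bij UV by (auto simp: bij_betw_def)
  define A :: "complex^'n^'n" where "A = (\<chi> i. grad (\<lambda>y. \<phi> y $ i) 0)"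
  define B :: "complex^'n^'n" where "B = (\<chi> i. grad (\<lambda>y. \<psi> y $ i) (\<phi> 0))"
  have gA: "has_grad (\<lambda>y. \<phi> y $ i) (A $ i) 0" for i
    using holo_has_grad[OF U \<phi> UV] by (simp add: A_def)
  have gB: "has_grad (\<lambda>y. \<psi> y $ i) (B $ i) (\<phi> 0)" for i
    using holo_has_grad[OF V \<psi> \<phi>0] by (simp add: B_def)
  have "B ** A = mat 1"
  proof -
    have "(\<Sum>j\<in>UNIV. B $ i $ j *s A $ j) = axis i 1" for i
    proof -
      have 1: "has_grad ((\<lambda>y. \<psi> y $ i) \<circ> \<phi>) (\<Sum>j\<in>UNIV. B $ i $ j *s A $ j) 0"
        by (rule has_grad_chain[OF gA gB])
      have "((\<lambda>y. \<psi> y $ i) \<circ> \<phi>) y = y $ i" if "y \<in> U" for y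
        using that bij by (simp add: \<psi>_def bij_betw_inv_into_left)
      from has_grad_transform[OF 1 U UV this] show ?thesis
        using has_grad_nth has_grad_unique by blast
    qed
    then have "(\<Sum>j\<in>UNIV. B $ i $ j *s A $ j) $ l = axis i 1 $ l" for i l
      by simp
    then show ?thesis
      by (auto simp: vec_eq_iff matrix_matrix_mult_def mat_def axis_def)
  qed
  then have AB: "A ** B = mat 1" by (simp add: matrix_left_right_inverse)
  have om: "om M (A $ i) (A $ j) = P' (\<phi> 0) i j"
    if "preserves_bracket UNIV \<phi> U (\<lambda>x. M) V P'" for M P' i j
  proof -
    have "holo V (\<lambda>y. y $ i)" for i
      by (rule holoI) (blast intro: has_grad_nth)
    then have "bracket UNIV (\<lambda>x. M) ((\<lambda>y. y $ i) \<circ> \<phi>) ((\<lambda>y. y $ j) \<circ> \<phi>) 0 = bracket UNIV P' (\<lambda>y. y $ i) (\<lambda>y. y $ j) (\<phi> 0)"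
      using that V UV \<phi>0 unfolding preserves_bracket_def open_dom_UNIV by blast
    then show ?thesis
      by (simp add: bracket_om grad_nth_coord o_def has_grad_grad[OF gA] om_axis)
  qed
  define J0 J1 where "J0 = Is ! 0" and "J1 = Is ! 1"
  have Is_eq: "Is = [J0, J1]"
    using Is(1) by (auto simp: J0_def J1_def length_Suc_conv numeral_2_eq_2)
  have part: "J0 \<inter> J1 = {}" "J0 \<union> J1 = UNIV" "J0 \<noteq> {}" "J1 \<noteq> {}"
    using Is(2) unfolding index_partition_def Is_eq by (auto simp: less_Suc_eq)
  have zero: "prod_tensor Is Ps y i j = 0" if "i \<in> J0 \<and> j \<in> J1 \<or> i \<in> J1 \<and> j \<in> J0" for Ps y i j
    using that part(1) unfolding prod_tensor_def Is_eq by (auto simp: numeral_2_eq_2)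
  have "card J0 + card J1 = CARD('n)"
    using part by (metis card_Un_disjoint finite_code)
  also have "\<dots> = 2 * k - 1"
    using bij_betw_same_card[OF c] by simp
  \<comment> \<open>For \<open>k = 0\<close> the truncated difference \<open>2 * k - 1\<close> would
    be even; this is excluded since \<open>J0\<close> is nonempty.\<close>
  finally have "odd (card J0) \<or> odd (card J1)"
    using part(3) by (cases k) (auto dest: arg_cong[of _ _ even])
  then show False
  proof
    assume "odd (card J0)"
    moreover obtain j where "j \<in> J1" using part by blast
    ultimately show False
      using kron_no_blocks[OF c AB part(1,2)] zero om[OF p1] om[OF p2] by metis
  next
    assume "odd (card J1)"
    moreover obtain j where "j \<in> J0" using part by blast
    moreover have "J1 \<inter> J0 = {}" "J1 \<union> J0 = UNIV" using part by auto
    ultimately show False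
      using kron_no_blocks[OF c AB, of J1 J0 j] zero om[OF p1] om[OF p2] by metis
  qed
qed

section \<open>Characteristic polynomials of Jacobi matrices\<close>

text \<open>Expansion along the last row of the leading block of size \<open>n\<close>. Only
  \<open>v 0\<close> up to \<open>v (2 * n - 2)\<close> enter when \<open>n\<close> is
  positive.\<close>

fun toda_poly :: "(nat \<Rightarrow> complex) \<Rightarrow> nat \<Rightarrow> complex poly" where
  "toda_poly v 0 = 1"
| "toda_poly v (Suc 0) = [:- v 0, 1:]"
| "toda_poly v (Suc (Suc n)) = [:- v (2 * n + 2), 1:] * toda_poly v (Suc n) - smult ((v (2 * n + 1))\<^sup>2) (toda_poly v n)"

text \<open>The differentiated three-term recursion at a fixed argument \<open>y\<close>, with
  \<open>e m\<close> standing for the differential of \<open>v m\<close>.\<close>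

fun toda_grad :: "(nat \<Rightarrow> complex^'n) \<Rightarrow> (nat \<Rightarrow> complex) \<Rightarrow> nat \<Rightarrow> complex \<Rightarrow> complex^'n" where
  "toda_grad e v 0 y = 0"
| "toda_grad e v (Suc 0) y = - e 0"
| "toda_grad e v (Suc (Suc n)) y = (y - v (2 * n + 2)) *s toda_grad e v (Suc n) y
     - poly (toda_poly v (Suc n)) y *s e (2 * n + 2)
     - (2 * v (2 * n + 1) * poly (toda_poly v n) y) *s e (2 * n + 1)
     - (v (2 * n + 1))\<^sup>2 *s toda_grad e v n y"

text \<open>The Christoffel--Darboux kernel, that is,
  \<open>(D\<^sub>n(x) D\<^bsub>n-1\<^esub>(y) - D\<^sub>n(y) D\<^bsub>n-1\<^esub>(x)) / (x - y)\<close> for \<open>D = toda_poly v\<close>, defined also for \<open>x = y\<close>.\<close>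

fun toda_kernel :: "(nat \<Rightarrow> complex) \<Rightarrow> nat \<Rightarrow> complex \<Rightarrow> complex \<Rightarrow> complex" where
  "toda_kernel v 0 x y = 0"
| "toda_kernel v (Suc 0) x y = 1"
| "toda_kernel v (Suc (Suc n)) x y = poly (toda_poly v (Suc n)) x * poly (toda_poly v (Suc n)) y
     + (v (2 * n + 1))\<^sup>2 * toda_kernel v (Suc n) x y"

lemma toda_kernel_commute: "toda_kernel v n x y = toda_kernel v n y x"
  by (induction v n x y rule: toda_kernel.induct) (simp_all add: mult.commute)

lemma toda_kernel_diff:
  "(x - y) * toda_kernel v (Suc n) x y = poly (toda_poly v (Suc n)) x * poly (toda_poly v n) y
     - poly (toda_poly v (Suc n)) y * poly (toda_poly v n) x"
proof (induction n)
  case (Suc n)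
  have "(x - y) * toda_kernel v (Suc (Suc n)) x y
      = (x - y) * poly (toda_poly v (Suc n)) x * poly (toda_poly v (Suc n)) y
        + (v (2 * n + 1))\<^sup>2 * ((x - y) * toda_kernel v (Suc n) x y)"
    by (simp add: algebra_simps)
  then show ?case unfolding Suc by (simp add: algebra_simps)
qed simp

lemma poly_pderiv_toda_poly:
  "poly (pderiv (toda_poly v (Suc (Suc n)))) y = poly (toda_poly v (Suc n)) y
     + (y - v (2 * n + 2)) * poly (pderiv (toda_poly v (Suc n))) y
     - (v (2 * n + 1))\<^sup>2 * poly (pderiv (toda_poly v n)) y"
  by (simp add: pderiv_mult pderiv_diff pderiv_add pderiv_smult pderiv_pCons algebra_simps)

text \<open>The confluent Christoffel--Darboux identity, obtained from the differentiated recursion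
  rather than by a limit.\<close>

lemma toda_kernel_diag:
  "toda_kernel v (Suc n) x x = poly (pderiv (toda_poly v (Suc n))) x * poly (toda_poly v n) x
     - poly (toda_poly v (Suc n)) x * poly (pderiv (toda_poly v n)) x"
proof (induction n)
  case (Suc n)
  show ?case
    unfolding toda_kernel.simps Suc poly_pderiv_toda_poly
    by (simp add: algebra_simps power2_eq_square)
qed (simp add: pderiv_pCons)

lemma toda_poly_degree: "degree (toda_poly v n) = n \<and> lead_coeff (toda_poly v n) = 1"
proof (induction v n rule: toda_poly.induct)
  case (3 v n)
  have 1: "degree ([:- v (2 * n + 2), 1:] * toda_poly v (Suc n)) = Suc (Suc n)"
    using 3 by (subst degree_mult_eq) auto
  have 2: "degree (smult ((v (2 * n + 1))\<^sup>2) (toda_poly v n)) < Suc (Suc n)"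
    using 3 by (simp add: degree_smult_eq)
  have "degree (toda_poly v (Suc (Suc n))) = Suc (Suc n)"
    unfolding toda_poly.simps diff_conv_add_uminus
    by (subst degree_add_eq_left) (use 1 2 in auto)
  moreover have "coeff (toda_poly v (Suc n)) (Suc n) = 1" using 3 by metis
  then have "coeff (toda_poly v (Suc (Suc n))) (Suc (Suc n)) = 1"
    using 3 2 by (simp add: coeff_eq_0)
  ultimately show ?case by simp
qed auto

text \<open>A common root of two consecutive polynomials would descend through the recursion, across
  nonzero off-diagonal entries, down to the constant polynomial 1.\<close>

lemma toda_poly_coprime:
  assumes "\<And>m. m < n \<Longrightarrow> v (2 * m + 1) \<noteq> 0" "poly (toda_poly v (Suc n)) x = 0"
  shows "poly (toda_poly v n) x \<noteq> 0"
  using assms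
proof (induction n)
  case (Suc n)
  show ?case
  proof
    assume "poly (toda_poly v (Suc n)) x = 0"
    moreover from this have "poly (toda_poly v n) x \<noteq> 0" using Suc by simp
    ultimately show False using Suc.prems(2) Suc.prems(1)[of n] by simp
  qed
qed simp

text \<open>The argument is allowed to move with \<open>x\<close> because p is later evaluated at
  the roots of q.\<close>

lemma has_grad_toda_poly:
  fixes f :: "complex^'n::finite \<Rightarrow> complex"
  assumes f: "has_grad f F x"
  shows "has_grad (\<lambda>x. poly (toda_poly (\<lambda>m. x $ \<sigma> m) n) (f x))
     (toda_grad (\<lambda>m. axis (\<sigma> m) 1) (\<lambda>m. x $ \<sigma> m) n (f x)
       + poly (pderiv (toda_poly (\<lambda>m. x $ \<sigma> m) n)) (f x) *s F) x"
proof (induction n rule: induct_nat_012)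
  case 0
  show ?case using has_grad_const[of 1 x] by simp
next
  case 1
  show ?case using has_grad_diff[OF f has_grad_nth] by (simp add: pderiv_pCons)
next
  case (ge2 n)
  let ?v = "\<lambda>m. x $ \<sigma> m"
  have "has_grad (\<lambda>x. (f x - x $ \<sigma> (2 * n + 2)) * poly (toda_poly (\<lambda>m. x $ \<sigma> m) (Suc n)) (f x)
      - (x $ \<sigma> (2 * n + 1))\<^sup>2 * poly (toda_poly (\<lambda>m. x $ \<sigma> m) n) (f x))
     (((f x - ?v (2 * n + 2)) *s (toda_grad (\<lambda>m. axis (\<sigma> m) 1) ?v (Suc n) (f x)
           + poly (pderiv (toda_poly ?v (Suc n))) (f x) *s F)
        + poly (toda_poly ?v (Suc n)) (f x) *s (F - axis (\<sigma> (2 * n + 2)) 1))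
      - ((?v (2 * n + 1))\<^sup>2 *s (toda_grad (\<lambda>m. axis (\<sigma> m) 1) ?v n (f x)
           + poly (pderiv (toda_poly ?v n)) (f x) *s F)
        + poly (toda_poly ?v n) (f x) *s ((of_nat 2 * ?v (2 * n + 1) ^ (2 - 1)) *s axis (\<sigma> (2 * n + 1)) 1))) x"
    by (intro has_grad_diff has_grad_mult has_grad_power has_grad_nth f ge2)
  moreover have "((f x - ?v (2 * n + 2)) *s (toda_grad (\<lambda>m. axis (\<sigma> m) 1) ?v (Suc n) (f x)
           + poly (pderiv (toda_poly ?v (Suc n))) (f x) *s F)
        + poly (toda_poly ?v (Suc n)) (f x) *s (F - axis (\<sigma> (2 * n + 2)) 1))
      - ((?v (2 * n + 1))\<^sup>2 *s (toda_grad (\<lambda>m. axis (\<sigma> m) 1) ?v n (f x)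
           + poly (pderiv (toda_poly ?v n)) (f x) *s F)
        + poly (toda_poly ?v n) (f x) *s ((of_nat 2 * ?v (2 * n + 1) ^ (2 - 1)) *s axis (\<sigma> (2 * n + 1)) 1))
     = toda_grad (\<lambda>m. axis (\<sigma> m) 1) ?v (Suc (Suc n)) (f x)
       + poly (pderiv (toda_poly ?v (Suc (Suc n)))) (f x) *s F"
    unfolding poly_pderiv_toda_poly by (simp add: vec_eq_iff algebra_simps)
  moreover have "(\<lambda>x. poly (toda_poly (\<lambda>m. x $ \<sigma> m) (Suc (Suc n))) (f x))
    = (\<lambda>x. (f x - x $ \<sigma> (2 * n + 2)) * poly (toda_poly (\<lambda>m. x $ \<sigma> m) (Suc n)) (f x)
      - (x $ \<sigma> (2 * n + 1))\<^sup>2 * poly (toda_poly (\<lambda>m. x $ \<sigma> m) n) (f x))"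
    by (simp add: fun_eq_iff algebra_simps)
  ultimately show ?case by (simp only:)
qed

section \<open>Brackets of consecutive characteristic polynomials\<close>

definition toda_pencil :: "('n::finite \<Rightarrow> nat) \<Rightarrow> complex \<Rightarrow> complex \<Rightarrow> 'n tensor" where
  "toda_pencil c \<alpha> \<beta> x i j = \<alpha> * toda1 c x i j + \<beta> * toda2 c x i j"

lemma toda_pencil_skew: "toda_pencil c \<alpha> \<beta> x i j = - toda_pencil c \<alpha> \<beta> x j i"
  by (simp add: toda_pencil_def toda1_def toda2_def Let_def algebra_simps)

context
  fixes c :: "'n::finite \<Rightarrow> nat" and k :: nat and x :: "complex^'n" and \<alpha> \<beta> :: complex
  assumes c: "bij_betw c UNIV {..<2 * k - 1}"
begin

private abbreviation e :: "nat \<Rightarrow> complex^'n" where "e m \<equiv> axis (inv c m) 1"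
private abbreviation v :: "nat \<Rightarrow> complex" where "v m \<equiv> x $ inv c m"
private abbreviation w :: "complex^'n \<Rightarrow> complex^'n \<Rightarrow> complex" where "w \<equiv> om (toda_pencil c \<alpha> \<beta> x)"
private abbreviation D :: "nat \<Rightarrow> complex \<Rightarrow> complex" where "D n y \<equiv> poly (toda_poly v n) y"
private abbreviation G :: "nat \<Rightarrow> complex \<Rightarrow> complex^'n" where "G n y \<equiv> toda_grad e v n y"

private lemma w_skew: "w a b = - w b a"
  by (rule om_skew) (rule toda_pencil_skew)

private lemma w_self: "w a a = 0"
  using w_skew[of a a] by simp

private lemma w_e:
  assumes "i < 2 * k - 1" "j < 2 * k - 1"
  shows "w (e i) (e j) = \<alpha> * (toda_table1 v i j - toda_table1 v j i) + \<beta> * (toda_table2 v i j - toda_table2 v j i)"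
  using assms c_inv[OF c] by (simp add: om_axis toda_pencil_def toda1_def toda2_def Let_def)

private lemma w_e_far:
  assumes "i < 2 * k - 1" "j < 2 * k - 1" "i + 2 < j"
  shows "w (e i) (e j) = 0"
  using assms by (simp add: w_e toda_table1_def toda_table2_def)

private lemma w_e_ee:
  assumes "2 * n + 2 < 2 * k - 1"
  shows "w (e (2 * n)) (e (2 * n + 2)) = - 2 * \<beta> * (v (2 * n + 1))\<^sup>2"
  using assms by (simp add: w_e toda_table1_def toda_table2_def)

private lemma w_e_eo:
  assumes "2 * n + 1 < 2 * k - 1"
  shows "w (e (2 * n)) (e (2 * n + 1)) = - (\<alpha> + \<beta> * v (2 * n)) * v (2 * n + 1)"
  using assms by (simp add: w_e toda_table1_def toda_table2_def algebra_simps)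

private lemma w_e_eo':
  assumes "2 * n + 2 < 2 * k - 1"
  shows "w (e (2 * n + 2)) (e (2 * n + 1)) = (\<alpha> + \<beta> * v (2 * n + 2)) * v (2 * n + 1)"
  using assms by (simp add: w_e toda_table1_def toda_table2_def algebra_simps)

private lemma w_e_oo:
  assumes "2 * n + 3 < 2 * k - 1"
  shows "w (e (2 * n + 1)) (e (2 * n + 3)) = - (1/2) * \<beta> * v (2 * n + 1) * v (2 * n + 3)"
  using assms by (simp add: w_e toda_table1_def toda_table2_def algebra_simps)

private lemma w_e_oe:
  assumes "2 * n + 4 < 2 * k - 1"
  shows "w (e (2 * n + 1)) (e (2 * n + 4)) = 0"
  by (rule w_e_far) (use assms in auto)

text \<open>The polynomial of index \<open>n\<close> stops at \<open>v (2 * n - 2)\<close>, and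
  neither bracket couples coordinates more than 2 apart.\<close>

private lemma w_G_far:
  assumes "2 * n < j" "j < 2 * k - 1"
  shows "w (G n y) (e j) = 0"
  using assms
proof (induction n rule: induct_nat_012)
  case (ge2 n)
  then show ?case using w_e_far[of "2 * n + 2" j] w_e_far[of "2 * n + 1" j] by simp
qed (auto simp: w_e_far)

private lemma w_G_odd:
  assumes "2 * n + 1 < 2 * k - 1"
  shows "w (G (Suc n) y) (e (2 * n + 1)) = v (2 * n + 1) * ((\<alpha> + \<beta> * y) * D n y - \<beta> * D (Suc n) y)"
proof (cases n)
  case 0
  have "w (G (Suc n) y) (e (2 * n + 1)) = - w (e (2 * 0)) (e (2 * 0 + 1))"
    using 0 by simp
  also have "\<dots> = v 1 * ((\<alpha> + \<beta> * y) - \<beta> * (y - v 0))"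
    using assms 0 by (subst w_e_eo) (simp_all add: algebra_simps)
  finally show ?thesis using 0 by simp
next
  case (Suc m)
  then have "w (G (Suc m) y) (e (2 * m + 3)) = 0" "w (G m y) (e (2 * m + 3)) = 0"
    using assms by (auto intro!: w_G_far)
  moreover have "w (e (2 * m + 2)) (e (2 * m + 3)) = - (\<alpha> + \<beta> * v (2 * m + 2)) * v (2 * m + 3)"
    using w_e_eo[of "Suc m"] assms Suc by (simp add: eval_nat_numeral)
  moreover have "w (e (2 * m + 1)) (e (2 * m + 3)) = - (1/2) * \<beta> * v (2 * m + 1) * v (2 * m + 3)"
    using w_e_oo[of m] assms Suc by simp
  moreover have "2 * n + 1 = 2 * m + 3" using Suc by simp
  ultimately show ?thesis
    by (simp only: Suc toda_grad.simps om_diff_left om_scale_left toda_poly.simps)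
      (simp add: algebra_simps power2_eq_square)
qed

private lemma w_G_even:
  assumes "2 * n + 2 < 2 * k - 1"
  shows "w (G (Suc n) y) (e (2 * n + 2)) = 2 * \<beta> * (v (2 * n + 1))\<^sup>2 * D n y"
proof (cases n)
  case 0
  then show ?thesis using w_e_ee[of 0] assms by simp
next
  case (Suc m)
  then have "w (G (Suc m) y) (e (2 * m + 4)) = 0" "w (G m y) (e (2 * m + 4)) = 0"
    using assms by (auto intro!: w_G_far)
  moreover have "w (e (2 * m + 2)) (e (2 * m + 4)) = - 2 * \<beta> * (v (2 * m + 3))\<^sup>2"
    using w_e_ee[of "Suc m"] assms Suc by (simp add: eval_nat_numeral)
  moreover have "w (e (2 * m + 1)) (e (2 * m + 4)) = 0"
    using w_e_oe[of m] assms Suc by simp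
  moreover have "2 * n + 1 = 2 * m + 3" "2 * n + 2 = 2 * m + 4" using Suc by auto
  ultimately show ?thesis
    by (simp only: Suc toda_grad.simps om_diff_left om_scale_left)
      (simp add: algebra_simps power2_eq_square)
qed

text \<open>The three identities feed each other and have to be carried together. Both arguments are
  general because the step also uses them interchanged.\<close>

private lemma toda_brackets_aux:
  assumes "Suc n \<le> k"
  shows "w (G n y) (G n z) = 0 \<and> w (G (Suc n) y) (G (Suc n) z) = 0 \<and>
    w (G (Suc n) y) (G n z) = 2 * (\<alpha> + \<beta> * y) * (toda_kernel v (Suc n) y z - D n y * D n z)"
  using assms
proof (induction n arbitrary: y z)
  case 0
  then show ?case by (simp add: w_self)
next
  case (Suc n)
  define a where "a = v (2 * n + 1)"
  define b where "b = v (2 * n + 2)"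
  define ea where "ea = e (2 * n + 1)"
  define eb where "eb = e (2 * n + 2)"
  define S where "S = toda_kernel v (Suc n) y z"
  define A where "A = D (Suc n)"
  define B where "B = D n"
  have n: "2 * n + 1 < 2 * k - 1" "2 * n + 2 < 2 * k - 1" "Suc n \<le> k" using Suc.prems by auto
  have GA: "G (Suc (Suc n)) t = (t - b) *s G (Suc n) t - A t *s eb - (2 * a * B t) *s ea - a\<^sup>2 *s G n t" for t
    by (simp add: a_def b_def ea_def eb_def A_def B_def)
  have K: "w (G (Suc n) s) (G n t) = 2 * (\<alpha> + \<beta> * s) * (toda_kernel v (Suc n) s t - B s * B t)" for s t
    using Suc.IH[OF n(3)] by (simp add: B_def)
  have Z: "w (G (Suc n) s) (G (Suc n) t) = 0" "w (G n s) (G n t) = 0" for s t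
    using Suc.IH[OF n(3)] by auto
  have S': "toda_kernel v (Suc n) z y = S" unfolding S_def by (rule toda_kernel_commute)
  have cd: "(y - z) * S = A y * B z - A z * B y"
    unfolding S_def A_def B_def by (rule toda_kernel_diff)
  have W1: "w (G (Suc n) t) ea = a * ((\<alpha> + \<beta> * t) * B t - \<beta> * A t)" for t
    unfolding a_def ea_def A_def B_def by (rule w_G_odd[OF n(1)])
  have W2: "w (G (Suc n) t) eb = 2 * \<beta> * a\<^sup>2 * B t" for t
    unfolding a_def eb_def B_def by (rule w_G_even[OF n(2)])
  have W3: "w (G n t) ea = 0" "w (G n t) eb = 0" for t
    unfolding ea_def eb_def by (rule w_G_far; use n in simp)+
  have W4: "w eb ea = (\<alpha> + \<beta> * b) * a"
    unfolding a_def b_def ea_def eb_def by (rule w_e_eo'[OF n(2)])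
  have W5: "w ea (G (Suc n) t) = - (a * ((\<alpha> + \<beta> * t) * B t - \<beta> * A t))"
    "w eb (G (Suc n) t) = - (2 * \<beta> * a\<^sup>2 * B t)" "w ea (G n t) = 0" "w eb (G n t) = 0"
    "w (G n s) (G (Suc n) t) = - (2 * (\<alpha> + \<beta> * t) * (toda_kernel v (Suc n) t s - B t * B s))" for s t
    using w_skew[of ea "G (Suc n) t"] w_skew[of eb "G (Suc n) t"] w_skew[of ea "G n t"] w_skew[of eb "G n t"]
      w_skew[of "G n s" "G (Suc n) t"] W1 W2 W3 K by auto
  have W6: "w ea eb = - ((\<alpha> + \<beta> * b) * a)" using w_skew[of ea eb] W4 by simp
  have "w (G (Suc (Suc n)) y) (G (Suc n) z)
     = 2 * \<beta> * a\<^sup>2 * (A y * B z - A z * B y) + 2 * a\<^sup>2 * (\<alpha> + \<beta> * z) * S"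
    unfolding GA by (simp add: W5 Z S' algebra_simps power2_eq_square)
  \<comment> \<open>The Christoffel--Darboux identity replaces the antisymmetric expression by
    \<open>(y - z) * S\<close>, which turns the factor \<open>\<alpha> + \<beta> * z\<close> into
    \<open>\<alpha> + \<beta> * y\<close>.\<close>
  also have "\<dots> = 2 * (\<alpha> + \<beta> * y) * (a\<^sup>2 * S)"
    unfolding cd[symmetric] by (simp add: algebra_simps)
  also have "\<dots> = 2 * (\<alpha> + \<beta> * y) * (toda_kernel v (Suc (Suc n)) y z - A y * A z)"
    by (simp add: S_def a_def A_def)
  finally have 1: "w (G (Suc (Suc n)) y) (G (Suc n) z)
     = 2 * (\<alpha> + \<beta> * y) * (toda_kernel v (Suc (Suc n)) y z - D (Suc n) y * D (Suc n) z)"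
    unfolding A_def .
  have "w (G (Suc (Suc n)) y) (G (Suc (Suc n)) z) = 0"
  proof -
    have "w (G (Suc (Suc n)) y) (G (Suc (Suc n)) z)
      = 2 * a\<^sup>2 * (\<alpha> + \<beta> * (y + z - b)) * ((A y * B z - A z * B y) - (y - z) * S)"
      unfolding GA
      by (simp add: W1 W2 W3 W4 W5 W6 K Z S_def[symmetric] S' w_self algebra_simps power2_eq_square)
    then show ?thesis using cd by simp
  qed
  with 1 Z show ?case by blast
qed

lemma toda_brackets:
  assumes "k = Suc n"
  shows "om (toda_pencil c \<alpha> \<beta> x) (toda_grad (\<lambda>m. axis (inv c m) 1) (\<lambda>m. x $ inv c m) k y)
      (toda_grad (\<lambda>m. axis (inv c m) 1) (\<lambda>m. x $ inv c m) k z) = 0"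
    and "om (toda_pencil c \<alpha> \<beta> x) (toda_grad (\<lambda>m. axis (inv c m) 1) (\<lambda>m. x $ inv c m) n y)
      (toda_grad (\<lambda>m. axis (inv c m) 1) (\<lambda>m. x $ inv c m) n z) = 0"
    and "om (toda_pencil c \<alpha> \<beta> x) (toda_grad (\<lambda>m. axis (inv c m) 1) (\<lambda>m. x $ inv c m) k y)
      (toda_grad (\<lambda>m. axis (inv c m) 1) (\<lambda>m. x $ inv c m) n z)
      = 2 * (\<alpha> + \<beta> * y) * (toda_kernel (\<lambda>m. x $ inv c m) k y z
          - poly (toda_poly (\<lambda>m. x $ inv c m) n) y * poly (toda_poly (\<lambda>m. x $ inv c m) n) z)"
  using toda_brackets_aux[of n y z] assms by auto

end

section \<open>Roots of monic polynomials\<close>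

text \<open>The modulus of a monic polynomial at \<open>z\<close> is the product of the distances
  from \<open>z\<close> to its roots, so not all of them can be at least \<open>e\<close>.\<close>

lemma monic_root_near:
  fixes p :: "complex poly"
  assumes "lead_coeff p = 1" "cmod (poly p z) < e ^ degree p" "0 < e"
  shows "\<exists>w. poly p w = 0 \<and> dist z w < e"
proof (rule ccontr)
  assume no: "\<not> ?thesis"
  have "p \<noteq> 0" using assms(1) by auto
  then obtain A where A: "size A = degree p" "p = (\<Prod>x\<in>#A. [:- x, 1:])"
    using alg_closed_imp_factorization[of p] assms(1) by (metis smult_1_left)
  have root: "poly p b = 0" if "b \<in># A" for b
    using that by (subst A(2)) (auto simp: poly_prod_mset)
  have "e ^ size B \<le> cmod (poly (\<Prod>x\<in>#B. [:- x, 1:]) z)" if "\<And>b. b \<in># B \<Longrightarrow> poly p b = 0" for B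
    using that
  proof (induction B)
    case (add b B)
    have "e \<le> cmod (z - b)"
      using no add.prems[of b] by (force simp: dist_norm not_less)
    moreover have "e ^ size B \<le> cmod (poly (\<Prod>x\<in>#B. [:- x, 1:]) z)"
      using add by simp
    ultimately have "e * e ^ size B \<le> cmod (z - b) * cmod (poly (\<Prod>x\<in>#B. [:- x, 1:]) z)"
      using assms(3) by (intro mult_mono) auto
    then show ?case by (simp add: norm_mult[symmetric] algebra_simps)
  qed simp
  from this[of A] root have "e ^ degree p \<le> cmod (poly p z)"
    using A by simp
  then show False
    using assms(2) by simp
qed

lemma monic_eq_prod_roots:
  fixes p :: "complex poly"
  assumes p: "degree p = k" "lead_coeff p = 1" and l: "inj_on l {..<k}" "\<And>j. j < k \<Longrightarrow> poly p (l j) = 0"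
  shows "p = (\<Prod>j<k. [:- l j, 1:])"
proof (rule ccontr)
  define r where "r = (\<Prod>j<k. [:- l j, 1:])"
  assume "p \<noteq> (\<Prod>j<k. [:- l j, 1:])"
  then have ne: "p - r \<noteq> 0" by (simp add: r_def)
  have r: "degree r = k" "lead_coeff r = 1"
    unfolding r_def lead_coeff_prod by (simp_all add: degree_prod_eq_sum_degree)
  have "k \<le> card {x. poly (p - r) x = 0}"
  proof -
    have "l ` {..<k} \<subseteq> {x. poly (p - r) x = 0}"
      using l(2) by (auto simp: r_def poly_prod)
    then have "card (l ` {..<k}) \<le> card {x. poly (p - r) x = 0}"
      by (intro card_mono poly_roots_finite ne)
    then show ?thesis using l(1) by (simp add: card_image)
  qed
  also have "\<dots> \<le> degree (p - r)"
    using ne by (rule card_poly_roots_bound)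
  finally have "degree (p - r) = k"
    using degree_diff_le_max[of p r] p r by simp
  moreover have "coeff (p - r) k = 0" using p r by (metis coeff_diff diff_self)
  ultimately have "lead_coeff (p - r) = 0" by simp
  then show False using ne leading_coeff_0_iff by blast
qed

text \<open>Disjoint discs around the simple roots at \<open>x0\<close> each keep a root for nearby
  \<open>x\<close>, and degree \<open>k\<close> leaves exactly one per disc. The choice by
  \<open>SOME\<close> is then forced, and closeness of roots implies continuity.\<close>

lemma monic_roots_continuous:
  fixes q :: "'a::metric_space \<Rightarrow> complex poly"
  assumes q: "\<And>x. degree (q x) = k" "\<And>x. lead_coeff (q x) = 1"
    and cont: "\<And>z. continuous_on UNIV (\<lambda>x. poly (q x) z)"
    and l0: "inj_on l0 {..<k}" "\<And>j. j < k \<Longrightarrow> poly (q x0) (l0 j) = 0"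
  obtains W l where "open W" "x0 \<in> W" "\<And>j. j < k \<Longrightarrow> l j x0 = l0 j" "\<And>j. j < k \<Longrightarrow> continuous_on W (l j)"
    "\<And>x. x \<in> W \<Longrightarrow> inj_on (\<lambda>j. l j x) {..<k}" "\<And>x. x \<in> W \<Longrightarrow> q x = (\<Prod>j<k. [:- l j x, 1:])"
proof -
  have "\<exists>e>0. \<forall>i<k. \<forall>j<k. i \<noteq> j \<longrightarrow> 2 * e \<le> dist (l0 i) (l0 j)"
  proof -
    \<comment> \<open>The extra element 1 keeps the minimum defined when there are fewer than two
      roots.\<close>
    define S where "S = insert 1 ((\<lambda>(i, j). dist (l0 i) (l0 j)) ` {(i, j). i < k \<and> j < k \<and> i \<noteq> j})"
    have "finite {(i, j). i < k \<and> j < k \<and> i \<noteq> j}"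
      by (rule finite_subset[of _ "{..<k} \<times> {..<k}"]) auto
    then have fin: "finite S" by (simp add: S_def)
    have "0 < Min S"
      using fin l0(1) by (auto simp: S_def inj_on_def)
    moreover have "Min S \<le> dist (l0 i) (l0 j)" if "i < k" "j < k" "i \<noteq> j" for i j
      by (rule Min_le[OF fin]) (use that in \<open>auto simp: S_def\<close>)
    ultimately show ?thesis by (intro exI[of _ "Min S / 2"]) auto
  qed
  then obtain e where e: "0 < e" "\<And>i j. i < k \<Longrightarrow> j < k \<Longrightarrow> i \<noteq> j \<Longrightarrow> 2 * e \<le> dist (l0 i) (l0 j)"
    by blast
  define W where "W = (\<Inter>j\<in>{..<k}. {x. cmod (poly (q x) (l0 j)) < e ^ k})"
  define l where "l j x = (SOME w. poly (q x) w = 0 \<and> dist (l0 j) w < e)" for j x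
  have W: "open W" unfolding W_def
    by (intro open_INT ballI open_Collect_less continuous_intros cont) auto
  have x0: "x0 \<in> W" using l0(2) e(1) by (simp add: W_def)
  have l: "poly (q x) (l j x) = 0" "dist (l0 j) (l j x) < e" if "x \<in> W" "j < k" for x j
  proof -
    have "\<exists>w. poly (q x) w = 0 \<and> dist (l0 j) w < e"
      using monic_root_near[of "q x" "l0 j" e] q that e(1) by (simp add: W_def)
    from someI_ex[OF this] show "poly (q x) (l j x) = 0" "dist (l0 j) (l j x) < e"
      by (auto simp: l_def)
  qed
  have sep: "i = j" if "i < k" "j < k" "dist (l0 i) w < e" "dist (l0 j) w < e" for i j w
    using e(2)[of i j] dist_triangle2[of "l0 i" "l0 j" w] that by force
  have inj: "inj_on (\<lambda>j. l j x) {..<k}" if "x \<in> W" for x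
  proof (rule inj_onI)
    fix i j assume "i \<in> {..<k}" "j \<in> {..<k}" "l i x = l j x"
    then show "i = j" using sep[of i j "l i x"] l(2)[OF that, of i] l(2)[OF that, of j] by simp
  qed
  have prod: "q x = (\<Prod>j<k. [:- l j x, 1:])" if "x \<in> W" for x
    by (rule monic_eq_prod_roots[OF q inj[OF that] l(1)[OF that]])
  have uniq: "w = l j x" if "x \<in> W" "j < k" "poly (q x) w = 0" "dist (l0 j) w < e" for x j w
  proof -
    have "poly (\<Prod>j<k. [:- l j x, 1:]) w = 0" using that(3) prod[OF that(1)] by simp
    then obtain i where i: "i < k" "w = l i x" by (auto simp: poly_prod)
    then show ?thesis using sep[of i j w] l(2)[OF that(1), of i] that by simp
  qed
  have "isCont (l j) x" if x: "x \<in> W" and j: "j < k" for x j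
    unfolding continuous_at_eps_delta
  proof (intro allI impI)
    fix d :: real assume "0 < d"
    \<comment> \<open>A root within \<open>d'\<close> of \<open>l j x\<close> is still inside the
      disc around \<open>l0 j\<close>, hence is the selected one.\<close>
    define d' where "d' = min d (e - dist (l0 j) (l j x))"
    have d': "0 < d'" using \<open>0 < d\<close> l(2)[OF x j] by (simp add: d'_def)
    have "open {y. cmod (poly (q y) (l j x)) < d' ^ k}"
      by (intro open_Collect_less continuous_intros cont)
    then have "open (W \<inter> {y. cmod (poly (q y) (l j x)) < d' ^ k})" using W by blast
    moreover have "x \<in> W \<inter> {y. cmod (poly (q y) (l j x)) < d' ^ k}"
      using x l(1)[OF x j] d' by simp
    ultimately obtain \<epsilon> where \<epsilon>: "\<epsilon> > 0" "ball x \<epsilon> \<subseteq> W \<inter> {y. cmod (poly (q y) (l j x)) < d' ^ k}"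
      using open_contains_ball by blast
    have "dist (l j y) (l j x) < d" if "dist y x < \<epsilon>" for y
    proof -
      have y: "y \<in> W" "cmod (poly (q y) (l j x)) < d' ^ k"
        using that \<epsilon>(2) by (auto simp: dist_commute)
      then obtain w where w: "poly (q y) w = 0" "dist (l j x) w < d'"
        using monic_root_near[of "q y" "l j x" d'] q d' by auto
      have "dist (l0 j) w < e"
        using dist_triangle[of "l0 j" w "l j x"] w(2) by (simp add: d'_def)
      then have "w = l j y" using uniq[OF y(1) j w(1)] by simp
      then show ?thesis using w(2) by (simp add: d'_def dist_commute)
    qed
    then show "\<exists>\<epsilon>>0. \<forall>y. dist y x < \<epsilon> \<longrightarrow> dist (l j y) (l j x) < d"
      using \<epsilon>(1) by blast
  qed
  then have "continuous_on W (l j)" if "j < k" for j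
    using that continuous_at_imp_continuous_on by blast
  moreover have "l j x0 = l0 j" if "j < k" for j
    using uniq[OF x0 that, of "l0 j"] l0(2)[OF that] e(1) by simp
  ultimately show ?thesis
    using W x0 inj prod by (intro that[of W l]) auto
qed

text \<open>The interpolant is a combination of monic polynomials of degree \<open>k - 1\<close>;
  comparing its top coefficient with that of \<open>H\<close> gives the second formula, the sum of
  the residues of H/q.\<close>

lemma lagrange_interpolation:
  fixes l :: "nat \<Rightarrow> complex"
  assumes l: "inj_on l {..<k}" and H: "degree H < k"
  shows "(\<Sum>j<k. poly H (l j) / (\<Prod>i\<in>{..<k} - {j}. l j - l i) * (\<Prod>i\<in>{..<k} - {j}. y - l i)) = poly H y"
    and "(\<Sum>j<k. poly H (l j) / (\<Prod>i\<in>{..<k} - {j}. l j - l i)) = coeff H (k - 1)"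
proof -
  define N where "N j = (\<Prod>i\<in>{..<k} - {j}. [:- l i, 1:])" for j
  define R where "R = (\<Sum>j<k. smult (poly H (l j) / (\<Prod>i\<in>{..<k} - {j}. l j - l i)) (N j))"
  have N: "poly (N j) y = (\<Prod>i\<in>{..<k} - {j}. y - l i)" for j y
    by (simp add: N_def poly_prod)
  have degN: "degree (N j) = k - 1" "lead_coeff (N j) = 1" if "j < k" for j
    using that unfolding N_def lead_coeff_prod by (simp_all add: degree_prod_eq_sum_degree)
  have degR: "degree R < k"
    unfolding R_def
    by (rule degree_sum_less) (use H degN in \<open>auto intro!: le_less_trans[OF degree_smult_le]\<close>)
  have "R = H"
  proof (rule poly_eqI_degree)
    fix z assume "z \<in> l ` {..<k}"
    then obtain m where m: "m < k" "z = l m" by auto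
    have nz: "(\<Prod>i\<in>{..<k} - {m}. l m - l i) \<noteq> 0"
      using l m by (auto simp: inj_on_def)
    have "poly R z = (\<Sum>j<k. if j = m then poly H z else 0)"
      unfolding R_def poly_sum
    proof (rule sum.cong)
      fix j assume "j \<in> {..<k}"
      show "poly (smult (poly H (l j) / (\<Prod>i\<in>{..<k} - {j}. l j - l i)) (N j)) z = (if j = m then poly H z else 0)"
      proof (cases "j = m")
        case False
        then have "(\<Prod>i\<in>{..<k} - {j}. z - l i) = 0" using m by (intro prod_zero) auto
        then show ?thesis using False by (simp add: N)
      qed (use m nz in \<open>simp add: N\<close>)
    qed simp
    then show "poly R z = poly H z" using m by simp
  qed (use l H degR in \<open>auto simp: card_image\<close>)
  have "poly R y = poly H y" by (simp only: \<open>R = H\<close>)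
  then show "(\<Sum>j<k. poly H (l j) / (\<Prod>i\<in>{..<k} - {j}. l j - l i) * (\<Prod>i\<in>{..<k} - {j}. y - l i)) = poly H y"
    by (simp add: R_def poly_sum N[symmetric])
  have "coeff R (k - 1) = (\<Sum>j<k. poly H (l j) / (\<Prod>i\<in>{..<k} - {j}. l j - l i))"
    unfolding R_def coeff_sum by (rule sum.cong) (use degN in force)+
  then show "(\<Sum>j<k. poly H (l j) / (\<Prod>i\<in>{..<k} - {j}. l j - l i)) = coeff H (k - 1)"
    using \<open>R = H\<close> by simp
qed

section \<open>Brackets in terms of the roots\<close>

text \<open>The algebra of brackets in terms of the roots \<open>l\<^sub>j\<close> of \<open>q = toda_poly v k\<close>. Here \<open>G\<close> is the differential
  of \<open>q\<close>, and \<open>L j\<close>, \<open>\<Theta> j\<close>, \<open>dg m j\<close>, \<open>Y m\<close> are those of \<open>l\<^sub>j\<close>, \<open>\<theta>\<^sub>j = ln p(l\<^sub>j)\<close>, \<open>g m j\<close> and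
  \<open>y\<^sub>m = 1/2 \<Sum>\<^sub>j g m j \<theta>\<^sub>j\<close>, where \<open>p = toda_poly v n\<close> and \<open>g m j = l\<^sub>j\<^sup>m / q'(l\<^sub>j)\<close>.\<close>

locale toda_roots =
  fixes c :: "'n::finite \<Rightarrow> nat" and k n :: nat and x :: "complex^'n" and \<alpha> \<beta> :: complex
    and l \<theta> :: "nat \<Rightarrow> complex"
  assumes c: "bij_betw c UNIV {..<2 * k - 1}" and kn: "k = Suc n"
    and odd_nz: "\<And>m. m < n \<Longrightarrow> x $ inv c (2 * m + 1) \<noteq> 0"
    and inj: "inj_on l {..<k}"
    and q: "toda_poly (\<lambda>m. x $ inv c m) k = (\<Prod>j<k. [:- l j, 1:])"
begin

abbreviation "v \<equiv> (\<lambda>m. x $ inv c m)"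
abbreviation "w \<equiv> om (toda_pencil c \<alpha> \<beta> x)"
abbreviation "G \<equiv> toda_grad (\<lambda>m. axis (inv c m) 1) v"
abbreviation "p \<equiv> poly (toda_poly v n)"
abbreviation "p' \<equiv> poly (pderiv (toda_poly v n))"
abbreviation "\<l> j y \<equiv> (\<Prod>i\<in>{..<k} - {j}. y - l i)"
definition "g m j = l j ^ m / \<l> j (l j)"
definition "L j = (- 1 / \<l> j (l j)) *s G k (l j)"
definition "\<Theta> j = (1 / p (l j)) *s (G n (l j) + p' (l j) *s L j)"
text \<open>The two halves of the product rule for twice y_m: \<open>T\<close> collects the
  differentials of the logarithms, \<open>\<Lambda>\<close> those of the weights.\<close>

definition "T m = (\<Sum>j<k. g m j *s \<Theta> j)"
definition "dg m j = (of_nat m * l j ^ (m - 1) / \<l> j (l j)) *s L j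
   - g m j *s (\<Sum>i\<in>{..<k} - {j}. (1 / (l j - l i)) *s (L j - L i))"
definition "\<Lambda> m = (\<Sum>j<k. \<theta> j *s dg m j)"
definition "Y m = (1 / 2) *s (T m + \<Lambda> m)"

lemma w_skew: "w a b = - w b a"
  by (rule om_skew) (rule toda_pencil_skew)

lemma root: "j < k \<Longrightarrow> poly (toda_poly v k) (l j) = 0"
  by (auto simp: q poly_prod)

lemma p_nz: "j < k \<Longrightarrow> p (l j) \<noteq> 0"
  using toda_poly_coprime[of n v "l j"] odd_nz root[of j] kn by simp

lemma \<l>_other: "i < k \<Longrightarrow> i \<noteq> j \<Longrightarrow> \<l> j (l i) = 0"
  by (rule prod_zero) auto

lemma q_split: "j < k \<Longrightarrow> toda_poly v k = [:- l j, 1:] * (\<Prod>i\<in>{..<k} - {j}. [:- l i, 1:])"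
  unfolding q by (rule prod.remove) auto

text \<open>At a root of q one Christoffel--Darboux term drops out, and dividing q by the linear
  factor leaves the product over the other roots. Coinciding arguments need the confluent
  form.\<close>

lemma kernel_root: "j < k \<Longrightarrow> toda_kernel v k y (l j) = p (l j) * \<l> j y"
proof (cases "y = l j")
  case False
  assume j: "j < k"
  have "(y - l j) * toda_kernel v k y (l j) = poly (toda_poly v k) y * p (l j)"
    using toda_kernel_diff[of y "l j" v n] root[OF j] kn by simp
  also have "\<dots> = (y - l j) * (p (l j) * \<l> j y)"
    by (subst q_split[OF j]) (simp add: poly_prod algebra_simps)
  finally show ?thesis using False by simp
next
  case True
  assume j: "j < k"
  have "toda_kernel v k y (l j) = poly (pderiv (toda_poly v k)) (l j) * p (l j)"
    using toda_kernel_diag[of v n "l j"] root[OF j] kn True by simp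
  also have "poly (pderiv (toda_poly v k)) (l j) = \<l> j (l j)"
    by (subst q_split[OF j], unfold pderiv_mult) (simp add: pderiv_pCons poly_prod)
  finally show ?thesis using True by (simp add: mult.commute)
qed

lemma w_G_G: "w (G k y) (G k z) = 0"
  by (rule toda_brackets(1)[OF c kn])

lemma w_G_Gn: "j < k \<Longrightarrow> w (G k y) (G n (l j)) = 2 * (\<alpha> + \<beta> * y) * p (l j) * (\<l> j y - p y)"
  using toda_brackets(3)[OF c kn, where y = y and z = "l j" and \<alpha> = \<alpha> and \<beta> = \<beta> and x = x] kernel_root
  by (simp add: algebra_simps)

lemma w_G_L: "w (G k y) (L j) = 0"
  by (simp add: L_def w_G_G)

lemma w_L_L: "w (L i) (L j) = 0"
  by (simp add: L_def[of i] w_G_L)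

lemma w_G_\<Theta>: "j < k \<Longrightarrow> w (G k y) (\<Theta> j) = 2 * (\<alpha> + \<beta> * y) * (\<l> j y - p y)"
  using p_nz by (simp add: \<Theta>_def w_G_L w_G_Gn)

text \<open>The result is a difference of a term in \<open>i\<close> alone and a term in
  \<open>j\<close> alone. Such a form vanishes when summed against weights of total zero.\<close>

lemma w_\<Theta>_\<Theta>:
  assumes "i < k" "j < k"
  defines "X \<equiv> \<lambda>a. 2 * (\<alpha> + \<beta> * l a) / \<l> a (l a)"
  shows "w (\<Theta> i) (\<Theta> j) = p' (l i) * X i - p' (l j) * X j"
proof (cases "i = j")
  case True
  then show ?thesis using w_skew[of "\<Theta> i" "\<Theta> i"] by simp
next
  case False
  have 1: "w (L a) (G n (l b)) = p (l a) * p (l b) * X a"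
    if "a < k" "b < k" "a \<noteq> b" for a b
  proof -
    have z: "\<l> b (l a) = 0" using that by (intro \<l>_other) auto
    show ?thesis
      unfolding L_def om_scale_left w_G_Gn[OF that(2)] z X_def by simp
  qed
  have "w (\<Theta> i) (\<Theta> j) = (1 / p (l i)) * (1 / p (l j)) *
      (p' (l j) * w (G n (l i)) (L j) + p' (l i) * w (L i) (G n (l j)))"
    by (simp add: \<Theta>_def w_L_L toda_brackets(2)[OF c kn] algebra_simps add_divide_distrib)
  also have "w (G n (l i)) (L j) = - w (L j) (G n (l i))"
    by (rule w_skew)
  also have "w (L j) (G n (l i)) = p (l j) * p (l i) * X j"
    using assms False by (intro 1) auto
  also have "w (L i) (G n (l j)) = p (l i) * p (l j) * X i"
    using assms False by (intro 1) auto
  also have "(1 / p (l i)) * (1 / p (l j)) * (p' (l j) * - (p (l j) * p (l i) * X j) + p' (l i) * (p (l i) * p (l j) * X i))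
      = p' (l i) * X i - p' (l j) * X j"
    using p_nz[OF assms(1)] p_nz[OF assms(2)] by (simp add: divide_simps) (simp add: algebra_simps)
  finally show ?thesis .
qed

lemma sum_g_l:
  assumes "m < k"
  shows "(\<Sum>j<k. g m j * \<l> j y) = y ^ m"
  using lagrange_interpolation(1)[OF inj, of "monom 1 m" y] assms
  by (simp add: g_def degree_monom_eq poly_monom)

text \<open>The monomial has degree below \<open>k - 1\<close>, so its coefficient there is zero.
  This bound is what limits m to at most k - 2.\<close>

lemma sum_g:
  assumes "m + 1 < k"
  shows "(\<Sum>j<k. g m j) = 0"
  using lagrange_interpolation(2)[OF inj, of "monom 1 m"] assms
  by (simp add: g_def degree_monom_eq poly_monom)

lemma w_G_T:
  assumes "m + 1 < k"
  shows "w (G k y) (T m) = 2 * (\<alpha> + \<beta> * y) * y ^ m"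
proof -
  have "w (G k y) (T m) = (\<Sum>j<k. 2 * (\<alpha> + \<beta> * y) * (g m j * \<l> j y) - 2 * (\<alpha> + \<beta> * y) * p y * g m j)"
    unfolding T_def om_sum_right by (rule sum.cong) (simp_all add: w_G_\<Theta> algebra_simps)
  then show ?thesis
    using sum_g_l[of m y] sum_g[OF assms] assms by (simp add: sum_subtractf sum_distrib_left[symmetric])
qed

lemma w_T_L:
  assumes "m + 1 < k" "i < k"
  shows "w (T m) (L i) = 2 * (\<alpha> + \<beta> * l i) * g m i"
  using w_skew[of "T m" "L i"] w_G_T[OF assms(1), of "l i"] by (simp add: L_def g_def)

lemma w_T_T:
  assumes "m + 1 < k" "r + 1 < k"
  shows "w (T m) (T r) = 0"
proof -
  define f where "f i = p' (l i) * (2 * (\<alpha> + \<beta> * l i) / \<l> i (l i))" for i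
  have "w (T m) (T r) = (\<Sum>i<k. \<Sum>j<k. g m i * f i * g r j - g m i * (g r j * f j))"
    unfolding T_def om_sum_right om_sum_left sum_distrib_left
    by (subst sum.swap) (auto intro!: sum.cong simp: w_\<Theta>_\<Theta> f_def algebra_simps)
  also have "\<dots> = (\<Sum>i<k. g m i * f i) * (\<Sum>j<k. g r j) - (\<Sum>i<k. g m i) * (\<Sum>j<k. g r j * f j)"
    by (simp add: sum_subtractf sum_product)
  finally show ?thesis using sum_g assms by simp
qed

lemma w_L_dg: "w (L i) (dg m j) = 0"
  by (simp add: dg_def om_sum_right w_L_L)

lemma w_G_dg: "w (G k y) (dg m j) = 0"
  by (simp add: dg_def om_sum_right w_G_L)

lemma w_G_\<Lambda>: "w (G k y) (\<Lambda> m) = 0"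
  by (simp add: \<Lambda>_def om_sum_right w_G_dg)

lemma w_\<Lambda>_\<Lambda>: "w (\<Lambda> m) (\<Lambda> r) = 0"
  by (simp add: \<Lambda>_def dg_def[of m] om_sum_right om_sum_left w_L_dg)

lemma w_T_dg:
  assumes "m + 1 < k" "j < k"
  shows "w (T m) (dg r j) = 2 * of_nat r * l j ^ (r - 1) / \<l> j (l j) * ((\<alpha> + \<beta> * l j) * g m j)
     - 2 * g r j * (\<Sum>i\<in>{..<k} - {j}. ((\<alpha> + \<beta> * l j) * g m j - (\<alpha> + \<beta> * l i) * g m i) / (l j - l i))"
proof -
  define u where "u i = (\<alpha> + \<beta> * l i) * g m i" for i
  have u: "w (T m) (L i) = 2 * u i" if "i < k" for i
    using w_T_L[OF assms(1) that] by (simp add: u_def)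
  have "(\<Sum>i\<in>{..<k} - {j}. (1 / (l j - l i)) * (w (T m) (L j) - w (T m) (L i)))
      = 2 * (\<Sum>i\<in>{..<k} - {j}. (u j - u i) / (l j - l i))"
    unfolding sum_distrib_left
    by (rule sum.cong) (use assms in \<open>simp_all add: u diff_divide_distrib right_diff_distrib\<close>)
  moreover have "w (T m) (dg r j) = of_nat r * l j ^ (r - 1) / \<l> j (l j) * w (T m) (L j)
     - g r j * (\<Sum>i\<in>{..<k} - {j}. (1 / (l j - l i)) * (w (T m) (L j) - w (T m) (L i)))"
    by (simp only: dg_def om_sum_right om_diff_right om_scale_right)
  ultimately show ?thesis
    using assms unfolding u[OF assms(2)] u_def[symmetric] by (simp add: algebra_simps)
qed

text \<open>Up to the factor 2 / q'(l_j), the difference of the two sides is the sum over all roots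
  of H(l_i) / q'(l_i), where H(z) = (\<alpha> + \<beta> z) (l_j^r z^m - l_j^m z^r) / (l_j - z). This
  is a polynomial of degree at most r <= k - 2, so the sum is zero.\<close>

lemma w_T_dg_symmetric:
  assumes m: "r + 1 < k" "m < r" and j: "j < k"
  shows "w (T m) (dg r j) = w (T r) (dg m j)"
proof -
  define d where "d = r - m"
  have r: "r = m + d" "0 < d" using m by (auto simp: d_def)
  \<comment> \<open>The quotient is written as a geometric sum, which makes it a polynomial and
    defines it at \<open>l j\<close> too.\<close>
  define H where "H = smult (l j ^ m) ([:\<alpha>, \<beta>:] * (monom 1 m * (\<Sum>s<d. monom (l j ^ (d - Suc s)) s)))"
  define b where "b i = \<alpha> + \<beta> * l i" for i
  have "degree (\<Sum>s<d. monom (l j ^ (d - Suc s)) s) \<le> d - 1"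
    by (rule degree_sum_le) (auto intro: order_trans[OF degree_monom_le])
  then have "degree (monom 1 m * (\<Sum>s<d. monom (l j ^ (d - Suc s)) s)) \<le> m + (d - 1)"
    using degree_mult_le[of "monom 1 m" "\<Sum>s<d. monom (l j ^ (d - Suc s)) s"]
      degree_monom_le[of "1 :: complex" m] by linarith
  moreover have "degree [:\<alpha>, \<beta>:] \<le> 1" by simp
  ultimately have "degree ([:\<alpha>, \<beta>:] * (monom 1 m * (\<Sum>s<d. monom (l j ^ (d - Suc s)) s))) \<le> 1 + (m + (d - 1))"
    using degree_mult_le[of "[:\<alpha>, \<beta>:]" "monom 1 m * (\<Sum>s<d. monom (l j ^ (d - Suc s)) s)"] by linarith
  then have degH: "degree H < k - 1"
    unfolding H_def using r m(1) by (intro le_less_trans[OF degree_smult_le]) simp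
  have H: "poly H z = (\<alpha> + \<beta> * z) * (l j ^ m * z ^ m) * (\<Sum>s<d. l j ^ (d - Suc s) * z ^ s)" for z
    by (simp add: H_def poly_sum poly_monom algebra_simps)
  have Hi: "poly H (l i) = b i * (l j ^ r * l i ^ m - l j ^ m * l i ^ r) / (l j - l i)"
    if "i \<in> {..<k} - {j}" for i
  proof -
    have ne: "l j - l i \<noteq> 0" using that inj j by (auto simp: inj_on_def)
    have "(l j - l i) * (\<Sum>s<d. l j ^ (d - Suc s) * l i ^ s) = l j ^ d - l i ^ d"
      using power_diff_sumr2[of "l i" d "l j"] by (simp add: algebra_simps)
    then have "(\<Sum>s<d. l j ^ (d - Suc s) * l i ^ s) = (l j ^ d - l i ^ d) / (l j - l i)"
      using ne by (simp add: field_simps)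
    then show ?thesis
      unfolding H b_def[symmetric] r(1) power_add by (simp add: algebra_simps)
  qed
  \<comment> \<open>At the coinciding node the difference quotient becomes a derivative; it matches
    the terms in which \<open>dg\<close> differentiates the power of the root.\<close>
  have Hj: "poly H (l j) = b j * (of_nat r * l j ^ (r - 1) * l j ^ m - of_nat m * l j ^ (m - 1) * l j ^ r)"
  proof -
    obtain d' where d': "d = Suc d'" using r(2) gr0_implies_Suc by blast
    have "(\<Sum>s<d. l j ^ (d - Suc s) * l j ^ s) = (\<Sum>s<d. l j ^ d')"
      by (rule sum.cong) (auto simp: power_add[symmetric] d')
    then have 1: "poly H (l j) = b j * (of_nat d * (l j ^ m * l j ^ m * l j ^ d'))"
      by (simp add: H b_def)
    have 2: "of_nat r * l j ^ (r - 1) * l j ^ m = of_nat r * (l j ^ m * l j ^ m * l j ^ d')"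
      by (simp add: r(1) d' power_add)
    have 3: "of_nat m * l j ^ (m - 1) * l j ^ r = of_nat m * (l j ^ m * l j ^ m * l j ^ d')"
      by (cases m) (simp_all add: r(1) d' power_add)
    have "of_nat r = of_nat m + (of_nat d :: complex)" by (simp add: r(1))
    then show ?thesis unfolding 1 2 3 by (simp add: algebra_simps)
  qed
  have "0 = coeff H (k - 1)" using degH by (simp add: coeff_eq_0)
  also have "\<dots> = (\<Sum>i<k. poly H (l i) / \<l> i (l i))"
    by (rule lagrange_interpolation(2)[symmetric, OF inj]) (use degH in simp)
  also have "\<dots> = poly H (l j) / \<l> j (l j) + (\<Sum>i\<in>{..<k} - {j}. poly H (l i) / \<l> i (l i))"
    by (rule sum.remove) (use j in auto)
  also have "(\<Sum>i\<in>{..<k} - {j}. poly H (l i) / \<l> i (l i))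
     = (\<Sum>i\<in>{..<k} - {j}. b i * (l j ^ r * g m i - l j ^ m * g r i) / (l j - l i))"
    by (rule sum.cong) (simp_all add: Hi g_def diff_divide_distrib algebra_simps)
  finally have z: "poly H (l j) / \<l> j (l j) = - (\<Sum>i\<in>{..<k} - {j}. b i * (l j ^ r * g m i - l j ^ m * g r i) / (l j - l i))"
    by (simp add: eq_neg_iff_add_eq_0)
  define E where "E = 1 / \<l> j (l j)"
  have gj: "g a j = l j ^ a * E" for a by (simp add: g_def E_def)
  define S where "S a = (\<Sum>i\<in>{..<k} - {j}. (b j * g a j - b i * g a i) / (l j - l i))" for a
  have wd: "w (T a) (dg a' j) = 2 * (of_nat a' * l j ^ (a' - 1) * E * b j * g a j - g a' j * S a)" if "a + 1 < k" for a a'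
    using w_T_dg[OF that j, of a'] unfolding b_def[symmetric] S_def[symmetric] E_def by simp
  have "g m j * S r - g r j * S m
     = (\<Sum>i\<in>{..<k} - {j}. g m j * ((b j * g r j - b i * g r i) / (l j - l i))
           - g r j * ((b j * g m j - b i * g m i) / (l j - l i)))"
    by (simp only: S_def sum_distrib_left sum_subtractf)
  also have "\<dots> = E * (\<Sum>i\<in>{..<k} - {j}. b i * (l j ^ r * g m i - l j ^ m * g r i) / (l j - l i))"
    unfolding sum_distrib_left
    by (rule sum.cong) (simp_all add: gj diff_divide_distrib add_divide_distrib algebra_simps)
  also have "\<dots> = - E * (E * poly H (l j))"
    using z by (simp add: E_def)
  finally have SS: "g m j * S r - g r j * S m = - E * (E * poly H (l j))" .
  have "w (T m) (dg r j) - w (T r) (dg m j)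
     = 2 * (E * b j * (of_nat r * l j ^ (r - 1) * g m j - of_nat m * l j ^ (m - 1) * g r j)
      + (g m j * S r - g r j * S m))"
    using m j by (simp add: wd algebra_simps)
  also have "\<dots> = 0"
    unfolding SS unfolding Hj gj by (simp add: algebra_simps)
  finally show ?thesis by simp
qed

lemma w_G_Y: "m + 1 < k \<Longrightarrow> w (G k y) (Y m) = (\<alpha> + \<beta> * y) * y ^ m"
  by (simp add: Y_def w_G_T w_G_\<Lambda>)

text \<open>The pure parts vanish, so the mixed parts must cancel. The values
  \<open>\<theta> j\<close> are free here, which is why the cancellation is established separately
  for each \<open>j\<close>.\<close>

lemma w_Y_Y:
  assumes "m + 1 < k" "r + 1 < k"
  shows "w (Y m) (Y r) = 0"
proof -
  have *: "w (Y m) (Y r) = 0" if "m < r" "r + 1 < k" for m r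
  proof -
    have "w (T m) (\<Lambda> r) = w (T r) (\<Lambda> m)"
      unfolding \<Lambda>_def om_sum_right om_scale_right
      by (rule sum.cong) (use that w_T_dg_symmetric in auto)
    moreover have "w (\<Lambda> m) (T r) = - w (T r) (\<Lambda> m)" by (rule w_skew)
    ultimately show ?thesis
      using that by (simp add: Y_def w_T_T w_\<Lambda>_\<Lambda>)
  qed
  consider "m < r" | "m = r" | "r < m" by linarith
  then show ?thesis
    using * assms w_skew[of "Y m" "Y r"] w_skew[of "Y m" "Y m"] by cases auto
qed

end

section \<open>Flat coordinates of the Toda lattice\<close>

text \<open>At a zero of \<open>f\<close> the product rule needs only continuity of the other
  factor. This permits differentiating a root through a quotient that contains the other roots,
  known so far only to be continuous.\<close>

lemma has_grad_mult_vanishing: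
  assumes f: "has_grad f F x" "f x = 0" and g: "isCont g x"
  shows "has_grad (\<lambda>y. f y * g y) (g x *s F) x"
proof -
  let ?D = "\<lambda>h. \<Sum>i\<in>UNIV. F $ i * h $ i"
  have der: "(f has_derivative ?D) (at x)" using f(1) by (simp add: has_grad_def)
  have bl: "bounded_linear ?D" using der has_derivative_bounded_linear by blast
  obtain K where K: "\<And>h. cmod (?D h) \<le> norm h * K"
    using bounded_linear.bounded[OF bl] by blast
  have l1: "((\<lambda>y. cmod (f y - ?D (y - x)) / norm (y - x)) \<longlongrightarrow> 0) (at x)"
    using der f(2) unfolding has_derivative_iff_norm by simp
  have lg: "(g \<longlongrightarrow> g x) (at x)" using g by (simp add: isCont_def)
  have l2: "((\<lambda>y. cmod (f y - ?D (y - x)) / norm (y - x) * cmod (g y) + K * cmod (g y - g x)) \<longlongrightarrow> 0 * cmod (g x) + K * 0) (at x)"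
    by (intro tendsto_intros l1 lg) (use lg LIM_zero_iff tendsto_norm_zero in blast)
  have "((\<lambda>y. cmod (f y * g y - f x * g x - g x * ?D (y - x)) / norm (y - x)) \<longlongrightarrow> 0) (at x)"
  proof (rule Lim_null_comparison)
    show "\<forall>\<^sub>F y in at x. norm (cmod (f y * g y - f x * g x - g x * ?D (y - x)) / norm (y - x))
        \<le> cmod (f y - ?D (y - x)) / norm (y - x) * cmod (g y) + K * cmod (g y - g x)"
      unfolding eventually_at
    proof (intro exI[of _ 1] conjI ballI impI)
      fix y assume "y \<in> UNIV" "y \<noteq> x \<and> dist y x < 1"
      then have pos: "norm (y - x) > 0" by simp
      have eq: "f y * g y - f x * g x - g x * ?D (y - x) = (f y - ?D (y - x)) * g y + ?D (y - x) * (g y - g x)"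
        using f(2) by (simp add: algebra_simps)
      have "cmod (f y * g y - f x * g x - g x * ?D (y - x))
          \<le> cmod (f y - ?D (y - x)) * cmod (g y) + (norm (y - x) * K) * cmod (g y - g x)"
        unfolding eq using norm_triangle_ineq[of "(f y - ?D (y - x)) * g y" "?D (y - x) * (g y - g x)"]
          mult_right_mono[OF K[of "y - x"] norm_ge_zero, of "g y - g x"]
        unfolding norm_mult by linarith
      then have "cmod (f y * g y - f x * g x - g x * ?D (y - x)) / norm (y - x)
          \<le> (cmod (f y - ?D (y - x)) * cmod (g y) + (norm (y - x) * K) * cmod (g y - g x)) / norm (y - x)"
        using pos by (intro divide_right_mono) auto
      also have "\<dots> = cmod (f y - ?D (y - x)) / norm (y - x) * cmod (g y) + K * cmod (g y - g x)"
        using pos by (simp add: field_simps)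
      finally show "norm (cmod (f y * g y - f x * g x - g x * ?D (y - x)) / norm (y - x))
        \<le> cmod (f y - ?D (y - x)) / norm (y - x) * cmod (g y) + K * cmod (g y - g x)" by simp
    qed simp
    show "((\<lambda>y. cmod (f y - ?D (y - x)) / norm (y - x) * cmod (g y) + K * cmod (g y - g x)) \<longlongrightarrow> 0) (at x)"
      using l2 by simp
  qed
  moreover have "bounded_linear (\<lambda>h. g x * ?D h)"
    by (rule bounded_linear_mult_right[THEN bounded_linear_compose, OF bl])
  ultimately have "((\<lambda>y. f y * g y) has_derivative (\<lambda>h. g x * ?D h)) (at x)"
    unfolding has_derivative_iff_norm by simp
  then show ?thesis
    unfolding has_grad_def by (simp add: sum_distrib_left mult.assoc)
qed

lemma has_grad_prod_inverse:
  assumes "finite A" "\<And>i. i \<in> A \<Longrightarrow> has_grad (u i) (U i) x" "\<And>i. i \<in> A \<Longrightarrow> u i x \<noteq> 0"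
  shows "has_grad (\<lambda>y. \<Prod>i\<in>A. inverse (u i y)) (- (\<Prod>i\<in>A. inverse (u i x)) *s (\<Sum>i\<in>A. (1 / u i x) *s U i)) x"
  using assms
proof (induction A)
  case (insert a A)
  have "has_grad (\<lambda>y. inverse (u a y)) (- (inverse (u a x) * inverse (u a x)) *s U a) x"
    by (rule has_grad_compose_field[of "u a"]) (use insert.prems in \<open>auto intro!: derivative_eq_intros simp: power2_eq_square\<close>)
  from has_grad_mult[OF this insert.IH] insert.prems
  have 1: "has_grad (\<lambda>y. inverse (u a y) * (\<Prod>i\<in>A. inverse (u i y)))
     (inverse (u a x) *s (- (\<Prod>i\<in>A. inverse (u i x)) *s (\<Sum>i\<in>A. (1 / u i x) *s U i))
      + (\<Prod>i\<in>A. inverse (u i x)) *s (- (inverse (u a x) * inverse (u a x)) *s U a)) x" by simp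
  have 2: "inverse (u a x) *s (- (\<Prod>i\<in>A. inverse (u i x)) *s (\<Sum>i\<in>A. (1 / u i x) *s U i))
      + (\<Prod>i\<in>A. inverse (u i x)) *s (- (inverse (u a x) * inverse (u a x)) *s U a)
    = - (\<Prod>i\<in>insert a A. inverse (u i x)) *s (\<Sum>i\<in>insert a A. (1 / u i x) *s U i)"
    using insert.hyps by (simp add: vec_eq_iff inverse_eq_divide algebra_simps)
  have 3: "(\<lambda>y. \<Prod>i\<in>insert a A. inverse (u i y)) = (\<lambda>y. inverse (u a y) * (\<Prod>i\<in>A. inverse (u i y)))"
    using insert.hyps by simp
  show ?case using 1 unfolding 2 3 .
qed simp

lemma has_grad_coeff_toda_poly:
  "\<exists>A. has_grad (\<lambda>x. coeff (toda_poly (\<lambda>m. x $ \<sigma> m) n) a) A x"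
proof (induction n arbitrary: a rule: induct_nat_012)
  case 0
  show ?case by (auto simp: coeff_pCons intro!: exI[of _ 0])
next
  case 1
  show ?case
  proof (cases "a = 0")
    case True
    then show ?thesis using has_grad_uminus[OF has_grad_nth[of "\<sigma> 0"]] by auto
  next
    case False
    then show ?thesis by (cases a) (auto simp: coeff_pCons intro!: exI[of _ 0] split: nat.split)
  qed
next
  case (ge2 n)
  have "\<exists>C. has_grad (\<lambda>x. if a = 0 then 0 else coeff (toda_poly (\<lambda>m. x $ \<sigma> m) (Suc n)) (a - 1)) C x"
    using ge2(2)[of "a - 1"] by (cases "a = 0") (auto intro!: exI[of _ 0])
  then obtain A B C where A: "has_grad (\<lambda>x. coeff (toda_poly (\<lambda>m. x $ \<sigma> m) (Suc n)) a) A x"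
    and B: "has_grad (\<lambda>x. coeff (toda_poly (\<lambda>m. x $ \<sigma> m) n) a) B x"
    and C: "has_grad (\<lambda>x. if a = 0 then 0 else coeff (toda_poly (\<lambda>m. x $ \<sigma> m) (Suc n)) (a - 1)) C x"
    using ge2(1)[of a] ge2(2)[of a] by blast
  have "(\<lambda>x. coeff (toda_poly (\<lambda>m. x $ \<sigma> m) (Suc (Suc n))) a)
    = (\<lambda>x. (if a = 0 then 0 else coeff (toda_poly (\<lambda>m. x $ \<sigma> m) (Suc n)) (a - 1))
        - x $ \<sigma> (2 * n + 2) * coeff (toda_poly (\<lambda>m. x $ \<sigma> m) (Suc n)) a
        - (x $ \<sigma> (2 * n + 1))\<^sup>2 * coeff (toda_poly (\<lambda>m. x $ \<sigma> m) n) a)"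
    by (rule ext) (cases a; simp add: coeff_pCons)
  then show ?case
    using has_grad_diff[OF has_grad_diff[OF C has_grad_mult[OF has_grad_nth A]]
        has_grad_mult[OF has_grad_power[OF has_grad_nth] B]] by (simp only:) blast
qed

lemma bilinear_poly_zero:
  fixes b :: "nat \<Rightarrow> nat \<Rightarrow> complex"
  assumes "\<And>y z. (\<Sum>i<k. \<Sum>j<k. y ^ i * z ^ j * b i j) = 0" "i < k" "j < k"
  shows "b i j = 0"
proof -
  have k: "{..<k} = {..k - 1}" using assms(2) by auto
  have "(\<Sum>j\<le>k - 1. b i j * z ^ j) = 0" if "i \<le> k - 1" for i z
  proof -
    have "(\<Sum>i\<le>k - 1. (\<Sum>j\<le>k - 1. b i j * z ^ j) * y ^ i) = 0" for y
      using assms(1)[of y z] unfolding k by (simp add: sum_distrib_right sum_distrib_left ac_simps)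
    then show ?thesis using polyfun_eq_0[of "\<lambda>i. \<Sum>j\<le>k - 1. b i j * z ^ j" "k - 1"] that by blast
  qed
  then show ?thesis using polyfun_eq_0[of "b i" "k - 1"] assms(2,3) by auto
qed

lemma linear_poly_coeffs:
  fixes b :: "nat \<Rightarrow> complex"
  assumes "\<And>y. (\<Sum>i<k. y ^ i * b i) = (\<alpha> + \<beta> * y) * y ^ m" "m + 1 < k" "i < k"
  shows "b i = (if i = m then \<alpha> else 0) + (if i = m + 1 then \<beta> else 0)"
proof -
  have k: "{..<k} = {..k - 1}" using assms(2) by auto
  have "(\<Sum>i\<le>k - 1. b i * y ^ i) = (\<Sum>i\<le>k - 1. ((if i = m then \<alpha> else 0) + (if i = m + 1 then \<beta> else 0)) * y ^ i)" for y
  proof -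
    have "(\<Sum>i\<le>k - 1. ((if i = m then \<alpha> else 0) + (if i = m + 1 then \<beta> else 0)) * y ^ i)
       = (\<Sum>i\<le>k - 1. if i = m then \<alpha> * y ^ i else 0) + (\<Sum>i\<le>k - 1. if i = m + 1 then \<beta> * y ^ i else 0)"
      unfolding sum.distrib[symmetric] by (rule sum.cong) auto
    also have "\<dots> = (\<alpha> + \<beta> * y) * y ^ m"
      using assms(2) by (simp add: algebra_simps)
    finally show ?thesis using assms(1)[of y] unfolding k by (simp add: mult.commute)
  qed
  then show ?thesis
    using polyfun_eq_coeffs[of b "k - 1" "\<lambda>i. (if i = m then \<alpha> else 0) + (if i = m + 1 then \<beta> else 0)"] assms(3)
    by auto
qed

text \<open>Quantifying over both parameters makes one chart serve the Jacobi identity of the whole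
  pencil and the local isomorphism for both brackets.\<close>

definition toda_chart :: "('n::finite \<Rightarrow> nat) \<Rightarrow> nat \<Rightarrow> (complex^'n) set \<Rightarrow> ('n \<Rightarrow> complex^'n \<Rightarrow> complex) \<Rightarrow> bool" where
  "toda_chart c k W F \<longleftrightarrow> open W \<and> (\<forall>i. holo W (F i)) \<and>
     (\<forall>x\<in>W. invertible (\<chi> i. grad (F i) x) \<and>
       (\<forall>\<alpha> \<beta> i j. bracket UNIV (toda_pencil c \<alpha> \<beta>) (F i) (F j) x = \<alpha> * kron1 k (c i) (c j) + \<beta> * kron2 k (c i) (c j)))"

lemma toda_chart_exists:
  fixes c :: "'n::finite \<Rightarrow> nat" and x0 :: "complex^'n"
  assumes c: "bij_betw c UNIV {..<2 * k - 1}" and kn: "k = Suc n"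
    and odd0: "\<And>m. m < n \<Longrightarrow> x0 $ inv c (2 * m + 1) \<noteq> 0"
    and l0: "inj_on l0 {..<k}" "\<And>j. j < k \<Longrightarrow> poly (toda_poly (\<lambda>m. x0 $ inv c m) k) (l0 j) = 0"
  shows "\<exists>W F. x0 \<in> W \<and> toda_chart c k W F"
proof -
  define v where "v x = (\<lambda>m. x $ inv c m)" for x :: "complex^'n"
  define e where "e = (\<lambda>m. axis (inv c m) 1 :: complex^'n)"
  define G where "G x = toda_grad e (v x)" for x
  have gpoly: "has_grad (\<lambda>x. poly (toda_poly (v x) r) (f x))
     (G x r (f x) + poly (pderiv (toda_poly (v x) r)) (f x) *s F) x" if "has_grad f F x" for r f F x
    using has_grad_toda_poly[OF that, of "inv c" r] by (simp add: v_def e_def G_def)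
  have gpoly0: "has_grad (\<lambda>x. poly (toda_poly (v x) r) y) (G x r y) x" for r y x
    using gpoly[OF has_grad_const[of y]] by simp
  obtain W l where W: "open W" "x0 \<in> W" and lx0: "\<And>j. j < k \<Longrightarrow> l j x0 = l0 j"
    and lc: "\<And>j. j < k \<Longrightarrow> continuous_on W (l j)"
    and inj: "\<And>x. x \<in> W \<Longrightarrow> inj_on (\<lambda>j. l j x) {..<k}"
    and qx: "\<And>x. x \<in> W \<Longrightarrow> toda_poly (v x) k = (\<Prod>j<k. [:- l j x, 1:])"
  proof (rule monic_roots_continuous[of "\<lambda>x. toda_poly (v x) k" k l0 x0])
    show "degree (toda_poly (v x) k) = k" "lead_coeff (toda_poly (v x) k) = 1" for x
      by (rule conjunct1[OF toda_poly_degree] conjunct2[OF toda_poly_degree])+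
    show "continuous_on UNIV (\<lambda>x. poly (toda_poly (v x) k) z)" for z
      using has_grad_continuous[OF gpoly0] by (auto intro: continuous_at_imp_continuous_on)
  qed (use l0 in \<open>auto simp: v_def\<close>)
  have lcx: "isCont (l j) x" if "x \<in> W" "j < k" for x j
    using lc[OF that(2)] W(1) that(1) by (simp add: continuous_on_eq_continuous_at)
  define ll where "ll x j = (\<Prod>i\<in>{..<k} - {j}. l j x - l i x)" for x j
  have ll_nz: "ll x j \<noteq> 0" if "x \<in> W" "j < k" for x j
    using inj[OF that(1)] that(2) by (auto simp: ll_def inj_on_def)
  define L where "L x j = (- 1 / ll x j) *s G x k (l j x)" for x j
  have gl: "has_grad (l j) (L x j) x" if x: "x \<in> W" and j: "j < k" for x j
  proof -
    \<comment> \<open>With the argument frozen at \<open>l j x\<close>, only the factor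
      \<open>j\<close> of the characteristic polynomial vanishes at \<open>x\<close>. Dividing by
      the remaining factors \<open>R\<close> expresses \<open>l j y\<close> through a function known
      to be differentiable.\<close>
    define R where "R y = (\<Prod>i\<in>{..<k} - {j}. l j x - l i y)" for y
    have Rc: "isCont R x" unfolding R_def
      by (intro continuous_intros lcx x) auto
    have Rx: "R x = ll x j" by (simp add: R_def ll_def)
    have eq: "poly (toda_poly (v y) k) (l j x) = (l j x - l j y) * R y" if "y \<in> W" for y
    proof -
      have "poly (toda_poly (v y) k) (l j x) = (\<Prod>i<k. l j x - l i y)"
        by (simp add: qx[OF that] poly_prod)
      then show ?thesis using j by (simp add: R_def prod.remove[of "{..<k}" j])
    qed
    have "has_grad (\<lambda>y. poly (toda_poly (v y) k) (l j x) * (- inverse (R y))) ((- inverse (R x)) *s G x k (l j x)) x"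
    proof (rule has_grad_mult_vanishing[OF gpoly0])
      show "poly (toda_poly (v x) k) (l j x) = 0" using eq[OF x] by simp
      show "isCont (\<lambda>y. - inverse (R y)) x"
        by (intro continuous_intros Rc) (use ll_nz[OF x j] Rx in simp)
    qed
    from has_grad_add[OF this has_grad_const[of "l j x"]]
    have 1: "has_grad (\<lambda>y. poly (toda_poly (v y) k) (l j x) * (- inverse (R y)) + l j x) (L x j) x"
      by (simp add: Rx L_def inverse_eq_divide)
    obtain d where d: "0 < d" "\<And>y. dist x y < d \<Longrightarrow> R y \<noteq> 0"
      using continuous_at_avoid[of x R 0] Rc ll_nz[OF x j] Rx by auto
    show ?thesis
      by (rule has_grad_transform[OF 1, of "ball x d \<inter> W"])
        (use d W x in \<open>auto simp: eq field_simps\<close>)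
  qed
  define P where "P j x = poly (toda_poly (v x) n) (l j x)" for j x
  define dP where "dP x j = G x n (l j x) + poly (pderiv (toda_poly (v x) n)) (l j x) *s L x j" for x j
  have gP: "has_grad (P j) (dP x j) x" if "x \<in> W" "j < k" for x j
    unfolding P_def dP_def by (rule gpoly[OF gl[OF that]])
  have P0: "P j x0 \<noteq> 0" if "j < k" for j
    using toda_poly_coprime[of n "v x0" "l0 j"] l0(2)[OF that] odd0 kn lx0[OF that]
    by (simp add: P_def v_def)
  \<comment> \<open>The half-plane keeps the quotient in the domain of the principal logarithm.
    Dividing by the value at \<open>x0\<close> shifts each logarithm by a constant and leaves its
    differential unchanged.\<close>
  define Q where "Q j = W \<inter> P j -` {z. 0 < Re (z / P j x0)}" for j
  define W1 where "W1 = W \<inter> (\<Inter>m\<in>{..<n}. {x. x $ inv c (2 * m + 1) \<noteq> 0})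
     \<inter> (\<Inter>j\<in>{..<k}. Q j)"
  have x0W1: "x0 \<in> W1" using W(2) odd0 P0 by (auto simp: W1_def Q_def)
  have openW1: "open W1"
  proof -
    have "open {x :: complex^'n. x $ i \<noteq> 0}" for i
      by (intro open_Collect_neq continuous_intros)
    moreover have "open (Q j)" if "j < k" for j
      unfolding Q_def
    proof (rule continuous_open_preimage)
      show "continuous_on W (P j)"
        using has_grad_continuous[OF gP] that by (auto intro: continuous_at_imp_continuous_on)
      show "open {z. 0 < Re (z / P j x0)}"
        by (intro open_Collect_less continuous_intros) (use P0[OF that] in simp)
    qed (rule W)
    ultimately show ?thesis unfolding W1_def
      by (intro open_Int open_INT W ballI) auto
  qed
  have W1W: "x \<in> W" if "x \<in> W1" for x using that by (simp add: W1_def)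
  define \<theta> where "\<theta> j x = Ln (P j x / P j x0)" for j x
  have P_nz: "P j x / P j x0 \<notin> \<real>\<^sub>\<le>\<^sub>0" "P j x \<noteq> 0" if "x \<in> W1" "j < k" for x j
  proof -
    have "x \<in> Q j" using that by (simp add: W1_def)
    then have "0 < Re (P j x / P j x0)" by (simp add: Q_def)
    then show "P j x / P j x0 \<notin> \<real>\<^sub>\<le>\<^sub>0" "P j x \<noteq> 0" by (auto simp: complex_nonpos_Reals_iff)
  qed
  have g\<theta>: "has_grad (\<theta> j) ((1 / P j x) *s dP x j) x" if x: "x \<in> W1" and j: "j < k" for x j
  proof -
    have "has_grad (\<lambda>y. (1 / P j x0) * P j y) ((1 / P j x0) *s dP x j) x"
      by (rule has_grad_cmult[OF gP[OF W1W[OF x] j]])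
    from has_grad_compose_field[OF this has_field_derivative_Ln] P_nz[OF x j]
    have "has_grad (\<lambda>y. Ln ((1 / P j x0) * P j y)) (inverse ((1 / P j x0) * P j x) *s ((1 / P j x0) *s dP x j)) x"
      by simp
    then show ?thesis using P0[OF j] unfolding \<theta>_def by (simp add: field_simps)
  qed
  define g where "g m j x = l j x ^ m / ll x j" for m j x
  define dg where "dg m x j = (of_nat m * l j x ^ (m - 1) / ll x j) *s L x j
     - g m j x *s (\<Sum>i\<in>{..<k} - {j}. (1 / (l j x - l i x)) *s (L x j - L x i))" for m x j
  have gg: "has_grad (g m j) (dg m x j) x" if x: "x \<in> W1" and j: "j < k" for m x j
  proof -
    have ne: "l j x - l i x \<noteq> 0" if "i \<in> {..<k} - {j}" for i
      using inj[OF W1W[OF x]] that j by (auto simp: inj_on_def)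
    have 1: "has_grad (\<lambda>y. \<Prod>i\<in>{..<k} - {j}. inverse (l j y - l i y))
       (- (\<Prod>i\<in>{..<k} - {j}. inverse (l j x - l i x)) *s (\<Sum>i\<in>{..<k} - {j}. (1 / (l j x - l i x)) *s (L x j - L x i))) x"
      by (rule has_grad_prod_inverse) (use ne gl[OF W1W[OF x]] j in \<open>auto intro!: has_grad_diff\<close>)
    have 2: "(\<Prod>i\<in>{..<k} - {j}. inverse (l j y - l i y)) = 1 / ll y j" for y
      by (simp add: ll_def inverse_eq_divide prod_dividef)
    have 3: "g m j = (\<lambda>y. l j y ^ m * (\<Prod>i\<in>{..<k} - {j}. inverse (l j y - l i y)))"
      by (rule ext) (simp add: 2 g_def)
    show ?thesis
      using has_grad_mult[OF has_grad_power[OF gl[OF W1W[OF x] j], of m] 1]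
      unfolding 3[symmetric] unfolding 2 by (simp add: dg_def g_def vec_eq_iff algebra_simps)
  qed
  define Y where "Y m x = (1/2) * (\<Sum>j<k. g m j x * \<theta> j x)" for m x
  define dY where "dY m x = (1/2) *s ((\<Sum>j<k. g m j x *s ((1 / P j x) *s dP x j)) + (\<Sum>j<k. \<theta> j x *s dg m x j))" for m x
  have gY: "has_grad (Y m) (dY m x) x" if "x \<in> W1" for m x
    unfolding Y_def dY_def sum.distrib[symmetric]
    by (intro has_grad_cmult has_grad_sum has_grad_mult gg g\<theta> that) auto
  define a where "a i x = coeff (toda_poly (v x) k) i" for i x
  define da where "da i x = grad (a i) x" for i x
  have ga: "has_grad (a i) (da i x) x" for i x
    using has_grad_coeff_toda_poly[of "inv c" k i x] has_grad_grad unfolding da_def a_def v_def by metis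
  have G_da: "G x k y = (\<Sum>i<k. y ^ i *s da i x)" for x y
  proof -
    have "(\<lambda>x. poly (toda_poly (v x) k) y) = (\<lambda>x. \<Sum>i\<le>k. y ^ i * a i x)"
      using toda_poly_degree[of _ k] by (simp add: poly_altdef a_def mult.commute)
    then have "has_grad (\<lambda>x. poly (toda_poly (v x) k) y) (\<Sum>i\<le>k. y ^ i *s da i x) x"
      by (simp only:) (intro has_grad_sum has_grad_cmult ga)
    then have "G x k y = (\<Sum>i\<le>k. y ^ i *s da i x)"
      using gpoly0 has_grad_unique by blast
    \<comment> \<open>The polynomial is monic, so the top term has no differential and
      \<open>k\<close> coefficients remain.\<close>
    moreover have "a k = (\<lambda>x. 1)"
      unfolding a_def using toda_poly_degree[of _ k] by metis
    then have "da k x = 0" using has_grad_unique[OF ga[of k x]] by simp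
    ultimately show ?thesis by (simp add: lessThan_Suc_atMost[symmetric])
  qed
  define F where "F i = (if c i < k then a (c i) else Y (c i - k))" for i
  define dF where "dF i x = (if c i < k then da (c i) x else dY (c i - k) x)" for i x
  have gF: "has_grad (F i) (dF i x) x" if "x \<in> W1" for i x
    using ga gY[OF that] by (simp add: F_def dF_def)
  have br: "om (toda_pencil c \<alpha> \<beta> x) (dF i x) (dF j x) = \<alpha> * kron1 k (c i) (c j) + \<beta> * kron2 k (c i) (c j)"
    if x: "x \<in> W1" for x \<alpha> \<beta> i j
  proof -
    interpret R: toda_roots c k n x \<alpha> \<beta> "\<lambda>j. l j x" "\<lambda>j. \<theta> j x"
      by unfold_locales (use c kn inj[OF W1W[OF x]] qx[OF W1W[OF x]] x in \<open>auto simp: W1_def v_def\<close>)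
    let ?w = "om (toda_pencil c \<alpha> \<beta> x)"
    have RG: "R.G r y = G x r y" for r y by (simp add: G_def e_def v_def)
    have RL: "R.L j = L x j" for j by (simp add: R.L_def L_def ll_def RG)
    have R\<Theta>: "R.\<Theta> j = (1 / P j x) *s dP x j" for j
      by (simp add: R.\<Theta>_def RL P_def dP_def RG v_def)
    have Rg: "R.g m j = g m j x" for m j by (simp add: R.g_def g_def ll_def)
    have Rdg: "R.dg m j = dg m x j" for m j by (simp add: R.dg_def dg_def Rg RL ll_def)
    have RY: "R.Y m = dY m x" for m
      by (simp only: R.Y_def dY_def R.T_def R.\<Lambda>_def Rg R\<Theta> Rdg)
    have aa: "?w (da i x) (da j x) = 0" if "i < k" "j < k" for i j
    proof (rule bilinear_poly_zero[OF _ that])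
      fix y z
      have "?w (G x k y) (G x k z) = 0" using R.w_G_G[of y z] unfolding RG .
      then show "(\<Sum>i<k. \<Sum>j<k. y ^ i * z ^ j * ?w (da i x) (da j x)) = 0"
        unfolding G_da om_sum_left om_scale_left om_sum_right om_scale_right
        by (subst sum.swap) (simp add: sum_distrib_left ac_simps)
    qed
    have aY: "?w (da i x) (dY m x) = (if i = m then \<alpha> else 0) + (if i = m + 1 then \<beta> else 0)"
      if "i < k" "m + 1 < k" for i m
    proof (rule linear_poly_coeffs[OF _ that(2,1)])
      fix y
      have "?w (G x k y) (dY m x) = (\<alpha> + \<beta> * y) * y ^ m"
        using R.w_G_Y[OF that(2), of y] unfolding RG RY .
      then show "(\<Sum>i<k. y ^ i * ?w (da i x) (dY m x)) = (\<alpha> + \<beta> * y) * y ^ m"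
        unfolding G_da om_sum_left om_scale_left .
    qed
    have Ya: "?w (dY m x) (da i x) = - ((if i = m then \<alpha> else 0) + (if i = m + 1 then \<beta> else 0))"
      if "i < k" "m + 1 < k" for i m
      using R.w_skew[of "dY m x" "da i x"] aY[OF that] by simp
    have YY: "?w (dY m x) (dY r x) = 0" if "m + 1 < k" "r + 1 < k" for m r
      using R.w_Y_Y[OF that] unfolding RY .
    have big: "c i - k + 1 < k" "c i = (c i - k) + k" if "\<not> c i < k" for i
      using c_less[OF c, of i] that by auto
    show ?thesis
    proof (cases "c i < k"; cases "c j < k")
      assume "c i < k" "c j < k"
      then show ?thesis using aa by (simp add: dF_def kron1_def kron2_def)
    next
      assume ij: "c i < k" "\<not> c j < k"
      define m where "m = c j - k"
      have m: "c j = m + k" "m + 1 < k" using big[OF ij(2)] by (auto simp: m_def)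
      show ?thesis using ij aY[OF ij(1) m(2)] m by (auto simp: dF_def kron1_def kron2_def)
    next
      assume ij: "\<not> c i < k" "c j < k"
      define m where "m = c i - k"
      have m: "c i = m + k" "m + 1 < k" using big[OF ij(1)] by (auto simp: m_def)
      show ?thesis using ij Ya[OF ij(2) m(2)] m by (auto simp: dF_def kron1_def kron2_def)
    next
      assume ij: "\<not> c i < k" "\<not> c j < k"
      then show ?thesis using YY[OF big(1)[OF ij(1)] big(1)[OF ij(2)]]
        by (simp add: dF_def kron1_def kron2_def)
    qed
  qed
  \<comment> \<open>Independence is read off from the brackets: a linear relation between the
    differentials lies in the kernel of every member of the constant pencil. For
    \<open>k > 1\<close> the kernels at \<open>t = 0\<close> and \<open>t = 1\<close> meet only in
    zero. For \<open>k = 1\<close> both brackets vanish, and the differential is computed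
    directly.\<close>
  have inv: "invertible (\<chi> i. grad (F i) x)" if x: "x \<in> W1" for x
  proof -
    define A where "A = (\<chi> i. grad (F i) x)"
    have row: "row i A = dF i x" for i
      using has_grad_grad[OF gF[OF x]] by (simp add: A_def row_def vec_eq_iff)
    have "u i = 0" if u: "(\<Sum>i\<in>UNIV. u i *s dF i x) = 0" for u i
    proof -
      define uu where "uu = (\<chi> i. u i)"
      have ker: "uu $ inv c m = (if m < k then t ^ m * uu $ inv c 0 else 0)" if "m < 2 * k - 1" for m t
      proof (rule kron_pencil_kernel[OF c _ that])
        fix j
        have "om (\<lambda>i j. kron2 k (c i) (c j) - t * kron1 k (c i) (c j)) (axis j 1) uu
            = (\<Sum>i\<in>UNIV. u i * om (toda_pencil c (- t) 1 x) (dF j x) (dF i x))"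
          unfolding om_axis_left br[OF x] uu_def by (rule sum.cong) (simp_all add: algebra_simps)
        also have "\<dots> = om (toda_pencil c (- t) 1 x) (dF j x) (\<Sum>i\<in>UNIV. u i *s dF i x)"
          by (simp add: om_sum_right)
        finally show "om (\<lambda>i j. kron2 k (c i) (c j) - t * kron1 k (c i) (c j)) (axis j 1) uu = 0"
          by (simp add: u)
      qed
      have "uu $ inv c 0 = 0"
      proof (cases n)
        case 0
        then have k: "k = 1" using kn by simp
        then have c0: "c i = 0" for i using c_less[OF c, of i] by simp
        define i0 where "i0 = inv c 0"
        have "i = i0" for i using inv_c[OF c, of i] unfolding c0 i0_def by simp
        then have U: "(UNIV :: 'n set) = {i0}" by auto
        have "dF i0 x = - e 0"
          using G_da[of x 0] by (simp add: dF_def c0 k G_def)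
        then have "u i0 *s (- e 0) = 0"
          using u unfolding U by simp
        then have "(u i0 *s (- e 0)) $ i0 = 0" by (simp only: zero_index)
        then show ?thesis by (simp add: uu_def e_def i0_def axis_def)
      next
        case (Suc r)
        then show ?thesis using ker[of 1 0] ker[of 1 1] kn by simp
      qed
      then have "uu $ inv c (c i) = 0" using ker[OF c_less[OF c, of i], of 0] by simp
      then show ?thesis using inv_c[OF c, of i] by (simp add: uu_def)
    qed
    then have "\<exists>B. A ** B = mat 1"
      unfolding matrix_right_invertible_independent_rows row by blast
    then show ?thesis
      unfolding A_def[symmetric] invertible_def by (metis matrix_left_right_inverse)
  qed
  have "toda_chart c k W1 F"
    unfolding toda_chart_def
  proof (intro conjI allI ballI)
    show "holo W1 (F i)" for i by (rule holoI) (blast intro: gF)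
    fix x \<alpha> \<beta> i j assume "x \<in> W1"
    then show "bracket UNIV (toda_pencil c \<alpha> \<beta>) (F i) (F j) x = \<alpha> * kron1 k (c i) (c j) + \<beta> * kron2 k (c i) (c j)"
      by (simp add: bracket_om has_grad_grad[OF gF] br)
  qed (use openW1 inv in auto)
  then show ?thesis using x0W1 by blast
qed

section \<open>Generic points\<close>

lemma toda_poly_cong:
  "(\<And>m. m < 2 * n - 1 \<Longrightarrow> v m = v' m) \<Longrightarrow> toda_poly v n = toda_poly v' n"
proof (induction n rule: induct_nat_012)
  case (ge2 n)
  have "toda_poly v n = toda_poly v' n" "toda_poly v (Suc n) = toda_poly v' (Suc n)"
    by (intro ge2.IH ge2.prems; simp)+
  then show ?case using ge2.prems[of "2 * n + 1"] ge2.prems[of "2 * n + 2"] by simp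
qed auto

lemma toda_poly_shift:
  assumes "\<And>m. m < 2 * n \<Longrightarrow> v' m = v m" "v' (2 * n) = v (2 * n) + t"
  shows "toda_poly v' (Suc n) = toda_poly v (Suc n) - smult t (toda_poly v n)"
proof (cases n)
  case 0
  then show ?thesis using assms by simp
next
  case (Suc m)
  have "toda_poly v' (Suc m) = toda_poly v (Suc m)" "toda_poly v' m = toda_poly v m"
    by (rule toda_poly_cong; use assms(1) Suc in simp)+
  then show ?thesis using assms(1)[of "2 * m + 1"] assms(2) Suc
    by (simp add: algebra_simps smult_add_left smult_diff_left)
qed

lemma distinct_roots_exist:
  fixes q :: "complex poly"
  assumes "\<And>z. poly q z = 0 \<Longrightarrow> poly (pderiv q) z \<noteq> 0"
  shows "\<exists>l. inj_on l {..<degree q} \<and> (\<forall>j<degree q. poly q (l j) = 0)"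
proof -
  let ?R = "{z. poly q z = 0}"
  have sf: "rsquarefree q" using assms by (auto simp: rsquarefree_roots)
  then have q0: "q \<noteq> 0" by (simp add: rsquarefree_def)
  then have fin: "finite ?R" by (rule poly_roots_finite)
  have "degree q = degree (smult (lead_coeff q) (\<Prod>z\<in>?R. [:- z, 1:]))"
    using complex_poly_decompose_rsquarefree[OF sf] by simp
  also have "\<dots> = card ?R"
    using q0 by (simp add: degree_prod_eq_sum_degree)
  finally have "card ?R = degree q" ..
  then obtain l where "bij_betw l {0..<degree q} ?R"
    using ex_bij_betw_nat_finite[OF fin] by metis
  then show ?thesis
    by (intro exI[of _ l]) (auto simp: bij_betw_def atLeast0LessThan)
qed

text \<open>The coefficient of degree \<open>n + n\<close> is \<open>(n + 1) - n = 1\<close>. Hence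
  q/p has only finitely many critical points.\<close>

lemma wronskian_nonzero:
  fixes q p :: "complex poly"
  assumes "degree q = Suc n" "lead_coeff q = 1" "degree p = n" "lead_coeff p = 1"
  shows "pderiv q * p - q * pderiv p \<noteq> 0"
proof -
  have 1: "coeff q (Suc n) = 1" "coeff p n = 1" using assms by metis+
  have "degree (pderiv q) = n" using assms by (simp add: degree_pderiv)
  then have "coeff (pderiv q * p) (n + n) = of_nat (Suc n)"
    using coeff_mult_degree_sum[of "pderiv q" p] assms 1 by (simp add: coeff_pderiv)
  moreover have "coeff (q * pderiv p) (n + n) = of_nat n"
  proof (cases n)
    case 0
    then have "pderiv p = 0" using assms by (simp add: pderiv_eq_0_iff)
    then show ?thesis using 0 by simp
  next
    case (Suc m)
    have "degree (pderiv p) = m" using assms Suc by (simp add: degree_pderiv)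
    then have "coeff (q * pderiv p) (Suc n + m) = of_nat n"
      using coeff_mult_degree_sum[of q "pderiv p"] assms 1 Suc by (simp add: coeff_pderiv)
    then show ?thesis using Suc by simp
  qed
  ultimately have "coeff (pderiv q * p - q * pderiv p) (n + n) = 1" by simp
  then show ?thesis by auto
qed

lemma small_scalar_avoiding_finite:
  fixes T :: "complex set"
  assumes "finite T" "0 < e"
  shows "\<exists>t. cmod t < e \<and> t \<notin> T"
proof -
  have "infinite (ball (0::complex) e)"
    using assms(2) by (metis ball_eq_empty finite_imp_not_open linorder_not_less open_ball)
  then obtain t where "t \<in> ball 0 e" "t \<notin> T"
    using assms(1) by (meson finite_subset subsetI)
  then show ?thesis by (auto intro!: exI[of _ t])
qed

definition toda_generic :: "('n::finite \<Rightarrow> nat) \<Rightarrow> nat \<Rightarrow> (complex^'n) set" where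
  "toda_generic c n = {x. (\<forall>m<n. x $ inv c (2 * m + 1) \<noteq> 0) \<and>
     (\<exists>l. inj_on l {..<Suc n} \<and> (\<forall>j<Suc n. poly (toda_poly (\<lambda>m. x $ inv c m) (Suc n)) (l j) = 0))}"

text \<open>Changing the last diagonal entry of the Jacobi matrix by \<open>t\<close> replaces its characteristic polynomial \<open>q\<close> by
  \<open>q - t p\<close>. Since \<open>p\<close> and \<open>q\<close> are coprime, a multiple root of \<open>q - t p\<close> is a critical point of \<open>q / p\<close>
  with critical value \<open>t\<close>, so it occurs for finitely many \<open>t\<close> only.\<close>

lemma closure_toda_generic:
  fixes c :: "'n::finite \<Rightarrow> nat"
  assumes c: "bij_betw c UNIV {..<2 * Suc n - 1}"
  shows "closure (toda_generic c n) = UNIV"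
proof -
  \<comment> \<open>Density in two stages: nonzero off-diagonal entries come first, since
    coprimality of p and q relies on them when the roots are separated.\<close>
  define S where "S = {x :: complex^'n. \<forall>m<n. x $ inv c (2 * m + 1) \<noteq> 0}"
  have "x \<in> closure S" for x
    unfolding closure_approachable
  proof (intro allI impI)
    fix e :: real assume e: "0 < e"
    \<comment> \<open>Shifting all coordinates by the same small number leaves just finitely many
      values to avoid.\<close>
    define u :: "complex^'n" where "u = (\<chi> i. 1)"
    have u: "norm u > 0" by (simp add: u_def vec_eq_iff)
    obtain t where t: "cmod t < e / norm u" "t \<notin> (\<lambda>i. - x $ i) ` UNIV"
      using small_scalar_avoiding_finite[of "(\<lambda>i. - x $ i) ` UNIV" "e / norm u"] e u by auto
    have "(x + t *s u) $ i \<noteq> 0" for i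
      using t(2) by (auto simp: u_def image_iff eq_neg_iff_add_eq_0 add.commute)
    then have "x + t *s u \<in> S" by (simp add: S_def)
    moreover have "dist (x + t *s u) x < e"
      using t(1) u by (simp add: dist_norm norm_vector_scalar_mult field_simps)
    ultimately show "\<exists>y\<in>S. dist y x < e" by blast
  qed
  then have S: "closure S = UNIV" by blast
  have "S \<subseteq> closure (toda_generic c n)"
  proof
    fix x assume x: "x \<in> S"
    define v where "v = (\<lambda>m. x $ inv c m)"
    define q where "q = toda_poly v (Suc n)"
    define p where "p = toda_poly v n"
    have deg: "degree q = Suc n" "lead_coeff q = 1" "degree p = n" "lead_coeff p = 1"
      unfolding q_def p_def by (rule conjunct1[OF toda_poly_degree] conjunct2[OF toda_poly_degree])+
    define r where "r = pderiv q * p - q * pderiv p"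
    define T where "T = (\<lambda>z. poly q z / poly p z) ` {z. poly r z = 0}"
    have "finite T"
      unfolding T_def r_def by (intro finite_imageI poly_roots_finite wronskian_nonzero[OF deg])
    have "x + axis (inv c (2 * n)) t \<in> toda_generic c n" if t: "t \<notin> T" for t
    proof -
      define y where "y = x + axis (inv c (2 * n)) t"
      have y: "y $ inv c m = v m" if "m < 2 * n" for m
      proof -
        have "inv c m \<noteq> inv c (2 * n)"
          using that c_inv[OF c, of m] c_inv[OF c, of "2 * n"] by auto
        then show ?thesis by (simp add: y_def v_def axis_def)
      qed
      have "toda_poly (\<lambda>m. y $ inv c m) (Suc n) = q - smult t p"
        unfolding q_def p_def by (rule toda_poly_shift) (use y in \<open>auto simp: y_def v_def\<close>)
      moreover have "\<exists>l. inj_on l {..<degree (q - smult t p)} \<and> (\<forall>j<degree (q - smult t p). poly (q - smult t p) (l j) = 0)"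
      proof (rule distinct_roots_exist, rule notI)
        fix z assume z: "poly (q - smult t p) z = 0" "poly (pderiv (q - smult t p)) z = 0"
        then have 1: "poly q z = t * poly p z" "poly (pderiv q) z = t * poly (pderiv p) z"
          by (auto simp: pderiv_diff pderiv_smult)
        then have "poly r z = 0" by (simp add: r_def)
        moreover have "poly p z \<noteq> 0"
          using toda_poly_coprime[of n v z] x 1(1) by (auto simp: S_def v_def q_def p_def)
        ultimately have "t \<in> T" using 1(1) by (auto simp: T_def image_iff intro!: exI[of _ z])
        then show False using t by simp
      qed
      moreover have "degree (toda_poly (\<lambda>m. y $ inv c m) (Suc n)) = Suc n"
        using toda_poly_degree by blast
      moreover have "\<forall>m<n. y $ inv c (2 * m + 1) \<noteq> 0"
        using y x by (simp add: S_def v_def)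
      ultimately show ?thesis
        unfolding toda_generic_def y_def[symmetric] by simp
    qed
    then show "x \<in> closure (toda_generic c n)"
      unfolding closure_approachable
      using small_scalar_avoiding_finite[OF \<open>finite T\<close>] by (metis add_diff_cancel_left' dist_norm norm_axis_cplx)
  qed
  then have "closure S \<subseteq> closure (toda_generic c n)" by (rule closure_minimal) simp
  then show ?thesis using S by blast
qed

section \<open>The Jacobi identity by density\<close>

lemma holo_add: "open U \<Longrightarrow> holo U f \<Longrightarrow> holo U g \<Longrightarrow> holo U (\<lambda>x. f x + g x)"
  by (rule holoI) (blast intro: has_grad_add holo_has_grad)

lemma holo_diff: "open U \<Longrightarrow> holo U f \<Longrightarrow> holo U g \<Longrightarrow> holo U (\<lambda>x. f x - g x)"
  by (rule holoI) (blast intro: has_grad_diff holo_has_grad)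

lemma holo_mult: "open U \<Longrightarrow> holo U f \<Longrightarrow> holo U g \<Longrightarrow> holo U (\<lambda>x. f x * g x)"
  by (rule holoI) (blast intro: has_grad_mult holo_has_grad)

lemma holo_uminus: "open U \<Longrightarrow> holo U f \<Longrightarrow> holo U (\<lambda>x. - f x)"
  by (rule holoI) (blast intro: has_grad_uminus holo_has_grad)

lemma holo_nth: "holo U (\<lambda>x. x $ i)"
  by (rule holoI) (blast intro: has_grad_nth)

lemma holo_If: "(b \<Longrightarrow> holo U f) \<Longrightarrow> (\<not> b \<Longrightarrow> holo U g) \<Longrightarrow> holo U (\<lambda>x. if b then f x else g x)"
  by (cases b) simp_all

lemma holo_toda_pencil: "holo UNIV (\<lambda>x. toda_pencil c \<alpha> \<beta> x i j)"
  unfolding toda_pencil_def toda1_def toda2_def Let_def toda_table1_def toda_table2_def power2_eq_square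
  by (intro holo_add holo_diff holo_mult holo_uminus holo_nth holo_const holo_If open_UNIV)

lemma continuous_on_jac:
  assumes "\<And>i j. holo UNIV (\<lambda>x. P x i j)"
  shows "continuous_on UNIV (\<lambda>x. jac P x a b c)"
  unfolding jac_def
  by (intro continuous_intros continuous_on_pd holo_continuous_on assms open_UNIV)

lemma toda_generic_chart:
  assumes "bij_betw c UNIV {..<2 * Suc n - 1}" "x \<in> toda_generic c n"
  shows "\<exists>W F. x \<in> W \<and> toda_chart c (Suc n) W F"
proof -
  obtain l where "inj_on l {..<Suc n}" "\<forall>j<Suc n. poly (toda_poly (\<lambda>m. x $ inv c m) (Suc n)) (l j) = 0"
    "\<forall>m<n. x $ inv c (2 * m + 1) \<noteq> 0"
    using assms(2) unfolding toda_generic_def by blast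
  then show ?thesis using toda_chart_exists[OF assms(1) refl, of x l] by blast
qed

lemma jac_toda_pencil:
  assumes c: "bij_betw c UNIV {..<2 * Suc n - 1}"
  shows "jac (toda_pencil c \<alpha> \<beta>) x a b d = 0"
proof -
  have "jac (toda_pencil c \<alpha> \<beta>) y a b d = 0" if y: "y \<in> toda_generic c n" for y
  proof -
    obtain W F where W: "y \<in> W" and ch: "toda_chart c (Suc n) W F"
      using toda_generic_chart[OF c y] by blast
    show ?thesis
      by (rule jac_zero_of_chart[of W y "toda_pencil c \<alpha> \<beta>" F])
        (use W ch toda_pencil_skew holo_subset[OF holo_toda_pencil] in \<open>auto simp: toda_chart_def\<close>)
  qed
  then have "toda_generic c n \<subseteq> {y. jac (toda_pencil c \<alpha> \<beta>) y a b d = 0}" by blast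
  moreover have "closed {y. jac (toda_pencil c \<alpha> \<beta>) y a b d = 0}"
    by (intro closed_Collect_eq continuous_on_jac holo_toda_pencil continuous_on_const)
  ultimately have "closure (toda_generic c n) \<subseteq> {y. jac (toda_pencil c \<alpha> \<beta>) y a b d = 0}"
    by (rule closure_minimal)
  then show ?thesis using closure_toda_generic[OF c] by blast
qed

lemma bihamiltonian_toda:
  assumes c: "bij_betw c UNIV {..<2 * Suc n - 1}" and U: "open U"
  shows "bihamiltonian UNIV U (toda1 c) (toda2 c)"
proof -
  have p: "poisson_on UNIV U (toda_pencil c \<alpha> \<beta>)" for \<alpha> \<beta>
    by (rule poisson_onI[OF U holo_subset[OF holo_toda_pencil] toda_pencil_skew jac_toda_pencil[OF c]]) simp
  have "toda_pencil c 1 0 = toda1 c" "toda_pencil c 0 1 = toda2 c"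
    by (simp_all add: fun_eq_iff toda_pencil_def)
  then have "poisson_on UNIV U (toda1 c)" "poisson_on UNIV U (toda2 c)"
    using p[of 1 0] p[of 0 1] by simp_all
  moreover have "poisson_on UNIV U (\<lambda>x i j. a * toda1 c x i j + b * toda2 c x i j)" for a b
    using p[of a b] unfolding toda_pencil_def[abs_def] .
  ultimately show ?thesis
    using U unfolding bihamiltonian_def by simp
qed

section \<open>Local isomorphisms with the Kronecker block\<close>

lemma toda_chart_locally_isomorphic:
  fixes c :: "'n::finite \<Rightarrow> nat"
  assumes ch: "toda_chart c k W F" and x: "x \<in> W" "W \<subseteq> U"
  shows "locally_isomorphic_at UNIV x U (toda1 c) (toda2 c)
    UNIV (\<lambda>x i j. kron1 k (c i) (c j)) (\<lambda>x i j. kron2 k (c i) (c j))"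
proof -
  define \<phi> where "\<phi> y = (\<chi> i. F i y)" for y
  have W: "open W" and hol: "\<And>i. holo W (\<lambda>y. \<phi> y $ i)"
    and inv: "invertible (\<chi> i. grad (\<lambda>y. \<phi> y $ i) x)"
    using ch x unfolding toda_chart_def \<phi>_def by auto
  obtain U' V where UV: "open U'" "x \<in> U'" "U' \<subseteq> W" "open V" "bij_betw \<phi> U' V"
    "\<And>i. holo V (\<lambda>y. inv_into U' \<phi> y $ i)"
    using holo_inverse_function[OF W x(1) hol inv] by metis
  have br: "bracket UNIV (toda_pencil c \<alpha> \<beta>) (\<lambda>y. \<phi> y $ i) (\<lambda>y. \<phi> y $ j) y
      = \<alpha> * kron1 k (c i) (c j) + \<beta> * kron2 k (c i) (c j)" if "y \<in> U'" for \<alpha> \<beta> i j y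
    using ch that UV(3) unfolding toda_chart_def \<phi>_def by auto
  have t: "toda_pencil c 1 0 = toda1 c" "toda_pencil c 0 1 = toda2 c"
    by (simp_all add: fun_eq_iff toda_pencil_def)
  have "preserves_bracket UNIV \<phi> U' (toda1 c) V (\<lambda>x i j. kron1 k (c i) (c j))"
    by (rule preserves_bracketI[OF UV(1) holo_subset[OF hol UV(3)]])
      (use br[of _ 1 0] t in simp)
  moreover have "preserves_bracket UNIV \<phi> U' (toda2 c) V (\<lambda>x i j. kron2 k (c i) (c j))"
    by (rule preserves_bracketI[OF UV(1) holo_subset[OF hol UV(3)]])
      (use br[of _ 0 1] t in simp)
  ultimately have "biham_iso UNIV \<phi> U' (toda1 c) (toda2 c) V (\<lambda>x i j. kron1 k (c i) (c j)) (\<lambda>x i j. kron2 k (c i) (c j))"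
    unfolding biham_iso_def open_dom_UNIV using UV holo_subset[OF hol UV(3)] by simp
  then show ?thesis
    unfolding locally_isomorphic_at_def using UV x(2) by blast
qed

theorem theorem12p4:
  fixes k :: nat and c :: "'n::finite \<Rightarrow> nat"
  assumes "1 \<le> k"
    and "bij_betw c UNIV {..<2 * k - 1}"
  shows "bihamiltonian UNIV UNIV (toda1 c) (toda2 c) \<and>
    (\<exists>U. open U \<and> closure U = UNIV \<and>
      kronecker_of_type [2 * k - 1] UNIV U (toda1 c) (toda2 c))"
proof -
  obtain n where k: "k = Suc n" using assms(1) by (cases k) auto
  have c: "bij_betw c UNIV {..<2 * Suc n - 1}" using assms(2) k by simp
  \<comment> \<open>The union of all chart domains is open at once; its density comes from the
    generic points it contains.\<close>
  define U where "U = \<Union> {W. \<exists>F. toda_chart c k W F}"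
  have "open U" unfolding U_def by (auto simp: toda_chart_def)
  have "toda_generic c n \<subseteq> U"
    using toda_generic_chart[OF c] k unfolding U_def by blast
  then have "closure U = UNIV"
    using closure_toda_generic[OF c] closure_mono by blast
  let ?A = "\<lambda>m. (\<lambda>x i j. kron1 k (c i) (c j)) :: 'n tensor" and ?B = "\<lambda>m. (\<lambda>x i j. kron2 k (c i) (c j)) :: 'n tensor"
  have card: "CARD('n) = 2 * k - 1" using bij_betw_same_card[OF assms(2)] by simp
  \<comment> \<open>The type has a single block, so the product domain and tensors collapse to those
    of the block.\<close>
  have dom: "prod_dom [UNIV] (\<lambda>m. cspace ([UNIV] ! m)) = (UNIV :: (complex^'n) set)"
    by (auto simp: prod_dom_def)
  have tens: "prod_tensor [UNIV] (\<lambda>m x. M) = (\<lambda>x. M)" for M :: "'n \<Rightarrow> 'n \<Rightarrow> complex"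
    by (simp add: prod_tensor_def fun_eq_iff)
  have "kronecker_of_type [2 * k - 1] UNIV U (toda1 c) (toda2 c)"
    unfolding kronecker_of_type_def
  proof (intro conjI ballI)
    show "bihamiltonian UNIV U (toda1 c) (toda2 c)"
      by (rule bihamiltonian_toda[OF c \<open>open U\<close>])
    fix x assume "x \<in> U"
    then obtain W F where W: "x \<in> W" "W \<subseteq> U" and ch: "toda_chart c k W F"
      unfolding U_def by blast
    have "index_partition (UNIV :: 'n set) [UNIV]" by (simp add: index_partition_def)
    moreover have "odd (2 * k - 1)" using assms(1) by simp
    moreover have "bihamiltonian UNIV UNIV (?A 0) (?B 0)"
      by (rule bihamiltonian_const) (rule kron1_skew kron2_skew)+
    moreover have "translation_invariant UNIV (?A 0) (?B 0)"
      by (rule translation_invariant_const)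
    moreover have "locally_isomorphic_at UNIV x U (toda1 c) (toda2 c)
        (prod_dom [UNIV] (\<lambda>m. cspace ([UNIV] ! m))) (prod_tensor [UNIV] ?A) (prod_tensor [UNIV] ?B)"
      unfolding dom tens by (rule toda_chart_locally_isomorphic[OF ch W])
    ultimately show "\<exists>Is As Bs. length Is = length [2 * k - 1] \<and> index_partition UNIV Is \<and>
        (\<forall>m<length [2 * k - 1].
           card (Is ! m) = [2 * k - 1] ! m \<and> odd ([2 * k - 1] ! m) \<and>
           bihamiltonian (Is ! m) (cspace (Is ! m)) (As m) (Bs m) \<and>
           translation_invariant (Is ! m) (As m) (Bs m) \<and>
           \<not> decomposable (Is ! m) (cspace (Is ! m)) (As m) (Bs m)) \<and>
        locally_isomorphic_at UNIV x U (toda1 c) (toda2 c)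
          (prod_dom Is (\<lambda>m. cspace (Is ! m))) (prod_tensor Is As) (prod_tensor Is Bs)"
      using kron_not_decomposable[OF assms(2)] card
      by (intro exI[of _ "[UNIV]"] exI[of _ ?A] exI[of _ ?B]) simp
  qed
  then show ?thesis
    using bihamiltonian_toda[OF c open_UNIV] \<open>open U\<close> \<open>closure U = UNIV\<close> by blast
qed

end
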